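(* For every $d\in\mathbb{N}$, the space $\mathcal{O}_M=\mathcal{O}_M(\mathbb{R}^d)$ of slowly increasing functions on $\mathbb{R}^d$ is a bornological locally convex space.
   Context: Here $\mathbb{N}=\{1,2,3,\dots\}$, $\mathbb{N}_0=\mathbb{N}\cup\{0\}$, and $\langle x\rangle=1+|x|^2$ for $x\in\mathbb{R}^d$. Functions are complex valued. The space of slowly increasing functions (multipliers of temperate distributions) is $$\mathcal{O}_M=\{f\in\mathcal{C}^\infty(\mathbb{R}^d) : \forall\alpha\in\mathbb{N}_0^d\ \exists N\in\mathbb{N}:\ \langle x\rangle^{-N}\partial^\alpha f\in L^\infty\}.$$ Its locally convex topology is that of the projective limit of LB-spaces $$\mathcal{O}_M=\bigcap_{n\in\mathbb{N}}X_n,\qquad X_n=\bigcup_{N\in\mathbb{N}}X_{n,N},$$ where $$X_{n,N}=\Big\{f\in\mathcal{C}^n(\mathbb{R}^d) : \|f\|_{n,N}=\sup_{x\in\mathbb{R}^d,\ |\alpha|\le n}\langle x\rangle^{-N}|\partial^\alpha f(x)|<\infty\Big\}$$ is a Banach space with norm $\|\cdot\|_{n,N}$, each $X_n$ carries the locally convex inductive limit topology of the spaces $X_{n,N}$ ($N\in\mathbb{N}$), and the intersection carries the projective limit topology (the coarsest topology making all inclusions $\mathcal{O}_M\hookrightarrow X_n$ continuous). A locally convex space is bornological if every absolutely convex subset that absorbs all bounded sets is a neighbourhood of $0$. *)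

theory Defs
  imports "HOL-Analysis.Analysis" "HOL-Library.Function_Algebras"
begin

section \<open>Locally convex topologies on subspaces of a complex vector space\<close>

locale complex_vector_space = vector_space scale
  for scale :: "complex \<Rightarrow> 'v::ab_group_add \<Rightarrow> 'v"
begin

definition absolutely_convex :: "'v set \<Rightarrow> bool" where
  "absolutely_convex A \<longleftrightarrow>
     (\<forall>x\<in>A. \<forall>y\<in>A. \<forall>a b. norm a + norm b \<le> 1 \<longrightarrow> scale a x + scale b y \<in> A)"

definition nbhd_zero :: "'v topology \<Rightarrow> 'v set \<Rightarrow> bool" where
  "nbhd_zero T U \<longleftrightarrow> U \<subseteq> topspace T \<and> (\<exists>W. openin T W \<and> 0 \<in> W \<and> W \<subseteq> U)"

definition locally_convex_space :: "'v set \<Rightarrow> 'v topology \<Rightarrow> bool" where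
  "locally_convex_space V T \<longleftrightarrow>
     subspace V \<and> topspace T = V \<and>
     continuous_map (prod_topology T T) T (\<lambda>(x, y). x + y) \<and>
     continuous_map (prod_topology euclidean T) T (\<lambda>(c, x). scale c x) \<and>
     (\<forall>U. nbhd_zero T U \<longrightarrow> (\<exists>W. absolutely_convex W \<and> nbhd_zero T W \<and> W \<subseteq> U))"

definition absorbs :: "'v set \<Rightarrow> 'v set \<Rightarrow> bool" where
  "absorbs A B \<longleftrightarrow> (\<exists>r>0. \<forall>c. norm c \<ge> r \<longrightarrow> B \<subseteq> scale c ` A)"

definition bounded_in :: "'v topology \<Rightarrow> 'v set \<Rightarrow> bool" where
  "bounded_in T B \<longleftrightarrow> B \<subseteq> topspace T \<and> (\<forall>U. nbhd_zero T U \<longrightarrow> absorbs U B)"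

definition bornological :: "'v topology \<Rightarrow> bool" where
  "bornological T \<longleftrightarrow>
     (\<forall>A. A \<subseteq> topspace T \<and> absolutely_convex A \<and> (\<forall>B. bounded_in T B \<longrightarrow> absorbs A B)
        \<longrightarrow> nbhd_zero T A)"

text \<open>
  The finest locally convex topology on \<open>V\<close> for which all inclusions of the spaces \<open>E i\<close>,
  \<open>i \<in> I\<close>, are continuous, given as the supremum of all such topologies (a supremum of locally
  convex topologies is locally convex). Local convexity does not include the Hausdorff
  property, so the indiscrete topology on \<open>V\<close> is among them.
\<close>

definition lc_inductive_limit :: "'v set \<Rightarrow> 'i set \<Rightarrow> ('i \<Rightarrow> 'v topology) \<Rightarrow> 'v topology" where
  "lc_inductive_limit V I E = topology_generated_by
     {U. \<exists>T. locally_convex_space V T \<and> (\<forall>i\<in>I. continuous_map (E i) T (\<lambda>x. x)) \<and> openin T U}"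

end

text \<open>The coarsest topology on \<open>V\<close> for which all inclusions into the spaces \<open>E i\<close>,
  \<open>i \<in> I\<close>, are continuous.\<close>

definition projective_limit :: "'v set \<Rightarrow> 'i set \<Rightarrow> ('i \<Rightarrow> 'v topology) \<Rightarrow> 'v topology" where
  "projective_limit V I E = topology_generated_by {V \<inter> U |U. \<exists>i\<in>I. openin (E i) U}"

definition fscale :: "complex \<Rightarrow> ('x \<Rightarrow> complex) \<Rightarrow> 'x \<Rightarrow> complex" where
  "fscale c f = (\<lambda>x. c * f x)"

interpretation cfun: complex_vector_space fscale
  by unfold_locales (auto simp: fscale_def fun_eq_iff algebra_simps)


section \<open>Partial derivatives and functions of class \<open>C\<close>\<close>

definition partial :: "'d::finite \<Rightarrow> (real^'d \<Rightarrow> complex) \<Rightarrow> real^'d \<Rightarrow> complex" where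
  "partial i f x = vector_derivative (\<lambda>t. f (x + t *\<^sub>R axis i 1)) (at 0)"

definition has_partial :: "'d::finite \<Rightarrow> (real^'d \<Rightarrow> complex) \<Rightarrow> bool" where
  "has_partial i f \<longleftrightarrow> (\<forall>x. (\<lambda>t. f (x + t *\<^sub>R axis i 1)) differentiable at 0)"

primrec C_k :: "nat \<Rightarrow> (real^'d::finite \<Rightarrow> complex) \<Rightarrow> bool" where
  "C_k 0 f \<longleftrightarrow> continuous_on UNIV f"
| "C_k (Suc n) f \<longleftrightarrow> continuous_on UNIV f \<and> (\<forall>i. has_partial i f \<and> C_k n (partial i f))"

definition C_infinity :: "(real^'d::finite \<Rightarrow> complex) \<Rightarrow> bool" where
  "C_infinity f \<longleftrightarrow> (\<forall>n. C_k n f)"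

text \<open>
  The index type carries no order, so iterated partial derivatives are taken along a fixed but
  arbitrary enumeration of the coordinates. For functions of class \<open>C_k n\<close> and multi-indices
  of order at most \<open>n\<close> the enumeration is irrelevant.
\<close>

definition coords :: "'d::finite list" where
  "coords = (SOME is. distinct is \<and> set is = UNIV)"

definition mpartial :: "('d::finite \<Rightarrow> nat) \<Rightarrow> (real^'d \<Rightarrow> complex) \<Rightarrow> real^'d \<Rightarrow> complex" where
  "mpartial \<alpha> f = foldr (\<lambda>i. partial i ^^ \<alpha> i) coords f"

definition order_of :: "('d::finite \<Rightarrow> nat) \<Rightarrow> nat" where
  "order_of \<alpha> = (\<Sum>i\<in>UNIV. \<alpha> i)"


section \<open>The space of slowly increasing functions\<close>

definition bracket :: "real^'d::finite \<Rightarrow> real" where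
  "bracket x = 1 + (norm x)\<^sup>2"

definition L_infinity :: "(real^'d::finite \<Rightarrow> complex) set" where
  "L_infinity = {g \<in> borel_measurable lebesgue. \<exists>C. AE x in lebesgue. norm (g x) \<le> C}"

definition O_M :: "(real^'d::finite \<Rightarrow> complex) set" where
  "O_M = {f. C_infinity f \<and>
     (\<forall>\<alpha>. \<exists>N\<ge>1. (\<lambda>x. mpartial \<alpha> f x / complex_of_real (bracket x ^ N)) \<in> L_infinity)}"

definition weighted_values :: "nat \<Rightarrow> nat \<Rightarrow> (real^'d::finite \<Rightarrow> complex) \<Rightarrow> real set" where
  "weighted_values n N f = {norm (mpartial \<alpha> f x) / bracket x ^ N |x \<alpha>. order_of \<alpha> \<le> n}"

definition X_nN :: "nat \<Rightarrow> nat \<Rightarrow> (real^'d::finite \<Rightarrow> complex) set" where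
  "X_nN n N = {f. C_k n f \<and> bdd_above (weighted_values n N f)}"

definition norm_nN :: "nat \<Rightarrow> nat \<Rightarrow> (real^'d::finite \<Rightarrow> complex) \<Rightarrow> real" where
  "norm_nN n N f = Sup (weighted_values n N f)"

text \<open>The metric is set to \<open>0\<close> off \<open>X_nN n N\<close> because \<^locale>\<open>Metric_space\<close> requires symmetry
  and nonnegativity on the whole type.\<close>

definition dist_nN ::
    "nat \<Rightarrow> nat \<Rightarrow> (real^'d::finite \<Rightarrow> complex) \<Rightarrow> (real^'d \<Rightarrow> complex) \<Rightarrow> real" where
  "dist_nN n N f g = (if f \<in> X_nN n N \<and> g \<in> X_nN n N then norm_nN n N (f - g) else 0)"

definition top_nN :: "nat \<Rightarrow> nat \<Rightarrow> (real^'d::finite \<Rightarrow> complex) topology" where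
  "top_nN n N = Metric_space.mtopology (X_nN n N) (dist_nN n N)"

definition X_n :: "nat \<Rightarrow> (real^'d::finite \<Rightarrow> complex) set" where
  "X_n n = (\<Union>N\<in>{1..}. X_nN n N)"

definition top_n :: "nat \<Rightarrow> (real^'d::finite \<Rightarrow> complex) topology" where
  "top_n n = cfun.lc_inductive_limit (X_n n) {1..} (top_nN n)"

definition O_M_topology :: "(real^'d::finite \<Rightarrow> complex) topology" where
  "O_M_topology = projective_limit O_M {1..} top_n"

end

theory Submission
  imports Defs
begin

text \<open>
  Let \<open>A\<close> be absolutely convex and absorb all bounded sets, with gauge \<open>p\<close>. For every sequence \<open>N\<^sub>k\<close> the
  restriction of \<open>p\<close> to the Frechet space \<open>\<Inter>\<^sub>k X\<^bsub>k,N\<^sub>k\<^esub>\<close> is continuous, hence bounded by a multiple of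
  \<open>max {\<parallel>f\<parallel>\<^bsub>k,N\<^sub>k\<^esub> | k \<le> n}\<close> with \<open>n\<close> depending on the sequence. To make \<open>n\<close> uniform, cut \<open>f\<close> into pieces living
  where \<open>\<langle>x\<rangle>\<close> is of size \<open>4\<^sup>j\<close> and mollify each piece at a scale that is a power of \<open>4\<^bsup>-j\<^esup>\<close>: the remainder is
  controlled by the estimate for the sequence \<open>0\<close>, the smooth part by the estimate for a suitable linear
  sequence. This gives one \<open>n\<close> such that \<open>p\<close> is bounded by a multiple of \<open>\<parallel>f\<parallel>\<^bsub>n,N\<^esub>\<close> on \<open>O_M\<close> for every \<open>N\<close>. The
  supremum of \<open>p\<close> over mollifications then extends \<open>p\<close>, up to domination, to a continuous seminorm on \<open>X_n\<close>.
\<close>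

section \<open>Iterated partial derivatives\<close>

text \<open>The obstacle is the order of quantifiers. A neighbourhood of 0 has to come from one
  \<open>X_n\<close>, so \<open>n\<close> must be fixed before the growth exponent \<open>N\<close>,
  whereas continuity on Frechet spaces yields an order that depends on the whole sequence of
  exponents. The sequence 0 is the way out: on an annulus growth is only a factor (4^j)^N, and the
  remainder pays for this factor by the smallness of the mollification scale, at the cost of one
  derivative whatever \<open>N\<close> is. For the smooth part the order may depend on
  \<open>N\<close>, because it then affects constants only. The slope \<open>N + 1\<close> of the
  linear sequence pays for the factors lost through the derivatives and through the weight, and
  leaves 4^(-j) for the summation over the annuli. The second obstacle is that \<open>p\<close>
  lives on \<open>O_M\<close> only, while \<open>top_n\<close> is built from topologies on all of
  \<open>X_n\<close>, whose elements are merely C^n. Mollification is bounded on every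
  \<open>X_nN\<close> uniformly in the scale, so the supremum over the scales is finite; on
  \<open>O_M\<close> it dominates \<open>p\<close> because \<open>p\<close> of the mollification
  error tends to 0.\<close>

lemma has_partial_iff:
  "has_partial i f \<longleftrightarrow>
     (\<forall>x. ((\<lambda>t. f (x + t *\<^sub>R axis i 1)) has_vector_derivative partial i f x) (at 0))"
  unfolding has_partial_def partial_def
  by (simp add: vector_derivative_works)

lemma partialI:
  assumes "\<And>x. ((\<lambda>t. f (x + t *\<^sub>R axis i 1)) has_vector_derivative g x) (at 0)"
  shows "has_partial i f" "partial i f = g"
proof -
  show "partial i f = g"
    using assms by (auto simp: partial_def fun_eq_iff intro: vector_derivative_at)
  then show "has_partial i f"
    using assms by (simp add: has_partial_iff)
qed

text \<open>The definition differentiates at parameter 0 only. Moving the base point along the line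
  gives the derivative at every parameter \<open>s\<close>, as the fundamental theorem of calculus
  requires.\<close>

lemma has_partialD:
  assumes "has_partial i f"
  shows "((\<lambda>t. f (x + t *\<^sub>R axis i 1)) has_vector_derivative partial i f (x + s *\<^sub>R axis i 1)) (at s)"
proof -
  have "((\<lambda>t. f ((x + s *\<^sub>R axis i 1) + t *\<^sub>R axis i 1)) has_vector_derivative
      partial i f (x + s *\<^sub>R axis i 1)) (at (s - s))"
    using assms by (simp add: has_partial_iff)
  then have "(((\<lambda>t. f ((x + s *\<^sub>R axis i 1) + t *\<^sub>R axis i 1)) \<circ> (\<lambda>t. t - s)) has_vector_derivative
      (1 *\<^sub>R partial i f (x + s *\<^sub>R axis i 1))) (at s)"
    by (intro vector_diff_chain_at) (auto intro!: derivative_eq_intros simp: has_vector_derivative_def)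
  then show ?thesis
    by (simp add: o_def algebra_simps)
qed

lemma has_partialD':
  assumes "has_partial j f"
  shows "((\<lambda>s. f (x + s *\<^sub>R axis j 1 + y)) has_vector_derivative
           partial j f (x + s *\<^sub>R axis j 1 + y)) (at s)"
  using has_partialD[OF assms, of "x + y" s] by (simp add: add_ac)

text \<open>One Leibniz rule for two uses: with \<open>\<phi> = 1\<close> and
  \<open>\<delta> = 1\<close> it enters Clairaut's theorem, with a kernel on [-1,1] it
  differentiates a convolution.\<close>

lemma partial_integral:
  fixes f :: "real^'d::finite \<Rightarrow> complex" and \<phi> :: "real \<Rightarrow> real"
  assumes f: "continuous_on UNIV f" and pj: "has_partial j f"
    and pf: "continuous_on UNIV (partial j f)" and phi: "continuous_on {a..b} \<phi>"
  shows "((\<lambda>s. integral {a..b} (\<lambda>t. \<phi> t *\<^sub>R f (x + s *\<^sub>R axis j 1 + (\<delta> * t) *\<^sub>R axis i 1)))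
     has_vector_derivative integral {a..b} (\<lambda>t. \<phi> t *\<^sub>R partial j f (x + (\<delta> * t) *\<^sub>R axis i 1))) (at 0)"
proof -
  have 1: "((\<lambda>s. \<phi> t *\<^sub>R f (x + s *\<^sub>R axis j 1 + (\<delta> * t) *\<^sub>R axis i 1)) has_vector_derivative
       \<phi> t *\<^sub>R partial j f (x + s *\<^sub>R axis j 1 + (\<delta> * t) *\<^sub>R axis i 1)) (at s within UNIV)" for s t
    using has_partialD'[OF pj] by (auto intro: bounded_linear.has_vector_derivative[OF bounded_linear_scaleR_right])
  have 2: "(\<lambda>t. \<phi> t *\<^sub>R f (x + s *\<^sub>R axis j 1 + (\<delta> * t) *\<^sub>R axis i 1)) integrable_on cbox a b" for s
    using phi by (auto intro!: integrable_continuous_interval continuous_intros continuous_on_compose2[OF f])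
  have 3: "continuous_on (UNIV \<times> cbox a b)
      (\<lambda>(s, t). \<phi> t *\<^sub>R partial j f (x + s *\<^sub>R axis j 1 + (\<delta> * t) *\<^sub>R axis i 1))"
    by (auto simp: split_beta intro!: continuous_intros continuous_on_compose2[OF pf] continuous_on_compose2[OF phi])
  show ?thesis
    using leibniz_rule_vector_derivative[OF 1 2 3, of 0] by simp
qed

lemma continuous_integral_shift:
  fixes f :: "real^'d::finite \<Rightarrow> complex" and \<phi> :: "real \<Rightarrow> real"
  assumes f: "continuous_on UNIV f" and phi: "continuous_on {a..b} \<phi>"
  shows "continuous_on UNIV (\<lambda>x. integral {a..b} (\<lambda>t. \<phi> t *\<^sub>R f (x + (\<delta> * t) *\<^sub>R axis i 1)))"
proof -
  have "continuous_on (UNIV \<times> cbox a b) (\<lambda>(x, t). \<phi> t *\<^sub>R f (x + (\<delta> * t) *\<^sub>R axis i 1))"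
    by (auto simp: split_beta intro!: continuous_intros continuous_on_compose2[OF f] continuous_on_compose2[OF phi])
  from integral_continuous_on_param[OF this] show ?thesis by simp
qed

lemma C_k_continuous: "C_k n f \<Longrightarrow> continuous_on UNIV f"
  by (cases n) auto

lemma C_k_Suc_imp: "C_k (Suc n) f \<Longrightarrow> C_k n f"
  by (induction n arbitrary: f) auto

lemma C_k_mono: "m \<le> n \<Longrightarrow> C_k n f \<Longrightarrow> C_k m f"
  by (induction n rule: dec_induct) (auto dest: C_k_Suc_imp simp del: C_k.simps)

text \<open>Clairaut's theorem: differentiate \<open>f (x + \<tau> e\<^sub>i) - f x = \<integral>\<^sub>0\<^sup>\<tau> \<partial>\<^sub>i f (x + s e\<^sub>i) ds\<close> in the
  direction \<open>e\<^sub>j\<close> and then in \<open>\<tau>\<close>.\<close>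

lemma partial_commute:
  assumes "C_k (Suc (Suc 0)) f"
  shows "partial i (partial j f) = partial j (partial i f)"
proof
  fix x
  have c: "continuous_on UNIV f" "continuous_on UNIV (partial k f)" "continuous_on UNIV (partial l (partial k f))"
     "has_partial k f" "has_partial l (partial k f)" for k l
    using assms by auto
  have ftc: "integral {0..\<tau>} (\<lambda>s. 1 *\<^sub>R partial i f (y + (1 * s) *\<^sub>R axis i 1)) = f (y + \<tau> *\<^sub>R axis i 1) - f y"
    if "0 \<le> \<tau>" for y \<tau>
  proof -
    have "((\<lambda>s. partial i f (y + s *\<^sub>R axis i 1)) has_integral
        f (y + \<tau> *\<^sub>R axis i 1) - f (y + 0 *\<^sub>R axis i 1)) {0..\<tau>}"
      using that
      by (intro fundamental_theorem_of_calculus) (auto intro: has_vector_derivative_at_within[OF has_partialD[OF c(4)]])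
    then show ?thesis
      by (simp add: integral_unique)
  qed
  define H where "H s = partial j (partial i f) (x + s *\<^sub>R axis i 1)" for s
  have contH: "continuous_on {0..1} H"
    unfolding H_def by (intro continuous_intros continuous_on_compose2[OF c(3)]) auto
  have GH: "partial j f (x + \<tau> *\<^sub>R axis i 1) = partial j f x + integral {0..\<tau>} H" if "0 \<le> \<tau>" for \<tau>
  proof -
    have "((\<lambda>s. integral {0..\<tau>} (\<lambda>t. 1 *\<^sub>R partial i f (x + s *\<^sub>R axis j 1 + (1 * t) *\<^sub>R axis i 1)))
     has_vector_derivative integral {0..\<tau>} (\<lambda>t. 1 *\<^sub>R partial j (partial i f) (x + (1 * t) *\<^sub>R axis i 1))) (at 0)"
      by (intro partial_integral c) auto
    then have "((\<lambda>s. f (x + s *\<^sub>R axis j 1 + \<tau> *\<^sub>R axis i 1) - f (x + s *\<^sub>R axis j 1))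
       has_vector_derivative integral {0..\<tau>} H) (at 0)"
      unfolding ftc[OF that] by (simp add: H_def[abs_def])
    moreover have "((\<lambda>s. f (x + s *\<^sub>R axis j 1 + \<tau> *\<^sub>R axis i 1) - f (x + s *\<^sub>R axis j 1))
       has_vector_derivative partial j f (x + 0 *\<^sub>R axis j 1 + \<tau> *\<^sub>R axis i 1) - partial j f (x + 0 *\<^sub>R axis j 1)) (at 0)"
      by (intro has_vector_derivative_diff has_partialD' has_partialD c)
    ultimately show ?thesis
      by (auto dest: vector_derivative_unique_at)
  qed
  \<comment> \<open>\<open>GH\<close> holds for nonnegative \<open>\<tau>\<close> only, so both
    derivatives are taken within {0..1}, where they are still unique.\<close>
  have "((\<lambda>\<tau>. partial j f x + integral {0..\<tau>} H) has_vector_derivative 0 + H 0) (at 0 within {0..1})"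
    by (intro has_vector_derivative_add has_vector_derivative_const integral_has_vector_derivative contH) auto
  then have "((\<lambda>\<tau>. partial j f (x + \<tau> *\<^sub>R axis i 1)) has_vector_derivative 0 + H 0) (at 0 within {0..1})"
    by (rule has_vector_derivative_transform[rotated 2]) (auto simp: GH)
  moreover have "((\<lambda>\<tau>. partial j f (x + \<tau> *\<^sub>R axis i 1)) has_vector_derivative
      partial i (partial j f) (x + 0 *\<^sub>R axis i 1)) (at 0 within {0..1})"
    by (rule has_vector_derivative_at_within[OF has_partialD[OF c(5)]])
  ultimately have "0 + H 0 = partial i (partial j f) (x + 0 *\<^sub>R axis i 1)"
    by (rule vector_derivative_unique_within_closed_interval[where a = 0 and b = 1 and x = 0,
          unfolded cbox_interval, rotated 2]) simp_all
  then show "partial i (partial j f) x = partial j (partial i f) x"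
    by (simp add: H_def)
qed

section \<open>Derivatives along lists of directions and multi-indices\<close>

text \<open>The head of the list is the innermost derivative. Lists suit inductions that peel off
  one derivative; the fixed enumeration of coordinates in \<open>mpartial\<close> does not.\<close>

definition iter_partial :: "'d::finite list \<Rightarrow> (real^'d \<Rightarrow> complex) \<Rightarrow> real^'d \<Rightarrow> complex" where
  "iter_partial is f = fold partial is f"

lemma iter_partial_simps [simp]:
  "iter_partial [] f = f"
  "iter_partial (i # is) f = iter_partial is (partial i f)"
  "iter_partial (is @ js) f = iter_partial js (iter_partial is f)"
  by (simp_all add: iter_partial_def)

text \<open>Adjacent transpositions by \<open>partial_commute\<close>; the strict bound on the
  length leaves two orders of differentiability at each swap.\<close>

lemma iter_partial_move:
  assumes "C_k n f" "length is < n"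
  shows "iter_partial (is @ [i]) f = iter_partial (i # is) f"
  using assms
proof (induction "is" arbitrary: f n)
  case Nil
  then show ?case by simp
next
  case (Cons j js)
  then obtain m where n: "n = Suc m" by (cases n) auto
  have "iter_partial ((j # js) @ [i]) f = iter_partial (js @ [i]) (partial j f)"
    by simp
  also have "\<dots> = iter_partial (i # js) (partial j f)"
    using Cons.prems n by (intro Cons.IH[of m]) auto
  also have "\<dots> = iter_partial js (partial i (partial j f))"
    by simp
  also have "partial i (partial j f) = partial j (partial i f)"
    using Cons.prems by (intro partial_commute[OF C_k_mono[of _ n f]]) auto
  finally show ?case by simp
qed

lemma iter_partial_perm:
  assumes "C_k n f" "length is \<le> n" "mset is = mset js"
  shows "iter_partial is f = iter_partial js f"
  using assms
proof (induction "is" arbitrary: f n js)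
  case Nil
  then show ?case by simp
next
  case (Cons i "is")
  then obtain m where n: "n = Suc m" by (cases n) auto
  have "i \<in> set js"
    using Cons.prems(3) by (metis list.set_intros(1) set_mset_mset)
  then obtain as bs where js: "js = as @ i # bs"
    by (auto simp: in_set_conv_decomp)
  have ms: "mset is = mset (as @ bs)"
    using Cons.prems(3) js by simp
  have len: "length is = length as + length bs"
    using ms by (metis length_append mset_eq_length)
  have "iter_partial js f = iter_partial bs (iter_partial (as @ [i]) f)"
    by (simp add: js)
  also have "\<dots> = iter_partial bs (iter_partial (i # as) f)"
    using Cons.prems(1,2) len by (subst iter_partial_move[of n]) auto
  also have "\<dots> = iter_partial (as @ bs) (partial i f)"
    by simp
  also have "\<dots> = iter_partial is (partial i f)"
    using Cons.prems(1,2) ms n by (intro Cons.IH[of m, symmetric]) auto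
  finally show ?case by simp
qed

lemma coords: "distinct (coords :: 'd::finite list)" "set (coords :: 'd list) = UNIV"
proof -
  have "\<exists>is :: 'd list. distinct is \<and> set is = UNIV"
    by (metis finite_class.finite_UNIV finite_distinct_list)
  then have "distinct (coords :: 'd list) \<and> set (coords :: 'd list) = UNIV"
    unfolding coords_def by (rule someI_ex)
  then show "distinct (coords :: 'd list)" "set (coords :: 'd list) = UNIV" by auto
qed

lemma funpow_partial: "(partial i ^^ k) f = iter_partial (replicate k i) f"
  by (induction k arbitrary: f) (simp_all add: funpow_Suc_right del: funpow.simps)

lemma mpartial_eq_iter_partial:
  fixes \<alpha> :: "'d::finite \<Rightarrow> nat"
  shows "mpartial \<alpha> f = iter_partial (concat (map (\<lambda>i. replicate (\<alpha> i) i) (rev coords))) f"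
proof -
  have "foldr (\<lambda>i. partial i ^^ \<alpha> i) is f = iter_partial (concat (map (\<lambda>i. replicate (\<alpha> i) i) (rev is))) f"
    for "is" :: "'d list"
    by (induction "is") (simp_all add: funpow_partial)
  then show ?thesis by (simp add: mpartial_def)
qed

lemma sum_list_rev_coords: "sum_list (map g (rev coords :: 'd::finite list)) = (\<Sum>i\<in>UNIV. g i)"
  by (subst sum_list_distinct_conv_sum_set) (simp_all add: coords)

lemma mset_replicate_coords:
  fixes \<alpha> :: "'d::finite \<Rightarrow> nat"
  shows "count (mset (concat (map (\<lambda>i. replicate (\<alpha> i) i) (rev coords)))) j = \<alpha> j"
proof -
  have "count (mset (concat (map (\<lambda>i. replicate (\<alpha> i) i) is))) j = (\<Sum>i\<leftarrow>is. if i = j then \<alpha> i else 0)"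
    for "is" :: "'d list"
    by (induction "is") auto
  moreover have "(\<Sum>i\<leftarrow>rev coords. if i = j then \<alpha> i else 0) = (\<Sum>i\<in>UNIV. if i = j then \<alpha> i else 0)"
    by (rule sum_list_rev_coords)
  ultimately show ?thesis by simp
qed

lemma length_replicate_coords:
  fixes \<alpha> :: "'d::finite \<Rightarrow> nat"
  shows "length (concat (map (\<lambda>i. replicate (\<alpha> i) i) (rev coords))) = order_of \<alpha>"
proof -
  have "length (concat (map (\<lambda>i. replicate (\<alpha> i) i) is)) = sum_list (map \<alpha> is)" for "is" :: "'d list"
    by (induction "is") auto
  moreover have "sum_list (map \<alpha> (rev coords)) = order_of \<alpha>"
    unfolding order_of_def by (rule sum_list_rev_coords)
  ultimately show ?thesis by simp
qed

text \<open>Every list of at most \<open>n\<close> directions can be rearranged to the one behind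
  \<open>mpartial\<close>, so bounds over lists and bounds over multi-indices are
  interchangeable.\<close>

lemma mpartial_C_k:
  assumes "C_k n f" "length is \<le> n"
  shows "iter_partial is f = mpartial (count (mset is)) f" "order_of (count (mset is)) = length is"
proof -
  let ?js = "concat (map (\<lambda>i. replicate (count (mset is) i) i) (rev coords))"
  have ms: "mset is = mset ?js"
    by (intro multiset_eqI) (simp only: mset_replicate_coords)
  then show "iter_partial is f = mpartial (count (mset is)) f"
    unfolding mpartial_eq_iter_partial using assms by (intro iter_partial_perm)
  show "order_of (count (mset is)) = length is"
    using ms by (metis length_replicate_coords mset_eq_length)
qed

section \<open>Derivative bounds with a weight\<close>

text \<open>With the weight \<open>M * bracket x ^ N\<close> this says that the (n,N)-norm is at
  most \<open>M\<close>. The weight is an arbitrary function so that it can also record a support,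
  as it does for the cutoffs.\<close>

primrec bounded_C_k :: "nat \<Rightarrow> (real^'d::finite \<Rightarrow> real) \<Rightarrow> (real^'d \<Rightarrow> complex) \<Rightarrow> bool" where
  "bounded_C_k 0 w f \<longleftrightarrow> continuous_on UNIV f \<and> (\<forall>x. norm (f x) \<le> w x)"
| "bounded_C_k (Suc n) w f \<longleftrightarrow> continuous_on UNIV f \<and> (\<forall>x. norm (f x) \<le> w x) \<and>
     (\<forall>i. has_partial i f \<and> bounded_C_k n w (partial i f))"

lemma bounded_C_k_iff:
  fixes f :: "real^'d::finite \<Rightarrow> complex"
  shows "bounded_C_k n w f \<longleftrightarrow> C_k n f \<and> (\<forall>is x. length is \<le> n \<longrightarrow> norm (iter_partial is f x) \<le> w x)"
proof (induction n arbitrary: f)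
  case 0
  then show ?case by auto
next
  case (Suc n)
  have "(\<forall>is x. length is \<le> Suc n \<longrightarrow> norm (iter_partial is f x) \<le> w x) \<longleftrightarrow>
     (\<forall>x. norm (f x) \<le> w x) \<and> (\<forall>i is x. length is \<le> n \<longrightarrow> norm (iter_partial is (partial i f) x) \<le> w x)"
    (is "?L = ?R")
  proof
    assume L: ?L
    show ?R
    proof (intro conjI allI impI)
      fix x show "norm (f x) \<le> w x" using L[rule_format, of "[]"] by simp
    next
      fix i :: 'd and "is" :: "'d list" and x assume "length is \<le> n"
      then show "norm (iter_partial is (partial i f) x) \<le> w x"
        using L[rule_format, of "i # is"] by simp
    qed
  next
    assume R: ?R
    show ?L
    proof (intro allI impI)
      fix "is" :: "'d list" and x assume "length is \<le> Suc n"
      then show "norm (iter_partial is f x) \<le> w x"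
        using R by (cases "is") auto
    qed
  qed
  then show ?case
    by (auto simp: Suc)
qed

lemma bounded_C_k_mpartial:
  assumes "C_k n f"
  shows "bounded_C_k n w f \<longleftrightarrow> (\<forall>\<alpha> x. order_of \<alpha> \<le> n \<longrightarrow> norm (mpartial \<alpha> f x) \<le> w x)"
proof
  assume "bounded_C_k n w f"
  then show "\<forall>\<alpha> x. order_of \<alpha> \<le> n \<longrightarrow> norm (mpartial \<alpha> f x) \<le> w x"
    by (auto simp: bounded_C_k_iff mpartial_eq_iter_partial length_replicate_coords)
next
  assume *: "\<forall>\<alpha> x. order_of \<alpha> \<le> n \<longrightarrow> norm (mpartial \<alpha> f x) \<le> w x"
  show "bounded_C_k n w f"
    unfolding bounded_C_k_iff using assms * mpartial_C_k[OF assms] by simp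
qed

lemma bounded_C_k_C_k: "bounded_C_k n w f \<Longrightarrow> C_k n f"
  by (simp add: bounded_C_k_iff)

lemma bounded_C_k_continuous: "bounded_C_k n w f \<Longrightarrow> continuous_on UNIV f"
  by (cases n) auto

lemma bounded_C_k_norm: "bounded_C_k n w f \<Longrightarrow> norm (f x) \<le> w x"
  by (cases n) auto

lemma bounded_C_k_mono:
  fixes f :: "real^'d::finite \<Rightarrow> complex"
  assumes "bounded_C_k n w f" "\<And>x. w x \<le> v x" "m \<le> n"
  shows "bounded_C_k m v f"
  unfolding bounded_C_k_iff
proof (intro conjI allI impI)
  show "C_k m f"
    using assms C_k_mono bounded_C_k_C_k by blast
  fix "is" :: "'d list" and x assume "length is \<le> m"
  then have "norm (iter_partial is f x) \<le> w x"
    using assms by (auto simp: bounded_C_k_iff)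
  then show "norm (iter_partial is f x) \<le> v x"
    using assms(2)[of x] by simp
qed

lemma partial_add:
  assumes "has_partial i f" "has_partial i g"
  shows "has_partial i (f + g)" "partial i (f + g) = partial i f + partial i g"
proof -
  have "((\<lambda>t. (f + g) (x + t *\<^sub>R axis i 1)) has_vector_derivative (partial i f + partial i g) x) (at 0)" for x
    using assms unfolding plus_fun_apply has_partial_iff by (auto intro!: has_vector_derivative_add)
  then show "has_partial i (f + g)" "partial i (f + g) = partial i f + partial i g"
    by (rule partialI)+
qed

lemma partial_diff:
  assumes "has_partial i f" "has_partial i g"
  shows "has_partial i (f - g)" "partial i (f - g) = partial i f - partial i g"
proof -
  have "((\<lambda>t. (f - g) (x + t *\<^sub>R axis i 1)) has_vector_derivative (partial i f - partial i g) x) (at 0)" for x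
    using assms unfolding fun_diff_def has_partial_iff by (auto intro!: has_vector_derivative_diff)
  then show "has_partial i (f - g)" "partial i (f - g) = partial i f - partial i g"
    by (rule partialI)+
qed

lemma partial_fscale:
  assumes "has_partial i f"
  shows "has_partial i (fscale c f)" "partial i (fscale c f) = fscale c (partial i f)"
proof -
  have "((\<lambda>t. (fscale c f) (x + t *\<^sub>R axis i 1)) has_vector_derivative (fscale c (partial i f)) x) (at 0)" for x
    using assms unfolding fscale_def has_partial_iff by (auto intro!: has_vector_derivative_mult_right)
  then show "has_partial i (fscale c f)" "partial i (fscale c f) = fscale c (partial i f)"
    by (rule partialI)+
qed

lemma partial_mult:
  assumes "has_partial i f" "has_partial i g"
  shows "has_partial i (f * g)" "partial i (f * g) = f * partial i g + partial i f * g"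
proof -
  have "((\<lambda>t. (f * g) (x + t *\<^sub>R axis i 1)) has_vector_derivative (f * partial i g + partial i f * g) x) (at 0)" for x
    using has_vector_derivative_mult[of "\<lambda>t. f (x + t *\<^sub>R axis i 1)" "partial i f x" 0 UNIV
       "\<lambda>t. g (x + t *\<^sub>R axis i 1)" "partial i g x"] assms
    by (simp add: has_partial_iff times_fun_def plus_fun_def)
  then show "has_partial i (f * g)" "partial i (f * g) = f * partial i g + partial i f * g"
    by (rule partialI)+
qed

lemma continuous_on_fun:
  fixes f g :: "'a::topological_space \<Rightarrow> complex"
  assumes "continuous_on S f" "continuous_on S g"
  shows "continuous_on S (f + g)" "continuous_on S (f - g)" "continuous_on S (f * g)"
    "continuous_on S (fscale c f)"
  using assms unfolding plus_fun_def fun_diff_def times_fun_def fscale_def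
  by (auto intro: continuous_intros)

lemma bounded_C_k_add:
  assumes "bounded_C_k n w f" "bounded_C_k n v g"
  shows "bounded_C_k n (\<lambda>x. w x + v x) (f + g)"
  using assms
  by (induction n arbitrary: f g) (auto simp: partial_add intro!: norm_triangle_mono continuous_intros)

lemma bounded_C_k_fscale:
  assumes "bounded_C_k n w f"
  shows "bounded_C_k n (\<lambda>x. norm c * w x) (fscale c f)"
proof -
  have "norm (fscale c f x) \<le> norm c * w x" if "norm (f x) \<le> w x" for f :: "real^'a \<Rightarrow> complex" and x
    using that by (simp add: fscale_def norm_mult mult_left_mono)
  then show ?thesis
    using assms by (induction n arbitrary: f) (auto simp: partial_fscale intro!: continuous_on_fun)
qed

text \<open>Each application of the product rule doubles the number of terms, hence the crude
  Leibniz constant \<open>2 ^ n\<close>.\<close>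

lemma bounded_C_k_mult:
  assumes "bounded_C_k n w f" "bounded_C_k n v g" 
  shows "bounded_C_k n (\<lambda>x. 2 ^ n * (w x * v x)) (f * g)"
  using assms
proof (induction n arbitrary: f g)
  case 0
  then show ?case
    by (auto simp: norm_mult intro!: mult_mono' continuous_intros)
next
  case (Suc n)
  have nonneg: "0 \<le> w x" "0 \<le> v x" for x
    using Suc.prems by (force intro: order_trans[OF norm_ge_zero])+
  have f': "bounded_C_k n w f" and g': "bounded_C_k n v g"
    using Suc.prems by (blast intro: bounded_C_k_mono le_SucI)+
  have "norm ((f * g) x) \<le> 2 ^ Suc n * (w x * v x)" for x
  proof -
    have "norm ((f * g) x) \<le> 1 * (w x * v x)"
      using Suc.prems by (auto simp: norm_mult intro!: mult_mono')
    also have "\<dots> \<le> 2 ^ Suc n * (w x * v x)"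
      using nonneg by (intro mult_right_mono one_le_power) auto
    finally show ?thesis .
  qed
  moreover have "bounded_C_k n (\<lambda>x. 2 ^ Suc n * (w x * v x)) (partial i (f * g))" for i
  proof -
    have "bounded_C_k n (\<lambda>x. 2 ^ n * (w x * v x) + 2 ^ n * (w x * v x)) (f * partial i g + partial i f * g)"
      using Suc.prems f' g' by (intro bounded_C_k_add Suc.IH) auto
    then show ?thesis
      using Suc.prems by (simp add: partial_mult mult_ac flip: mult_2)
  qed
  moreover have "continuous_on UNIV (f * g)"
    using Suc.prems by (auto intro!: continuous_intros)
  moreover have "has_partial i (f * g)" for i
    using Suc.prems by (intro partial_mult) auto
  ultimately show ?case
    unfolding bounded_C_k.simps by blast
qed

section \<open>Convolution with a bump function\<close>

text \<open>A family closed under differentiation that contains exp(-1/(1-t^2)), extended by zero,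
  and therefore all of its derivatives.\<close>

definition bump_term :: "real poly \<Rightarrow> nat \<Rightarrow> real \<Rightarrow> real" where
  "bump_term p m t = (if \<bar>t\<bar> < 1 then poly p t * (inverse (1 - t\<^sup>2) ^ m * exp (- inverse (1 - t\<^sup>2))) else 0)"

lemma power_le_exp: "s ^ n \<le> real n ^ n * exp s" if "0 \<le> s"
proof (cases "n = 0")
  case True
  then show ?thesis using that by simp
next
  case False
  have "s ^ n = real n ^ n * (s / n) ^ n"
    using False by (simp add: power_divide)
  also have "(s / n) ^ n \<le> exp (s / n) ^ n"
    using that by (intro power_mono) (auto intro: order_trans[OF _ exp_ge_add_one_self])
  also have "exp (s / n) ^ n = exp s"
    using False by (simp flip: exp_of_nat_mult)
  finally show ?thesis by (simp add: mult_left_mono)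
qed

lemma one_minus_square_pos: "\<bar>t\<bar> < 1 \<Longrightarrow> 0 < 1 - (t::real)\<^sup>2"
  by (simp add: abs_square_less_1)

text \<open>The exponential beats \<open>m + 2\<close> powers of
  \<open>inverse (1 - t\<^sup>2)\<close>; the two spare powers give quadratic vanishing at the end
  points, enough for a zero derivative there.\<close>

lemma bump_term_quadratic:
  obtains C where "0 \<le> C" "\<And>t. \<bar>bump_term p m t\<bar> \<le> C * (1 - \<bar>t\<bar>)\<^sup>2"
proof -
  have "bounded (poly p ` {-1..1})"
    by (intro compact_imp_bounded compact_continuous_image continuous_intros) auto
  then obtain B where B: "0 < B" "\<And>t. \<bar>t\<bar> \<le> 1 \<Longrightarrow> \<bar>poly p t\<bar> \<le> B"
    by (auto simp: bounded_pos abs_le_iff)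
  define K where "K = real (m + 2) ^ (m + 2)"
  have K: "0 \<le> K" by (simp add: K_def)
  show thesis
  proof (rule that[of "4 * B * K"])
    show "0 \<le> 4 * B * K" using B K by simp
    show "\<bar>bump_term p m t\<bar> \<le> 4 * B * K * (1 - \<bar>t\<bar>)\<^sup>2" for t
    proof (cases "\<bar>t\<bar> < 1")
      case True
      define u where "u = 1 - t\<^sup>2"
      have u: "0 < u" using one_minus_square_pos[OF True] by (simp add: u_def)
      have "inverse u ^ (m + 2) \<le> K * exp (inverse u)"
        unfolding K_def using u by (intro power_le_exp) simp
      then have "inverse u ^ (m + 2) * (exp (- inverse u) * u\<^sup>2) \<le> K * exp (inverse u) * (exp (- inverse u) * u\<^sup>2)"
        by (rule mult_right_mono) simp
      then have "inverse u ^ m * exp (- inverse u) \<le> K * u\<^sup>2"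
        using u by (simp add: power_add exp_minus field_simps power2_eq_square)
      also have "u\<^sup>2 \<le> 4 * (1 - \<bar>t\<bar>)\<^sup>2"
      proof -
        have "u = (1 - \<bar>t\<bar>) * (1 + \<bar>t\<bar>)"
          by (simp add: u_def power2_eq_square algebra_simps)
        also have "\<dots> \<le> (1 - \<bar>t\<bar>) * 2"
          using True by (intro mult_left_mono) auto
        finally have "u\<^sup>2 \<le> ((1 - \<bar>t\<bar>) * 2)\<^sup>2"
          using u by (intro power_mono) auto
        then show ?thesis unfolding power_mult_distrib by (simp add: mult.commute)
      qed
      finally have "inverse u ^ m * exp (- inverse u) \<le> K * (4 * (1 - \<bar>t\<bar>)\<^sup>2)"
        using K by (simp add: mult_left_mono)
      then have "\<bar>poly p t\<bar> * (inverse u ^ m * exp (- inverse u)) \<le> B * (K * (4 * (1 - \<bar>t\<bar>)\<^sup>2))"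
        using B True u by (intro mult_mono[OF B(2)]) auto
      then show ?thesis
        using True u by (simp add: bump_term_def abs_mult mult_ac flip: u_def)
    next
      case False
      then show ?thesis using B K by (simp add: bump_term_def)
    qed
  qed
qed

lemma has_derivative_zero_quadratic:
  fixes f :: "real \<Rightarrow> real"
  assumes "\<And>t. \<bar>f t\<bar> \<le> C * (t - a)\<^sup>2"
  shows "(f has_real_derivative 0) (at a)"
proof -
  have fa: "f a = 0" using assms[of a] by simp
  have "((\<lambda>h. f (a + h) / h) \<longlongrightarrow> 0) (at 0)"
  proof (rule Lim_null_comparison)
    show "((\<lambda>h. \<bar>C\<bar> * \<bar>h\<bar>) \<longlongrightarrow> 0) (at 0)"
      by (auto intro!: tendsto_eq_intros)
    have "norm (f (a + h) / h) \<le> \<bar>C\<bar> * \<bar>h\<bar>" for h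
    proof (cases "h = 0")
      case False
      have "\<bar>f (a + h)\<bar> \<le> C * h\<^sup>2"
        using assms[of "a + h"] by simp
      also have "\<dots> \<le> \<bar>C\<bar> * h\<^sup>2"
        by (intro mult_right_mono) auto
      finally show ?thesis
        using False by (simp add: field_simps power2_eq_square)
    qed simp
    then show "\<forall>\<^sub>F h in at 0. norm (f (a + h) / h) \<le> \<bar>C\<bar> * \<bar>h\<bar>" by simp
  qed
  then show ?thesis by (simp add: DERIV_def fa)
qed

text \<open>Polynomial and exponent of the derivative of \<open>bump_term p m\<close>. The exponent
  rises by 2 because differentiating \<open>inverse (1 - t\<^sup>2)\<close> squares it; the powers
  of \<open>[:1, 0, -1:]\<close>, which is 1 - t^2, bring all terms over the same exponent.\<close>

definition bump_next :: "real poly \<times> nat \<Rightarrow> real poly \<times> nat" where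
  "bump_next = (\<lambda>(p, m). (pderiv p * [:1, 0, -1:] ^ 2 + smult (2 * real m) ([:0, 1:] * p * [:1, 0, -1:])
      - smult 2 ([:0, 1:] * p), m + 2))"

lemma bump_term_deriv:
  "(bump_term p m has_real_derivative bump_term (fst (bump_next (p, m))) (snd (bump_next (p, m))) t) (at t)"
proof -
  consider "\<bar>t\<bar> < 1" | "\<bar>t\<bar> = 1" | "\<bar>t\<bar> > 1" by linarith
  then show ?thesis
  proof cases
    case 1
    define u where "u = 1 - t\<^sup>2"
    have u: "0 < u" using one_minus_square_pos[OF 1] by (simp add: u_def)
    have "((\<lambda>t. poly p t * (inverse (1 - t\<^sup>2) ^ m * exp (- inverse (1 - t\<^sup>2)))) has_real_derivative
       poly (pderiv p) t * (inverse u ^ m * exp (- inverse u)) + poly p t *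
        (real m * inverse u ^ (m - 1) * (2 * t * inverse u ^ 2) * exp (- inverse u) +
           inverse u ^ m * (exp (- inverse u) * (- (2 * t * inverse u ^ 2))))) (at t)"
      using u unfolding u_def
      by (auto intro!: derivative_eq_intros poly_DERIV simp: power2_eq_square algebra_simps)
    also have "poly (pderiv p) t * (inverse u ^ m * exp (- inverse u)) + poly p t *
        (real m * inverse u ^ (m - 1) * (2 * t * inverse u ^ 2) * exp (- inverse u) +
           inverse u ^ m * (exp (- inverse u) * (- (2 * t * inverse u ^ 2)))) =
       (poly (pderiv p) t * u\<^sup>2 + 2 * real m * t * poly p t * u - 2 * t * poly p t) * (inverse u ^ (m + 2) * exp (- inverse u))"
    proof -
      have 1: "real m * inverse u ^ (m - 1) * (2 * t * inverse u ^ 2) = 2 * real m * t * u * inverse u ^ (m + 2)"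
        using u by (cases m) (auto simp: field_simps power2_eq_square)
      have 2: "inverse u ^ m = u ^ 2 * inverse u ^ (m + 2)"
        using u by (simp add: field_simps power2_eq_square)
      have 3: "u\<^sup>2 * W * (E * - (2 * t * (inverse u)\<^sup>2)) = - (2 * t * (W * E))" for W E
        using u by (simp add: field_simps power2_eq_square)
      show ?thesis
        unfolding 1 2 3 by (simp only: ring_distribs mult_ac minus_mult_left minus_mult_right)
    qed
    also have "(poly (pderiv p) t * u\<^sup>2 + 2 * real m * t * poly p t * u - 2 * t * poly p t) * (inverse u ^ (m + 2) * exp (- inverse u))
       = bump_term (fst (bump_next (p, m))) (snd (bump_next (p, m))) t"
    proof -
      have "poly (fst (bump_next (p, m))) t = poly (pderiv p) t * u\<^sup>2 + 2 * real m * t * poly p t * u - 2 * t * poly p t"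
        by (simp add: bump_next_def u_def power2_eq_square algebra_simps)
      moreover have "snd (bump_next (p, m)) = m + 2"
        by (simp add: bump_next_def)
      ultimately show ?thesis
        using 1 unfolding bump_term_def u_def by simp
    qed
    finally show ?thesis
      by (rule has_field_derivative_transform_within_open[where S = "{-1<..<1}"])
         (use 1 in \<open>auto simp: bump_term_def\<close>)
  next
    case 2
    \<comment> \<open>At an end point no formula holds on both sides; quadratic vanishing gives the
      derivative 0, which is also the value of the next \<open>bump_term\<close> there.\<close>
    obtain C where C: "0 \<le> C" "\<And>t. \<bar>bump_term p m t\<bar> \<le> C * (1 - \<bar>t\<bar>)\<^sup>2"
      using bump_term_quadratic by blast
    have "\<bar>bump_term p m s\<bar> \<le> C * (s - t)\<^sup>2" for s
    proof -
      have "\<bar>1 - \<bar>s\<bar>\<bar> \<le> \<bar>s - t\<bar>" using 2 by linarith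
      then have "(1 - \<bar>s\<bar>)\<^sup>2 \<le> (s - t)\<^sup>2" by (rule abs_le_square_iff[THEN iffD1])
      then show ?thesis using C by (meson mult_left_mono order_trans)
    qed
    then have "(bump_term p m has_real_derivative 0) (at t)"
      by (rule has_derivative_zero_quadratic)
    then show ?thesis
      using 2 by (simp add: bump_term_def)
  next
    case 3
    have "((\<lambda>_. 0) has_real_derivative 0) (at t)" by simp
    then have "(bump_term p m has_real_derivative 0) (at t)"
      by (rule has_field_derivative_transform_within_open[where S = "- {-1..1}"])
         (use 3 in \<open>auto simp: bump_term_def abs_if split: if_splits\<close>)
    then show ?thesis using 3 by (simp add: bump_term_def)
  qed
qed

text \<open>The kernel comes with the sequence of all its derivatives, because every derivative
  taken off a mollified function raises the index of the kernel.\<close>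

lemma ex_bump:
  "\<exists>\<kappa> :: nat \<Rightarrow> real \<Rightarrow> real. (\<forall>k t. (\<kappa> k has_real_derivative \<kappa> (Suc k) t) (at t)) \<and>
     (\<forall>k t. 1 \<le> \<bar>t\<bar> \<longrightarrow> \<kappa> k t = 0) \<and> integral {-1..1} (\<kappa> 0) = 1"
proof -
  define \<beta> where "\<beta> k = (let q = (bump_next ^^ k) (1, 0) in bump_term (fst q) (snd q))" for k
  have \<beta>: "(\<beta> k has_real_derivative \<beta> (Suc k) t) (at t)" for k t
    using bump_term_deriv[of "fst ((bump_next ^^ k) (1, 0))" "snd ((bump_next ^^ k) (1, 0))" t]
    by (simp add: \<beta>_def Let_def)
  define I where "I = integral {-1..1} (\<beta> 0)"
  have cont: "continuous_on {-1..1} (\<beta> 0)"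
    by (rule DERIV_continuous_on[OF has_field_derivative_at_within[OF \<beta>]])
  have nonneg: "0 \<le> \<beta> 0 t" for t by (simp add: \<beta>_def bump_term_def)
  have "I \<noteq> 0"
  proof
    assume "I = 0"
    then have "\<beta> 0 0 = 0"
      unfolding I_def using cont nonneg by (subst (asm) integral_eq_0_iff) auto
    then show False by (simp add: \<beta>_def bump_term_def)
  qed
  show ?thesis
  proof (intro exI[of _ "\<lambda>k t. \<beta> k t / I"] conjI allI impI)
    show "((\<lambda>t. \<beta> k t / I) has_real_derivative \<beta> (Suc k) t / I) (at t)" for k t
      using \<beta> by (rule DERIV_cdivide)
    show "\<beta> k t / I = 0" if "1 \<le> \<bar>t\<bar>" for k t
      using that by (simp add: \<beta>_def bump_term_def Let_def)
    show "integral {-1..1} (\<lambda>t. \<beta> 0 t / I) = 1"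
      using \<open>I \<noteq> 0\<close> by (simp add: I_def)
  qed
qed

definition bump :: "nat \<Rightarrow> real \<Rightarrow> real" where
  "bump = (SOME \<kappa>. (\<forall>k t. (\<kappa> k has_real_derivative \<kappa> (Suc k) t) (at t)) \<and>
     (\<forall>k t. 1 \<le> \<bar>t\<bar> \<longrightarrow> \<kappa> k t = 0) \<and> integral {-1..1} (\<kappa> 0) = 1)"

lemma bump_deriv: "(bump k has_real_derivative bump (Suc k) t) (at t)"
  and bump_eq_0: "1 \<le> \<bar>t\<bar> \<Longrightarrow> bump k t = 0"
  and integral_bump: "integral {-1..1} (bump 0) = 1"
  using someI_ex[OF ex_bump] unfolding bump_def by blast+

lemma continuous_on_bump: "continuous_on S (bump k)"
  by (rule DERIV_continuous_on[OF has_field_derivative_at_within[OF bump_deriv]])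

lemma bump_bounded: obtains B where "0 \<le> B" "\<And>t. \<bar>bump k t\<bar> \<le> B"
proof -
  have "bounded (bump k ` {-1..1})"
    by (intro compact_imp_bounded compact_continuous_image continuous_on_bump) auto
  then obtain B where B: "0 < B" "\<And>t. \<bar>t\<bar> \<le> 1 \<Longrightarrow> \<bar>bump k t\<bar> \<le> B"
    by (auto simp: bounded_pos abs_le_iff)
  then have "\<bar>bump k t\<bar> \<le> B" for t
    by (cases "\<bar>t\<bar> \<le> 1") (auto simp: bump_eq_0)
  with B show thesis by (intro that[of B]) auto
qed

text \<open>The lower limit -2 lies to the left of the support of the kernel, so that every
  \<open>t \<ge> -1\<close> is interior to the interval \<open>{-2..t+1}\<close> on which the
  integral is differentiated.\<close>

definition step :: "real \<Rightarrow> real" where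
  "step t = integral {-2..t} (bump 0)"

lemma bump_integrable: "bump k integrable_on {a..b}"
  by (intro integrable_continuous_interval continuous_on_bump)

lemma step_eq_0: "step t = 0" if "t \<le> -1"
proof -
  have "step t = integral {-2..t} (\<lambda>_. 0)"
    unfolding step_def by (intro integral_cong) (use that in \<open>auto intro!: bump_eq_0\<close>)
  then show ?thesis by simp
qed

lemma step_eq_1: "step t = 1" if "1 \<le> t"
proof -
  have "step t = integral {-2..-1} (bump 0) + integral {-1..t} (bump 0)"
    unfolding step_def using that by (intro Henstock_Kurzweil_Integration.integral_combine[symmetric] bump_integrable) auto
  also have "integral {-2..-1} (bump 0) = integral {-2..-1::real} (\<lambda>_. 0 :: real)"
    by (intro integral_cong bump_eq_0) auto
  also have "integral {-1..t} (bump 0) = integral {-1..1} (bump 0) + integral {1..t} (bump 0)"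
    using that by (intro Henstock_Kurzweil_Integration.integral_combine[symmetric] bump_integrable) auto
  also have "integral {1..t} (bump 0) = integral {1..t} (\<lambda>_. 0 :: real)"
    by (intro integral_cong bump_eq_0) auto
  finally show ?thesis by (simp add: integral_bump)
qed

lemma step_deriv: "(step has_real_derivative bump 0 t) (at t)"
proof (cases "t < -1")
  case True
  have "((\<lambda>_. 0) has_real_derivative 0) (at t)" by simp
  then have "(step has_real_derivative 0) (at t)"
    by (rule has_field_derivative_transform_within_open[where S = "{..<-1}"])
       (use True in \<open>auto simp: step_eq_0\<close>)
  then show ?thesis using True by (simp add: bump_eq_0)
next
  case False
  have "(step has_vector_derivative bump 0 t) (at t within {-2..t+1})"
    unfolding step_def using False by (intro integral_has_vector_derivative continuous_on_bump) auto
  then show ?thesis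
    using False at_within_Icc_at[of "-2" t "t + 1"] by (simp add: has_real_derivative_iff_has_vector_derivative)
qed

section \<open>Averages along one coordinate\<close>

text \<open>Composing these over all coordinates replaces a convolution in several variables by
  one-variable integrals. The kernel enters reflected, whence the minus sign in
  \<open>conv_by_parts\<close>.\<close>

definition conv :: "'d::finite \<Rightarrow> (real \<Rightarrow> real) \<Rightarrow> real \<Rightarrow> (real^'d \<Rightarrow> complex) \<Rightarrow> real^'d \<Rightarrow> complex" where
  "conv i \<phi> \<delta> f x = integral {-1..1} (\<lambda>t. \<phi> t *\<^sub>R f (x + (\<delta> * t) *\<^sub>R axis i 1))"

lemma conv_continuous:
  assumes "continuous_on UNIV f" "continuous_on {-1..1} \<phi>"
  shows "continuous_on UNIV (conv i \<phi> \<delta> f)"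
  using continuous_integral_shift[OF assms] by (simp add: conv_def[abs_def])

lemma conv_integrable:
  fixes f :: "real^'d::finite \<Rightarrow> complex"
  assumes "continuous_on UNIV f" "continuous_on {-1..1} \<phi>"
  shows "(\<lambda>t. \<phi> t *\<^sub>R f (x + (\<delta> * t) *\<^sub>R axis i 1)) integrable_on {-1..1}"
  using assms(2) by (auto intro!: integrable_continuous_interval continuous_intros continuous_on_compose2[OF assms(1)])

lemma conv_partial:
  assumes "continuous_on UNIV f" "continuous_on {-1..1} \<phi>" "has_partial j f" "continuous_on UNIV (partial j f)"
  shows "has_partial j (conv i \<phi> \<delta> f)" "partial j (conv i \<phi> \<delta> f) = conv i \<phi> \<delta> (partial j f)"
proof -
  have "((\<lambda>t. conv i \<phi> \<delta> f (x + t *\<^sub>R axis j 1)) has_vector_derivative conv i \<phi> \<delta> (partial j f) x) (at 0)" for x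
    using partial_integral[OF assms(1,3,4,2)] by (simp add: conv_def)
  then show "has_partial j (conv i \<phi> \<delta> f)" "partial j (conv i \<phi> \<delta> f) = conv i \<phi> \<delta> (partial j f)"
    by (rule partialI)+
qed

lemma conv_diff:
  assumes "continuous_on UNIV f" "continuous_on UNIV g" "continuous_on {-1..1} \<phi>"
  shows "conv i \<phi> \<delta> (f - g) = conv i \<phi> \<delta> f - conv i \<phi> \<delta> g"
  using assms conv_integrable
  by (auto simp: conv_def fun_eq_iff scaleR_diff_right intro!: Henstock_Kurzweil_Integration.integral_diff)

lemma conv_add:
  assumes "continuous_on UNIV f" "continuous_on UNIV g" "continuous_on {-1..1} \<phi>"
  shows "conv i \<phi> \<delta> (f + g) = conv i \<phi> \<delta> f + conv i \<phi> \<delta> g"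
  using assms conv_integrable
  by (auto simp: conv_def fun_eq_iff scaleR_add_right intro!: Henstock_Kurzweil_Integration.integral_add)

lemma conv_fscale:
  "conv i \<phi> \<delta> (fscale c f) = fscale c (conv i \<phi> \<delta> f)"
  by (simp add: conv_def fscale_def fun_eq_iff flip: mult_scaleR_right)

text \<open>The smoothing effect: along \<open>axis i 1\<close> a derivative of \<open>f\<close> is
  a \<open>t\<close>-derivative of the integrand up to the factor \<open>\<delta>\<close>, and it
  moves to the kernel without boundary terms.\<close>

lemma conv_by_parts:
  fixes f :: "real^'d::finite \<Rightarrow> complex"
  assumes phi: "\<And>t. (\<phi> has_real_derivative \<phi>' t) (at t)" "continuous_on UNIV \<phi>'" "\<phi> (-1) = 0" "\<phi> 1 = 0"
    and "\<delta> \<noteq> 0" and f: "C_k (Suc 0) f"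
  shows "conv i \<phi> \<delta> (partial i f) = fscale (- 1 / of_real \<delta>) (conv i \<phi>' \<delta> f)"
proof
  fix x
  have c: "continuous_on UNIV f" "continuous_on UNIV (partial i f)" "has_partial i f"
    using f by auto
  have cphi: "continuous_on {-1..1} \<phi>" "continuous_on {-1..1} \<phi>'"
    using DERIV_continuous_on[OF has_field_derivative_at_within[OF phi(1)]] phi(2)
    by (auto intro: continuous_on_subset)
  define h where "h t = f (x + (\<delta> * t) *\<^sub>R axis i 1)" for t
  define h' where "h' t = partial i f (x + (\<delta> * t) *\<^sub>R axis i 1)" for t
  have h: "(h has_vector_derivative \<delta> *\<^sub>R h' t) (at t)" for t
  proof -
    have "((\<lambda>s. f (x + s *\<^sub>R axis i 1)) \<circ> (\<lambda>t. \<delta> * t) has_vector_derivative \<delta> *\<^sub>R h' t) (at t)"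
      unfolding h'_def
      by (intro vector_diff_chain_at has_partialD c) (auto intro!: derivative_eq_intros simp: has_vector_derivative_def)
    then show ?thesis by (simp add: o_def h_def[abs_def])
  qed
  have "((\<lambda>t. \<phi> t *\<^sub>R (\<delta> *\<^sub>R h' t) + \<phi>' t *\<^sub>R h t) has_integral \<phi> 1 *\<^sub>R h 1 - \<phi> (-1) *\<^sub>R h (-1)) {-1..1}"
    by (intro fundamental_theorem_of_calculus has_vector_derivative_at_within[OF has_vector_derivative_scaleR[OF phi(1) h]]) simp
  then have "integral {-1..1} (\<lambda>t. \<phi> t *\<^sub>R (\<delta> *\<^sub>R h' t) + \<phi>' t *\<^sub>R h t) = 0"
    by (simp add: phi integral_unique)
  also have "integral {-1..1} (\<lambda>t. \<phi> t *\<^sub>R (\<delta> *\<^sub>R h' t) + \<phi>' t *\<^sub>R h t) =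
      integral {-1..1} (\<lambda>t. \<delta> *\<^sub>R (\<phi> t *\<^sub>R h' t)) + integral {-1..1} (\<lambda>t. \<phi>' t *\<^sub>R h t)"
    unfolding h_def h'_def scaleR_left_commute[of _ \<delta>]
    by (intro Henstock_Kurzweil_Integration.integral_add integrable_cmul conv_integrable c cphi)
  finally have "\<delta> *\<^sub>R conv i \<phi> \<delta> (partial i f) x = - conv i \<phi>' \<delta> f x"
    unfolding integral_cmul conv_def h_def h'_def by (simp only: eq_neg_iff_add_eq_0)
  then show "conv i \<phi> \<delta> (partial i f) x = fscale (- 1 / of_real \<delta>) (conv i \<phi>' \<delta> f) x"
    using \<open>\<delta> \<noteq> 0\<close> by (auto simp: fscale_def scaleR_conv_of_real field_simps)
qed

lemma bracket_ge_1: "1 \<le> bracket x"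
  by (simp add: bracket_def)

lemma bracket_pos: "0 < bracket x"
  using bracket_ge_1[of x] by linarith

text \<open>From \<open>(norm x + 1)\<^sup>2 \<le> 2 * (norm x)\<^sup>2 + 2\<close>. Since shifts
  must stay within length 1, mollification scales are kept at most 1.\<close>

lemma bracket_shift:
  fixes x :: "real^'d::finite"
  assumes "\<bar>s\<bar> \<le> 1"
  shows "bracket (x + s *\<^sub>R axis i 1) \<le> 3 * bracket x"
proof -
  have "norm (x + s *\<^sub>R axis i 1) \<le> norm x + 1"
    using norm_triangle_ineq[of x "s *\<^sub>R axis i 1"] assms by (simp add: norm_axis_1)
  then have "(norm (x + s *\<^sub>R axis i 1))\<^sup>2 \<le> (norm x + 1)\<^sup>2"
    by (intro power_mono) auto
  also have "\<dots> \<le> 2 * (norm x)\<^sup>2 + 2"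
    using sum_squares_bound[of "norm x" 1] by (simp add: power2_sum)
  finally show ?thesis
    using zero_le_power2[of "norm x"] by (auto simp: bracket_def intro: order_trans)
qed

lemma bracket_power_shift:
  "\<bar>s\<bar> \<le> 1 \<Longrightarrow> bracket (x + s *\<^sub>R axis i 1) ^ N \<le> 3 ^ N * bracket x ^ N"
  using power_mono[OF bracket_shift, of s x i N] bracket_pos[of "x + s *\<^sub>R axis i 1"]
  by (simp add: power_mult_distrib)

text \<open>The factor 2 is the length of [-1,1], \<open>B\<close> bounds the kernel and
  \<open>3 ^ N\<close> is the cost of shifting the weight.\<close>

lemma norm_conv_le:
  assumes f: "continuous_on UNIV f" and phi: "continuous_on {-1..1} \<phi>"
    and B: "\<And>t. \<bar>\<phi> t\<bar> \<le> B" and \<delta>: "0 < \<delta>" "\<delta> \<le> 1"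
    and bd: "\<And>x. norm (f x) \<le> M * bracket x ^ N"
  shows "norm (conv i \<phi> \<delta> f x) \<le> 2 * B * 3 ^ N * M * bracket x ^ N"
proof -
  have "0 \<le> M * bracket x ^ N" by (rule order_trans[OF norm_ge_zero bd])
  then have M: "0 \<le> M" using zero_less_power[OF bracket_pos[of x], of N] by (simp add: zero_le_mult_iff not_le)
  have "norm (conv i \<phi> \<delta> f x) \<le> (B * (M * (3 ^ N * bracket x ^ N))) * (1 - (-1))"
    unfolding conv_def
  proof (rule integral_bound)
    show "continuous_on {-1..1} (\<lambda>t. \<phi> t *\<^sub>R f (x + (\<delta> * t) *\<^sub>R axis i 1))"
      using phi by (auto intro!: continuous_intros continuous_on_compose2[OF f])
    show "norm (\<phi> t *\<^sub>R f (x + (\<delta> * t) *\<^sub>R axis i 1)) \<le> B * (M * (3 ^ N * bracket x ^ N))" if "t \<in> {-1..1}" for t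
    proof -
      have "\<bar>\<delta> * t\<bar> \<le> 1"
        using that \<delta> by (auto simp: abs_mult intro!: mult_le_one)
      then have "norm (f (x + (\<delta> * t) *\<^sub>R axis i 1)) \<le> M * (3 ^ N * bracket x ^ N)"
        using M by (intro order_trans[OF bd] mult_left_mono bracket_power_shift)
      then show ?thesis
        using B[of t] by (auto intro!: mult_mono)
    qed
  qed simp
  then show ?thesis by (simp add: mult_ac)
qed

lemma bounded_C_k_conv:
  assumes phi: "continuous_on {-1..1} \<phi>" and B: "\<And>t. \<bar>\<phi> t\<bar> \<le> B" and \<delta>: "0 < \<delta>" "\<delta> \<le> 1"
    and "bounded_C_k n (\<lambda>x. M * bracket x ^ N) f"
  shows "bounded_C_k n (\<lambda>x. 2 * B * 3 ^ N * M * bracket x ^ N) (conv i \<phi> \<delta> f)"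
  using assms(5)
proof (induction n arbitrary: f)
  case 0
  then show ?case
    by (auto intro!: norm_conv_le[OF _ phi B \<delta>] conv_continuous phi)
next
  case (Suc n)
  then have b: "norm (f x) \<le> M * bracket x ^ N" "bounded_C_k n (\<lambda>x. M * bracket x ^ N) (partial j f)"
    and c: "continuous_on UNIV f" "has_partial j f" for j x
    by auto
  note c = c bounded_C_k_continuous[OF b(2)]
  show ?case
    using conv_continuous[OF c(1) phi] norm_conv_le[OF c(1) phi B \<delta> b(1)] conv_partial[OF c(1) phi c(2,3)] Suc.IH[OF b(2)]
    by simp
qed

lemma C_k_conv:
  assumes phi: "continuous_on {-1..1} \<phi>" and "C_k n f"
  shows "C_k n (conv i \<phi> \<delta> f)"
  using assms(2)
proof (induction n arbitrary: f)
  case 0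
  then show ?case by (simp add: conv_continuous phi)
next
  case (Suc n)
  then have c: "continuous_on UNIV f" "has_partial j f" "C_k n (partial j f)" for j
    by auto
  show ?case
    using conv_continuous[OF c(1) phi] conv_partial[OF c(1) phi c(2) C_k_continuous[OF c(3)]] Suc.IH[OF c(3)]
    by simp
qed

section \<open>Mollification\<close>

lemma weight_nonneg:
  fixes f :: "real^'d::finite \<Rightarrow> complex"
  assumes "bounded_C_k n (\<lambda>x. M * bracket x ^ N) f"
  shows "0 \<le> M"
proof -
  have "0 \<le> M * bracket (0 :: real^'d) ^ N"
    using order_trans[OF norm_ge_zero bounded_C_k_norm[OF assms, of 0]] .
  then show ?thesis by (simp add: bracket_def)
qed

text \<open>\<open>\<alpha> i\<close> counts the derivatives in direction \<open>i\<close> that have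
  been moved to the kernel; the mollifier proper has \<open>\<alpha> = 0\<close>.\<close>

definition mollify :: "'d::finite list \<Rightarrow> real \<Rightarrow> ('d \<Rightarrow> nat) \<Rightarrow> (real^'d \<Rightarrow> complex) \<Rightarrow> real^'d \<Rightarrow> complex" where
  "mollify is \<delta> \<alpha> f = foldr (\<lambda>i. conv i (bump (\<alpha> i)) \<delta>) is f"

lemma mollify_simps [simp]:
  "mollify [] \<delta> \<alpha> f = f"
  "mollify (i # is) \<delta> \<alpha> f = conv i (bump (\<alpha> i)) \<delta> (mollify is \<delta> \<alpha> f)"
  by (simp_all add: mollify_def)

lemma C_k_mollify: "C_k n f \<Longrightarrow> C_k n (mollify is \<delta> \<alpha> f)"
  by (induction "is") (auto simp: C_k_conv continuous_on_bump)

lemma mollify_continuous: "continuous_on UNIV f \<Longrightarrow> continuous_on UNIV (mollify is \<delta> \<alpha> f)"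
  using C_k_mollify[of 0] by simp

lemma mollify_cong: "(\<And>i. i \<in> set is \<Longrightarrow> \<alpha> i = \<beta> i) \<Longrightarrow> mollify is \<delta> \<alpha> f = mollify is \<delta> \<beta> f"
  by (induction "is") auto

lemma mollify_add:
  assumes "continuous_on UNIV f" "continuous_on UNIV g"
  shows "mollify is \<delta> \<alpha> (f + g) = mollify is \<delta> \<alpha> f + mollify is \<delta> \<alpha> g"
  using assms by (induction "is") (simp_all add: conv_add mollify_continuous continuous_on_bump)

lemma mollify_fscale: "mollify is \<delta> \<alpha> (fscale c f) = fscale c (mollify is \<delta> \<alpha> f)"
  by (induction "is") (simp_all add: conv_fscale)

text \<open>The order of quantifiers matters: \<open>c\<close> does not depend on the scale or the
  order \<open>n\<close>, which later makes a supremum over all scales finite.\<close>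

lemma bounded_C_k_mollify:
  fixes "is" :: "'d::finite list"
  obtains c where "0 \<le> c"
    "\<And>n \<delta> M f. 0 < \<delta> \<Longrightarrow> \<delta> \<le> 1 \<Longrightarrow> bounded_C_k n (\<lambda>x. M * bracket x ^ N) f \<Longrightarrow>
       bounded_C_k n (\<lambda>x. c * M * bracket x ^ N) (mollify is \<delta> \<alpha> f)"
proof (induction "is" arbitrary: thesis)
  case Nil
  show ?case by (rule Nil[of 1]) auto
next
  case (Cons i "is")
  obtain c where c: "0 \<le> c"
    "\<And>n \<delta> M f. 0 < \<delta> \<Longrightarrow> \<delta> \<le> 1 \<Longrightarrow> bounded_C_k n (\<lambda>x. M * bracket x ^ N) f \<Longrightarrow>
       bounded_C_k n (\<lambda>x. c * M * bracket x ^ N) (mollify is \<delta> \<alpha> f)"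
    using Cons.IH by blast
  obtain B where B: "0 \<le> B" "\<And>t. \<bar>bump (\<alpha> i) t\<bar> \<le> B"
    using bump_bounded by blast
  show ?case
  proof (rule Cons.prems[of "2 * B * 3 ^ N * c"])
    show "0 \<le> 2 * B * 3 ^ N * c" using B c by simp
    fix n and \<delta> M :: real and f :: "real^'d \<Rightarrow> complex"
    assume d: "0 < \<delta>" "\<delta> \<le> 1" and f: "bounded_C_k n (\<lambda>x. M * bracket x ^ N) f"
    show "bounded_C_k n (\<lambda>x. 2 * B * 3 ^ N * c * M * bracket x ^ N) (mollify (i # is) \<delta> \<alpha> f)"
      using bounded_C_k_conv[OF continuous_on_bump B(2) d c(2)[OF d f]] by (simp add: mult.assoc)
  qed
qed

text \<open>The derivative passes through the averages in other directions until it meets the one in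
  direction \<open>i\<close>, where it is integrated by parts; distinctness ensures that the index
  is raised in one factor only.\<close>

lemma partial_mollify:
  assumes "distinct is" "i \<in> set is" "C_k (Suc 0) f" "\<delta> \<noteq> 0"
  shows "has_partial i (mollify is \<delta> \<alpha> f)"
    "partial i (mollify is \<delta> \<alpha> f) = fscale (- 1 / of_real \<delta>) (mollify is \<delta> (\<alpha>(i := Suc (\<alpha> i))) f)"
proof -
  have C1: "C_k (Suc 0) (mollify js \<delta> \<alpha> f)" for js
    by (rule C_k_mollify) (rule assms)
  then show "has_partial i (mollify is \<delta> \<alpha> f)" by simp
  define c where "c = - 1 / complex_of_real \<delta>"
  show "partial i (mollify is \<delta> \<alpha> f) = fscale (- 1 / of_real \<delta>) (mollify is \<delta> (\<alpha>(i := Suc (\<alpha> i))) f)"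
    using assms(1,2) unfolding c_def[symmetric]
  proof (induction "is")
    case (Cons a js)
    have "partial i (mollify (a # js) \<delta> \<alpha> f) = conv a (bump (\<alpha> a)) \<delta> (partial i (mollify js \<delta> \<alpha> f))"
      using C1[of js] by (auto simp: conv_partial continuous_on_bump)
    also have "\<dots> = fscale c (mollify (a # js) \<delta> (\<alpha>(i := Suc (\<alpha> i))) f)"
    proof (cases "a = i")
      case True
      then have "mollify js \<delta> (\<alpha>(i := Suc (\<alpha> i))) f = mollify js \<delta> \<alpha> f"
        using Cons.prems by (intro mollify_cong) auto
      then show ?thesis
        using conv_by_parts[OF bump_deriv continuous_on_bump bump_eq_0 bump_eq_0 \<open>\<delta> \<noteq> 0\<close> C1, folded c_def] True
        by simp
    next
      case False
      then show ?thesis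
        using Cons by (simp add: conv_fscale fun_upd_def)
    qed
    finally show ?case .
  qed simp
qed

text \<open>All \<open>k\<close> derivatives fall on the kernel, each at the price 1/\<delta>, so
  the constant depends on the size of \<open>f\<close> and not on the size of its derivatives. Lower
  orders fit under the same power of 1/\<delta> because \<open>\<delta> \<le> 1\<close>.\<close>

lemma bounded_C_k_mollify_smooth:
  fixes \<alpha> :: "'d::finite \<Rightarrow> nat"
  shows "\<exists>c\<ge>0. \<forall>\<delta> M f. 0 < \<delta> \<and> \<delta> \<le> 1 \<and> C_k (Suc 0) f \<and> (\<forall>x. norm (f x) \<le> M * bracket x ^ N) \<longrightarrow>
       bounded_C_k k (\<lambda>x. c * M / \<delta> ^ k * bracket x ^ N) (mollify coords \<delta> \<alpha> f)"
proof (induction k arbitrary: \<alpha>)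
  case 0
  obtain c where c: "0 \<le> c"
    "\<And>n \<delta> M f. 0 < \<delta> \<Longrightarrow> \<delta> \<le> 1 \<Longrightarrow> bounded_C_k n (\<lambda>x. M * bracket x ^ N) f \<Longrightarrow>
       bounded_C_k n (\<lambda>x. c * M * bracket x ^ N) (mollify coords \<delta> \<alpha> f)"
    using bounded_C_k_mollify by blast
  show ?case
  proof (intro exI[of _ c] conjI allI impI c(1))
    fix \<delta> M :: real and f :: "real^'d \<Rightarrow> complex"
    assume "0 < \<delta> \<and> \<delta> \<le> 1 \<and> C_k (Suc 0) f \<and> (\<forall>x. norm (f x) \<le> M * bracket x ^ N)"
    then have "bounded_C_k 0 (\<lambda>x. c * M * bracket x ^ N) (mollify coords \<delta> \<alpha> f)"
      by (intro c) auto
    then show "bounded_C_k 0 (\<lambda>x. c * M / \<delta> ^ 0 * bracket x ^ N) (mollify coords \<delta> \<alpha> f)" by simp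
  qed
next
  case (Suc k)
  let ?\<alpha> = "\<lambda>i. \<alpha>(i := Suc (\<alpha> i))"
  obtain c0 where c0: "0 \<le> c0"
    "\<And>n \<delta> M f. 0 < \<delta> \<Longrightarrow> \<delta> \<le> 1 \<Longrightarrow> bounded_C_k n (\<lambda>x. M * bracket x ^ N) f \<Longrightarrow>
       bounded_C_k n (\<lambda>x. c0 * M * bracket x ^ N) (mollify coords \<delta> \<alpha> f)"
    using bounded_C_k_mollify by blast
  have "\<forall>i. \<exists>c. 0 \<le> c \<and> (\<forall>\<delta> M f. 0 < \<delta> \<and> \<delta> \<le> 1 \<and> C_k (Suc 0) f \<and> (\<forall>x. norm (f x) \<le> M * bracket x ^ N) \<longrightarrow>
       bounded_C_k k (\<lambda>x. c * M / \<delta> ^ k * bracket x ^ N) (mollify coords \<delta> (?\<alpha> i) f))"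
    using Suc.IH by blast
  from choice[OF this] obtain c where c: "\<And>i. 0 \<le> c i" "\<And>i \<delta> M f. 0 < \<delta> \<and> \<delta> \<le> 1 \<and> C_k (Suc 0) f \<and>
      (\<forall>x. norm (f x) \<le> M * bracket x ^ N) \<Longrightarrow>
       bounded_C_k k (\<lambda>x. c i * M / \<delta> ^ k * bracket x ^ N) (mollify coords \<delta> (?\<alpha> i) f)"
    by blast
  define C where "C = c0 + (\<Sum>i\<in>UNIV. c i)"
  have C: "c0 \<le> C" "c i \<le> C" for i
    using c0(1) c(1) member_le_sum[of i UNIV c] by (auto simp: C_def sum_nonneg)
  show ?case
  proof (intro exI[of _ C] conjI allI impI)
    show "0 \<le> C" using C c0 by linarith
    fix \<delta> M :: real and f :: "real^'d \<Rightarrow> complex"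
    assume *: "0 < \<delta> \<and> \<delta> \<le> 1 \<and> C_k (Suc 0) f \<and> (\<forall>x. norm (f x) \<le> M * bracket x ^ N)"
    then have d: "0 < \<delta>" "\<delta> \<le> 1" and f: "C_k (Suc 0) f" "\<And>x. norm (f x) \<le> M * bracket x ^ N"
      by auto
    have M: "0 \<le> M"
      using f weight_nonneg[of 0 M N f] by auto
    have b0: "bounded_C_k 0 (\<lambda>x. c0 * M * bracket x ^ N) (mollify coords \<delta> \<alpha> f)"
      using f by (intro c0 d) auto
    have "c0 * M * 1 \<le> C * M * (1 / \<delta> ^ Suc k)"
      using C M d c0 by (intro mult_mono) (auto simp: power_le_one mult_le_one)
    then have "c0 * M * bracket x ^ N \<le> C * M / \<delta> ^ Suc k * bracket x ^ N" for x :: "real^'d"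
      using bracket_pos[of x] by (intro mult_right_mono) auto
    then have 1: "norm (mollify coords \<delta> \<alpha> f x) \<le> C * M / \<delta> ^ Suc k * bracket x ^ N" for x
      using bounded_C_k_norm[OF b0] by (meson order_trans)
    have 2: "bounded_C_k k (\<lambda>x. C * M / \<delta> ^ Suc k * bracket x ^ N) (partial i (mollify coords \<delta> \<alpha> f))" for i
    proof -
      have "bounded_C_k k (\<lambda>x. norm (- 1 / complex_of_real \<delta>) * (c i * M / \<delta> ^ k * bracket x ^ N))
          (fscale (- 1 / of_real \<delta>) (mollify coords \<delta> (?\<alpha> i) f))"
        by (intro bounded_C_k_fscale c(2) *)
      moreover have "norm (- 1 / complex_of_real \<delta>) * (c i * M / \<delta> ^ k * bracket x ^ N) \<le>
          C * M / \<delta> ^ Suc k * bracket x ^ N" for x :: "real^'d"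
      proof -
        have "norm (- 1 / complex_of_real \<delta>) * (c i * M / \<delta> ^ k * bracket x ^ N) = c i * M / \<delta> ^ Suc k * bracket x ^ N"
          using d by (simp add: norm_divide)
        also have "\<dots> \<le> C * M / \<delta> ^ Suc k * bracket x ^ N"
          using C M d bracket_pos[of x] by (intro mult_right_mono divide_right_mono) auto
        finally show ?thesis .
      qed
      ultimately show ?thesis
        using d f by (auto simp: partial_mollify coords intro: bounded_C_k_mono)
    qed
    show "bounded_C_k (Suc k) (\<lambda>x. C * M / \<delta> ^ Suc k * bracket x ^ N) (mollify coords \<delta> \<alpha> f)"
      unfolding bounded_C_k.simps
      using 1 2 bounded_C_k_continuous[OF b0] partial_mollify(1)[OF coords(1) _ f(1)] d by (auto simp: coords)
  qed
qed

text \<open>As the kernel has integral 1, the difference is an average of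
  \<open>f x - f (x + (\<delta> * t) *\<^sub>R axis i 1)\<close>, which the mean value inequality
  bounds by \<delta> times one further derivative.\<close>

lemma bounded_C_k_conv_diff:
  assumes phi: "continuous_on {-1..1} \<phi>" "integral {-1..1} \<phi> = 1"
    and B: "\<And>t. \<bar>\<phi> t\<bar> \<le> B" and \<delta>: "0 < \<delta>" "\<delta> \<le> 1"
    and "bounded_C_k (Suc n) (\<lambda>x. M * bracket x ^ N) f"
  shows "bounded_C_k n (\<lambda>x. 2 * B * 3 ^ N * (\<delta> * M) * bracket x ^ N) (f - conv i \<phi> \<delta> f)"
  using assms(6)
proof (induction n arbitrary: f)
  \<comment> \<open>Only values are estimated here. Since \<open>conv\<close> commutes with partial
    derivatives, the induction reuses this bound for the derivatives of \<open>f\<close>.\<close>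
  have *: "norm ((f - conv i \<phi> \<delta> f) x) \<le> 2 * B * 3 ^ N * (\<delta> * M) * bracket x ^ N"
    if f: "bounded_C_k (Suc n) (\<lambda>x. M * bracket x ^ N) f" for f n x
  proof -
    have M: "0 \<le> M" by (rule weight_nonneg[OF f])
    have cf: "continuous_on UNIV f" by (rule bounded_C_k_continuous[OF f])
    have diff: "norm (f x - f (x + (\<delta> * t) *\<^sub>R axis i 1)) \<le> \<delta> * (M * (3 ^ N * bracket x ^ N))"
      if t: "t \<in> {-1..1}" for t
    proof -
      have "norm (f (x + 0 *\<^sub>R axis i 1) - f (x + (\<delta> * t) *\<^sub>R axis i 1)) \<le> (M * (3 ^ N * bracket x ^ N)) * norm (0 - \<delta> * t)"
      proof (rule differentiable_bound[where S = "{-1..1}" and f = "\<lambda>s. f (x + s *\<^sub>R axis i 1)"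
            and f' = "\<lambda>s h. h *\<^sub>R partial i f (x + s *\<^sub>R axis i 1)" and x = 0 and y = "\<delta> * t"])
        show "((\<lambda>s. f (x + s *\<^sub>R axis i 1)) has_derivative (\<lambda>h. h *\<^sub>R partial i f (x + s *\<^sub>R axis i 1))) (at s within {-1..1})" for s
          using has_partialD[of i f x s] f
          unfolding has_vector_derivative_def by (auto intro: has_derivative_at_withinI)
        show "onorm (\<lambda>h. h *\<^sub>R partial i f (x + s *\<^sub>R axis i 1)) \<le> M * (3 ^ N * bracket x ^ N)" if "s \<in> {-1..1}" for s
        proof -
          have "norm (partial i f (x + s *\<^sub>R axis i 1)) \<le> M * bracket (x + s *\<^sub>R axis i 1) ^ N"
            using f by (auto intro: bounded_C_k_norm)
          also have "\<dots> \<le> M * (3 ^ N * bracket x ^ N)"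
            using that M by (intro mult_left_mono bracket_power_shift) auto
          finally show ?thesis
            by (intro onorm_le) (auto simp: mult.commute intro!: mult_left_mono)
        qed
        show "\<delta> * t \<in> {-1..1}"
          using t \<delta> mult_mono[of \<delta> 1 "\<bar>t\<bar>" 1] abs_mult[of \<delta> t] by (auto simp: abs_le_iff)
      qed auto
      also have "\<dots> \<le> (M * (3 ^ N * bracket x ^ N)) * \<delta>"
        using t \<delta> M bracket_pos[of x] by (intro mult_left_mono) (auto simp: abs_mult abs_le_iff)
      finally show ?thesis by (simp add: mult.commute)
    qed
    have int: "(\<lambda>t. \<phi> t *\<^sub>R f (x + (\<delta> * t) *\<^sub>R axis i 1)) integrable_on {-1..1}"
      by (rule conv_integrable[OF cf phi(1)])
    have int2: "(\<lambda>t. \<phi> t *\<^sub>R f x) integrable_on {-1..1}"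
      by (intro integrable_continuous_interval continuous_intros phi)
    have "integral {-1..1} (\<lambda>t. \<phi> t *\<^sub>R f x) = 1 *\<^sub>R f x"
      using integral_linear[OF integrable_continuous_interval[OF phi(1)] bounded_linear_scaleR_left[of "f x"]] phi(2)
      by (simp add: o_def)
    then have "(f - conv i \<phi> \<delta> f) x = integral {-1..1} (\<lambda>t. \<phi> t *\<^sub>R f x) - integral {-1..1} (\<lambda>t. \<phi> t *\<^sub>R f (x + (\<delta> * t) *\<^sub>R axis i 1))"
      by (simp add: conv_def)
    also have "\<dots> = integral {-1..1} (\<lambda>t. \<phi> t *\<^sub>R (f x - f (x + (\<delta> * t) *\<^sub>R axis i 1)))"
      unfolding scaleR_diff_right using int int2 by (intro Henstock_Kurzweil_Integration.integral_diff[symmetric])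
    also have "norm \<dots> \<le> (B * (\<delta> * (M * (3 ^ N * bracket x ^ N)))) * (1 - (-1))"
    proof (rule integral_bound)
      show "continuous_on {-1..1} (\<lambda>t. \<phi> t *\<^sub>R (f x - f (x + (\<delta> * t) *\<^sub>R axis i 1)))"
        using phi(1) by (auto intro!: continuous_intros continuous_on_compose2[OF cf])
      show "norm (\<phi> t *\<^sub>R (f x - f (x + (\<delta> * t) *\<^sub>R axis i 1))) \<le> B * (\<delta> * (M * (3 ^ N * bracket x ^ N)))"
        if "t \<in> {-1..1}" for t
        using B[of t] diff[OF that] by (auto intro!: mult_mono)
    qed simp
    finally show ?thesis by (simp add: mult_ac)
  qed
  {
    case 0
    have cf: "continuous_on UNIV f" by (rule bounded_C_k_continuous[OF 0])
    show ?case
      unfolding bounded_C_k.simps using *[OF 0] continuous_on_fun(2)[OF cf conv_continuous[OF cf phi(1)]] by blast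
  next
    case (Suc n)
    then have b: "bounded_C_k (Suc n) (\<lambda>x. M * bracket x ^ N) (partial j f)"
      and c: "continuous_on UNIV f" "has_partial j f" for j
      by auto
    note c = c bounded_C_k_continuous[OF b]
    note p = conv_partial[OF c(1) phi(1) c(2,3)]
    show ?case
      unfolding bounded_C_k.simps partial_diff(2)[OF c(2) p(1)] p(2)
      using *[OF Suc.prems] Suc.IH[OF b] continuous_on_fun(2)[OF c(1) conv_continuous[OF c(1) phi(1)]]
        partial_diff(1)[OF c(2) p(1)] by blast
  }
qed

text \<open>Telescoping over the coordinates: f - K S f = (f - K f) + K (f - S f). Applying K to the
  second term costs no derivative, so one derivative is lost in total and not one per
  coordinate.\<close>

lemma bounded_C_k_mollify_diff:
  fixes "is" :: "'d::finite list"
  obtains c where "0 \<le> c"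
    "\<And>n \<delta> M f. 0 < \<delta> \<Longrightarrow> \<delta> \<le> 1 \<Longrightarrow> bounded_C_k (Suc n) (\<lambda>x. M * bracket x ^ N) f \<Longrightarrow>
       bounded_C_k n (\<lambda>x. c * (\<delta> * M) * bracket x ^ N) (f - mollify is \<delta> (\<lambda>_. 0) f)"
proof (induction "is" arbitrary: thesis)
  case Nil
  have "bounded_C_k n (\<lambda>x. 0) (\<lambda>x :: real^'d. 0)" for n
  proof (induction n)
    case (Suc n)
    have "((\<lambda>t. 0 :: complex) has_vector_derivative 0) (at 0)" by simp
    from partialI[of "\<lambda>x :: real^'d. 0" _ "\<lambda>x. 0", OF this] Suc show ?case by auto
  qed auto
  then show ?case by (intro Nil[of 0]) simp_all
next
  case (Cons i "is")
  obtain c where c: "0 \<le> c"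
    "\<And>n \<delta> M f. 0 < \<delta> \<Longrightarrow> \<delta> \<le> 1 \<Longrightarrow> bounded_C_k (Suc n) (\<lambda>x. M * bracket x ^ N) f \<Longrightarrow>
       bounded_C_k n (\<lambda>x. c * (\<delta> * M) * bracket x ^ N) (f - mollify is \<delta> (\<lambda>_. 0) f)"
    using Cons.IH by blast
  obtain B where B: "0 \<le> B" "\<And>t. \<bar>bump 0 t\<bar> \<le> B"
    using bump_bounded by blast
  define b where "b = 2 * B * 3 ^ N"
  show ?case
  proof (rule Cons.prems[of "b + b * c"])
    show "0 \<le> b + b * c" using B c by (simp add: b_def)
    fix n and \<delta> M :: real and f :: "real^'d \<Rightarrow> complex"
    assume d: "0 < \<delta>" "\<delta> \<le> 1" and f: "bounded_C_k (Suc n) (\<lambda>x. M * bracket x ^ N) f"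
    have cf: "continuous_on UNIV f" by (rule bounded_C_k_continuous[OF f])
    have 1: "bounded_C_k n (\<lambda>x. b * (\<delta> * M) * bracket x ^ N) (f - conv i (bump 0) \<delta> f)"
      unfolding b_def by (intro bounded_C_k_conv_diff continuous_on_bump integral_bump B d f)
    have 2: "bounded_C_k n (\<lambda>x. b * (c * (\<delta> * M)) * bracket x ^ N) (conv i (bump 0) \<delta> (f - mollify is \<delta> (\<lambda>_. 0) f))"
      unfolding b_def by (intro bounded_C_k_conv continuous_on_bump B d c f)
    have "f - mollify (i # is) \<delta> (\<lambda>_. 0) f = (f - conv i (bump 0) \<delta> f) + conv i (bump 0) \<delta> (f - mollify is \<delta> (\<lambda>_. 0) f)"
      using cf by (simp add: conv_diff mollify_continuous continuous_on_bump)
    with bounded_C_k_add[OF 1 2]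
    show "bounded_C_k n (\<lambda>x. (b + b * c) * (\<delta> * M) * bracket x ^ N) (f - mollify (i # is) \<delta> (\<lambda>_. 0) f)"
      by (simp add: algebra_simps)
  qed
qed

section \<open>Cutoff functions\<close>

text \<open>\<open>plateau k\<close> is the k-th derivative of a bump that is 1 on [-2,2] and 0 off
  (-4,4): the shift 3 combined with the transition of \<open>step\<close> on [-1,1] produces the
  numbers 2 and 4.\<close>

definition plateau :: "nat \<Rightarrow> real \<Rightarrow> real" where
  "plateau k t = (case k of 0 \<Rightarrow> step (t + 3) - step (t - 3) | Suc l \<Rightarrow> bump l (t + 3) - bump l (t - 3))"

lemma plateau_deriv: "(plateau k has_real_derivative plateau (Suc k) t) (at t)"
proof -
  have *: "((\<lambda>t. F (t + 3) - F (t - 3)) has_real_derivative F' (t + 3) - F' (t - 3)) (at t)"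
    if "\<And>t. (F has_real_derivative F' t) (at t)" for F F' :: "real \<Rightarrow> real"
    using that[of "t + 3"] that[of "t - 3"] DERIV_shift[of F _ t 3] DERIV_shift[of F _ t "-3"]
    by (auto intro!: DERIV_diff)
  show ?thesis
    using *[OF step_deriv] *[OF bump_deriv] by (cases k) (simp_all add: plateau_def[abs_def])
qed

lemma plateau_eq_0: "4 \<le> \<bar>t\<bar> \<Longrightarrow> plateau k t = 0"
  by (cases k; cases "0 \<le> t") (auto simp: plateau_def step_eq_0 step_eq_1 bump_eq_0)

lemma plateau_eq_1: "\<bar>t\<bar> \<le> 2 \<Longrightarrow> plateau 0 t = 1"
  by (simp add: plateau_def step_eq_0 step_eq_1)

lemma plateau_Suc_eq_0: "\<bar>t\<bar> \<le> 2 \<Longrightarrow> plateau (Suc k) t = 0"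
  by (simp add: plateau_def bump_eq_0)

lemma continuous_on_plateau: "continuous_on S (plateau k)"
  by (rule DERIV_continuous_on[OF has_field_derivative_at_within[OF plateau_deriv]])

lemma plateau_bounded: "\<exists>B\<ge>0. \<forall>t. \<bar>plateau k t\<bar> \<le> B"
proof -
  have "bounded (plateau k ` {-4..4})"
    by (intro compact_imp_bounded compact_continuous_image continuous_on_plateau) auto
  then obtain B where B: "0 < B" "\<And>t. \<bar>t\<bar> \<le> 4 \<Longrightarrow> \<bar>plateau k t\<bar> \<le> B"
    by (auto simp: bounded_pos abs_le_iff)
  then have "\<bar>plateau k t\<bar> \<le> B" for t
    by (cases "\<bar>t\<bar> \<le> 4") (auto simp: plateau_eq_0)
  with B show ?thesis by (intro exI[of _ B]) auto
qed

text \<open>The \<open>\<alpha>\<close>-th partial derivative of a product of plateaus dilated by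
  \<open>r\<close>; the power of \<open>r\<close> is the chain rule factor, which is at most 1 for 0
  < r \<le> 1.\<close>

definition cutoff :: "real \<Rightarrow> ('d \<Rightarrow> nat) \<Rightarrow> real^'d::finite \<Rightarrow> complex" where
  "cutoff r \<alpha> x = of_real (r ^ order_of \<alpha> * (\<Prod>i\<in>UNIV. plateau (\<alpha> i) (r * x $ i)))"

lemma order_of_upd: "order_of (\<alpha>(i := Suc (\<alpha> i))) = Suc (order_of \<alpha>)"
proof -
  have "order_of (\<alpha>(i := Suc (\<alpha> i))) = Suc (\<alpha> i) + (\<Sum>j\<in>UNIV - {i}. \<alpha> j)"
    by (simp add: order_of_def sum.remove[of UNIV i])
  also have "\<dots> = Suc (order_of \<alpha>)"
    by (simp add: order_of_def sum.remove[of UNIV i])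
  finally show ?thesis .
qed

lemma continuous_on_cutoff: "continuous_on UNIV (cutoff r \<alpha>)"
  unfolding cutoff_def by (intro continuous_intros continuous_on_compose2[OF continuous_on_plateau]) auto

lemma partial_cutoff:
  "has_partial i (cutoff r \<alpha>)" "partial i (cutoff r \<alpha>) = cutoff r (\<alpha>(i := Suc (\<alpha> i)))"
proof -
  let ?\<alpha> = "\<alpha>(i := Suc (\<alpha> i))"
  have "((\<lambda>t. cutoff r \<alpha> (x + t *\<^sub>R axis i 1)) has_vector_derivative cutoff r ?\<alpha> x) (at 0)" for x
  proof -
    define P where "P = (\<Prod>j\<in>UNIV - {i}. plateau (\<alpha> j) (r * x $ j))"
    have "(\<Prod>j\<in>UNIV. plateau (\<alpha> j) (r * (x + t *\<^sub>R axis i 1) $ j)) = plateau (\<alpha> i) (r * (x $ i + t)) * P" for t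
    proof -
      have "(\<Prod>j\<in>UNIV - {i}. plateau (\<alpha> j) (r * (x + t *\<^sub>R axis i 1) $ j)) = P"
        unfolding P_def by (intro prod.cong) (auto simp: axis_def)
      then show ?thesis
        by (simp add: prod.remove[of UNIV i] axis_def)
    qed
    then have 1: "cutoff r \<alpha> (x + t *\<^sub>R axis i 1) = of_real (r ^ order_of \<alpha> * (plateau (\<alpha> i) (r * (x $ i + t)) * P))" for t
      by (simp add: cutoff_def)
    have "(\<Prod>j\<in>UNIV - {i}. plateau (?\<alpha> j) (r * x $ j)) = P"
      unfolding P_def by (intro prod.cong) auto
    then have 2: "cutoff r ?\<alpha> x = of_real (r ^ order_of \<alpha> * (plateau (Suc (\<alpha> i)) (r * (x $ i + 0)) * r * P))"
      by (simp add: cutoff_def order_of_upd prod.remove[of UNIV i])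
    have "((\<lambda>t. plateau (\<alpha> i) (r * (x $ i + t))) has_real_derivative plateau (Suc (\<alpha> i)) (r * (x $ i + 0)) * r) (at 0)"
      by (rule DERIV_chain2[OF plateau_deriv]) (auto intro!: derivative_eq_intros)
    then have "((\<lambda>t. r ^ order_of \<alpha> * (plateau (\<alpha> i) (r * (x $ i + t)) * P)) has_real_derivative
        r ^ order_of \<alpha> * (plateau (Suc (\<alpha> i)) (r * (x $ i + 0)) * r * P)) (at 0)"
      by (intro DERIV_cmult DERIV_cmult_right)
    then show ?thesis
      unfolding 1 2 by (rule has_vector_derivative_of_real)
  qed
  then show "has_partial i (cutoff r \<alpha>)" "partial i (cutoff r \<alpha>) = cutoff r ?\<alpha>"
    by (rule partialI)+
qed

text \<open>The support lies in the cube where every \<open>\<bar>r * x $ i\<bar>\<close> is at most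
  4; summing the squares gives 16 per coordinate, and \<open>r\<^sup>2 \<le> 1\<close> accounts for
  the constant term of \<open>bracket\<close>.\<close>

lemma cutoff_near:
  fixes x :: "real^'d::finite"
  assumes "cutoff r \<alpha> x \<noteq> 0" "\<bar>r\<bar> \<le> 1"
  shows "r\<^sup>2 * bracket x \<le> 1 + 16 * real CARD('d)"
proof -
  have "\<bar>r * x $ i\<bar> \<le> 4" for i
    using assms(1) plateau_eq_0[of "r * x $ i" "\<alpha> i"] by (force simp: cutoff_def)
  then have "(r * x $ i)\<^sup>2 \<le> 4\<^sup>2" for i
    by (subst abs_le_square_iff[symmetric]) simp
  then have "(\<Sum>i\<in>UNIV. (r * x $ i)\<^sup>2) \<le> (\<Sum>i\<in>(UNIV :: 'd set). 16)"
    by (intro sum_mono) simp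
  also have "(\<Sum>i\<in>UNIV. (r * x $ i)\<^sup>2) = r\<^sup>2 * (norm x)\<^sup>2"
    by (simp add: norm_vec_def L2_set_def sum_nonneg power_mult_distrib sum_distrib_left)
  finally have "r\<^sup>2 * (norm x)\<^sup>2 \<le> 16 * real CARD('d)"
    by simp
  moreover have "r\<^sup>2 \<le> 1"
    using assms(2) by (simp add: abs_square_le_1)
  ultimately show ?thesis
    unfolding bracket_def distrib_left by linarith
qed

lemma bracket_far:
  assumes "2 < \<bar>r * x $ i\<bar>"
  shows "1 \<le> r\<^sup>2 * bracket x"
proof -
  have "\<bar>r * x $ i\<bar> \<le> \<bar>r\<bar> * norm x"
    unfolding abs_mult by (intro mult_left_mono component_le_norm_cart) simp
  then have "1\<^sup>2 \<le> (\<bar>r\<bar> * norm x)\<^sup>2"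
    using assms by (intro power_mono) auto
  also have "\<dots> \<le> r\<^sup>2 * bracket x"
    by (simp add: bracket_def power_mult_distrib distrib_left)
  finally show ?thesis by simp
qed

text \<open>A proper derivative of the cutoff lives in the transition region, where some
  \<open>\<bar>r * x $ i\<bar>\<close> exceeds 2.\<close>

lemma cutoff_far:
  assumes "cutoff r \<alpha> x \<noteq> 0" "\<alpha> \<noteq> (\<lambda>_. 0)"
  shows "1 \<le> r\<^sup>2 * bracket x"
proof -
  obtain i k where "\<alpha> i = Suc k"
    using assms(2) by (metis ext not0_implies_Suc)
  moreover have "plateau (\<alpha> i) (r * x $ i) \<noteq> 0"
    using assms(1) by (auto simp: cutoff_def)
  ultimately show ?thesis
    using plateau_Suc_eq_0[of "r * x $ i" k] by (metis bracket_far not_le)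
qed

lemma cutoff_0_far:
  assumes "cutoff r (\<lambda>_. 0) x \<noteq> 1"
  shows "1 \<le> r\<^sup>2 * bracket x"
proof (rule ccontr)
  assume "\<not> 1 \<le> r\<^sup>2 * bracket x"
  then have "\<bar>r * x $ i\<bar> \<le> 2" for i
    using bracket_far[of r x i] by linarith
  then have "cutoff r (\<lambda>_. 0) x = 1"
    by (simp add: cutoff_def plateau_eq_1 order_of_def)
  with assms show False by simp
qed

lemma norm_cutoff_le:
  fixes \<alpha> :: "'d::finite \<Rightarrow> nat"
  shows "\<exists>c\<ge>0. \<forall>r x. 0 < r \<and> r \<le> 1 \<longrightarrow> norm (cutoff r \<alpha> x) \<le> c"
proof -
  have "\<forall>i. \<exists>B. 0 \<le> B \<and> (\<forall>t. \<bar>plateau (\<alpha> i) t\<bar> \<le> B)"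
    using plateau_bounded by blast
  from choice[OF this] obtain B where B: "\<And>i. 0 \<le> B i" "\<And>i t. \<bar>plateau (\<alpha> i) t\<bar> \<le> B i"
    by blast
  have "norm (cutoff r \<alpha> x) \<le> (\<Prod>i\<in>UNIV. B i)" if r: "0 < r \<and> r \<le> 1" for r x
  proof -
    have "norm (cutoff r \<alpha> x) = r ^ order_of \<alpha> * (\<Prod>i\<in>UNIV. \<bar>plateau (\<alpha> i) (r * x $ i)\<bar>)"
      using r by (simp only: cutoff_def norm_of_real) (simp add: abs_mult abs_prod)
    also have "\<dots> \<le> 1 * (\<Prod>i\<in>UNIV. B i)"
      using r B by (intro mult_mono prod_mono power_le_one prod_nonneg) auto
    finally show ?thesis by simp
  qed
  then show ?thesis
    using B by (intro exI[of _ "\<Prod>i\<in>UNIV. B i"]) (auto intro: prod_nonneg)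
qed

text \<open>The weight encodes the support, with a constant uniform in \<open>r\<close>. The lower
  bound on the support is restricted to proper derivatives, since the cutoff itself is 1 near the
  origin.\<close>

lemma bounded_C_k_cutoff:
  fixes \<alpha> :: "'d::finite \<Rightarrow> nat"
  shows "\<exists>c\<ge>0. \<forall>r. 0 < r \<and> r \<le> 1 \<longrightarrow> bounded_C_k k
     (\<lambda>x. if r\<^sup>2 * bracket x \<le> 1 + 16 * real CARD('d) \<and> (\<alpha> \<noteq> (\<lambda>_. 0) \<longrightarrow> 1 \<le> r\<^sup>2 * bracket x) then c else 0)
     (cutoff r \<alpha>)"
proof (induction k arbitrary: \<alpha>)
  have base: "norm (cutoff r \<alpha> x) \<le> (if r\<^sup>2 * bracket x \<le> 1 + 16 * real CARD('d) \<and>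
      (\<alpha> \<noteq> (\<lambda>_. 0) \<longrightarrow> 1 \<le> r\<^sup>2 * bracket x) then c else 0)"
    if "norm (cutoff r \<alpha> x) \<le> c" "0 < r \<and> r \<le> 1" for r c x and \<alpha> :: "'d \<Rightarrow> nat"
    using that cutoff_near[of r \<alpha> x] cutoff_far[of r \<alpha> x] by auto
  {
    case 0
    obtain c where "0 \<le> c" "\<And>r x. 0 < r \<and> r \<le> 1 \<Longrightarrow> norm (cutoff r \<alpha> x) \<le> c"
      using norm_cutoff_le by blast
    then show ?case
      using base continuous_on_cutoff by (intro exI[of _ c]) (auto simp del: if_split)
  next
    case (Suc k)
    let ?\<alpha> = "\<lambda>i. \<alpha>(i := Suc (\<alpha> i))"
    have ne: "?\<alpha> i \<noteq> (\<lambda>_. 0)" for i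
      by (metis fun_upd_same nat.distinct(1))
    obtain c0 where c0: "0 \<le> c0" "\<And>r x. 0 < r \<and> r \<le> 1 \<Longrightarrow> norm (cutoff r \<alpha> x) \<le> c0"
      using norm_cutoff_le by blast
    have "\<forall>i. \<exists>c. 0 \<le> c \<and> (\<forall>r. 0 < r \<and> r \<le> 1 \<longrightarrow> bounded_C_k k
       (\<lambda>x. if r\<^sup>2 * bracket x \<le> 1 + 16 * real CARD('d) \<and> (?\<alpha> i \<noteq> (\<lambda>_. 0) \<longrightarrow> 1 \<le> r\<^sup>2 * bracket x) then c else 0)
       (cutoff r (?\<alpha> i)))"
      using Suc.IH by blast
    from choice[OF this] obtain c where c: "\<And>i. 0 \<le> c i" "\<And>i r. 0 < r \<and> r \<le> 1 \<Longrightarrow> bounded_C_k k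
       (\<lambda>x. if r\<^sup>2 * bracket x \<le> 1 + 16 * real CARD('d) \<and> (?\<alpha> i \<noteq> (\<lambda>_. 0) \<longrightarrow> 1 \<le> r\<^sup>2 * bracket x) then c i else 0)
       (cutoff r (?\<alpha> i))"
      by blast
    define C where "C = c0 + (\<Sum>i\<in>UNIV. c i)"
    have C: "c0 \<le> C" "c i \<le> C" for i
      using c0(1) c(1) member_le_sum[of i UNIV c] by (auto simp: C_def sum_nonneg)
    show ?case
    proof (intro exI[of _ C] conjI allI impI)
      show "0 \<le> C" using C c0 by linarith
      fix r :: real assume r: "0 < r \<and> r \<le> 1"
      have 1: "norm (cutoff r \<alpha> x) \<le> C" for x
        using c0(2)[OF r] C(1) by (meson order_trans)
      have 2: "bounded_C_k k (\<lambda>x. if r\<^sup>2 * bracket x \<le> 1 + 16 * real CARD('d) \<and>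
           (\<alpha> \<noteq> (\<lambda>_. 0) \<longrightarrow> 1 \<le> r\<^sup>2 * bracket x) then C else 0) (partial i (cutoff r \<alpha>))" for i
        unfolding partial_cutoff
        by (rule bounded_C_k_mono[OF c(2)[OF r]]) (use ne C \<open>0 \<le> C\<close> in auto)
      show "bounded_C_k (Suc k) (\<lambda>x. if r\<^sup>2 * bracket x \<le> 1 + 16 * real CARD('d) \<and>
           (\<alpha> \<noteq> (\<lambda>_. 0) \<longrightarrow> 1 \<le> r\<^sup>2 * bracket x) then C else 0) (cutoff r \<alpha>)"
        unfolding bounded_C_k.simps
        using 2 base[OF 1 r] continuous_on_cutoff partial_cutoff(1) by blast
    qed
  }
qed

lemma partial_const: "has_partial i (\<lambda>_. a)" "partial i (\<lambda>_. a) = (\<lambda>_. 0)"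
  by (rule partialI[of "\<lambda>_. a" i "\<lambda>_. 0"]; simp)+

text \<open>One derivative removes the constant 1 and leaves a proper derivative of the cutoff, to
  which \<open>bounded_C_k_cutoff\<close> applies; hence a case distinction on \<open>k\<close> in
  place of an induction.\<close>

lemma bounded_C_k_one_minus_cutoff:
  "\<exists>c\<ge>0. \<forall>r. 0 < r \<and> r \<le> 1 \<longrightarrow> bounded_C_k k
     (\<lambda>x :: real^'d::finite. if 1 \<le> r\<^sup>2 * bracket x then c else 0) ((\<lambda>_. 1) - cutoff r (\<lambda>_. 0))"
proof -
  obtain c0 where c0: "0 \<le> c0" "\<And>r x. 0 < r \<and> r \<le> 1 \<Longrightarrow> norm (cutoff r (\<lambda>_ :: 'd. 0) x) \<le> c0"
    using norm_cutoff_le[of "\<lambda>_. 0"] by blast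
  have base: "norm (((\<lambda>_. 1) - cutoff r (\<lambda>_. 0)) x) \<le> (if 1 \<le> r\<^sup>2 * bracket x then 1 + c0 else 0)"
    if "0 < r \<and> r \<le> 1" for r and x :: "real^'d"
    using cutoff_0_far[of r x] norm_triangle_ineq4[of 1 "cutoff r (\<lambda>_. 0) x"] c0(2)[OF that, of x] by auto
  have cont: "continuous_on UNIV ((\<lambda>_. 1) - cutoff r (\<lambda>_ :: 'd. 0))" for r
    by (intro continuous_on_fun continuous_on_cutoff continuous_on_const)
  show ?thesis
  proof (cases k)
    case 0
    then show ?thesis
      unfolding 0 bounded_C_k.simps using cont base c0(1) by (intro exI[of _ "1 + c0"]) auto
  next
    case (Suc l)
    let ?\<alpha> = "\<lambda>i :: 'd. (\<lambda>_. 0 :: nat)(i := Suc 0)"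
    have ne: "?\<alpha> i \<noteq> (\<lambda>_. 0)" for i
      by (metis fun_upd_same nat.distinct(1))
    have "\<forall>i. \<exists>c. 0 \<le> c \<and> (\<forall>r. 0 < r \<and> r \<le> 1 \<longrightarrow> bounded_C_k l
       (\<lambda>x. if r\<^sup>2 * bracket x \<le> 1 + 16 * real CARD('d) \<and> (?\<alpha> i \<noteq> (\<lambda>_. 0) \<longrightarrow> 1 \<le> r\<^sup>2 * bracket x) then c else 0)
       (cutoff r (?\<alpha> i)))"
      using bounded_C_k_cutoff by blast
    from choice[OF this] obtain c where c: "\<And>i. 0 \<le> c i" "\<And>i r. 0 < r \<and> r \<le> 1 \<Longrightarrow> bounded_C_k l
       (\<lambda>x. if r\<^sup>2 * bracket x \<le> 1 + 16 * real CARD('d) \<and> (?\<alpha> i \<noteq> (\<lambda>_. 0) \<longrightarrow> 1 \<le> r\<^sup>2 * bracket x) then c i else 0)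
       (cutoff r (?\<alpha> i))"
      by blast
    define C where "C = 1 + c0 + (\<Sum>i\<in>UNIV. c i)"
    have C: "1 + c0 \<le> C" "c i \<le> C" for i
      using c0(1) c(1) member_le_sum[of i UNIV c] by (auto simp: C_def sum_nonneg)
    show ?thesis
      unfolding Suc
    proof (intro exI[of _ C] conjI allI impI)
      show "0 \<le> C" using C c0 by linarith
      fix r :: real assume r: "0 < r \<and> r \<le> 1"
      have 1: "norm (((\<lambda>_. 1) - cutoff r (\<lambda>_. 0)) x) \<le> (if 1 \<le> r\<^sup>2 * bracket x then C else 0)" for x :: "real^'d"
        using base[OF r, of x] C(1) by (cases "1 \<le> r\<^sup>2 * bracket x") auto
      have p: "has_partial i ((\<lambda>_. 1) - cutoff r (\<lambda>_. 0))"
        "partial i ((\<lambda>_. 1) - cutoff r (\<lambda>_. 0)) = fscale (-1) (cutoff r (?\<alpha> i))" for i :: 'd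
        using partial_diff[OF partial_const(1)[of i 1] partial_cutoff(1)[of i r "\<lambda>_. 0"]]
        by (auto simp: partial_const partial_cutoff fscale_def fun_eq_iff)
      have 2: "bounded_C_k l (\<lambda>x. if 1 \<le> r\<^sup>2 * bracket x then C else 0) (partial i ((\<lambda>_. 1) - cutoff r (\<lambda>_. 0)))" for i :: 'd
        unfolding p
        by (rule bounded_C_k_mono[OF bounded_C_k_fscale[OF c(2)[OF r]]]) (use ne C \<open>0 \<le> C\<close> in auto)
      show "bounded_C_k (Suc l) (\<lambda>x :: real^'d. if 1 \<le> r\<^sup>2 * bracket x then C else 0) ((\<lambda>_. 1) - cutoff r (\<lambda>_. 0))"
        unfolding bounded_C_k.simps using 1 2 p(1) cont by blast
    qed
  qed
qed

section \<open>Seminorms and locally convex topologies\<close>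

context complex_vector_space
begin

section \<open>Suprema of locally convex topologies\<close>

lemma locally_convex_spaceD:
  assumes "locally_convex_space V T"
  shows "subspace V" "topspace T = V"
    "continuous_map (prod_topology T T) T (\<lambda>(x, y). x + y)"
    "continuous_map (prod_topology euclidean T) T (\<lambda>(c, x). scale c x)"
    "nbhd_zero T U \<Longrightarrow> \<exists>W. absolutely_convex W \<and> nbhd_zero T W \<and> W \<subseteq> U"
  using assms unfolding locally_convex_space_def by blast+

lemma absolutely_convex_Int:
  "absolutely_convex A \<Longrightarrow> absolutely_convex B \<Longrightarrow> absolutely_convex (A \<inter> B)"
  by (simp add: absolutely_convex_def)

lemma absolutely_convex_subspace: "subspace V \<Longrightarrow> absolutely_convex V"
  by (simp add: absolutely_convex_def subspace_add subspace_scale)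

text \<open>Serves twice: for topologies on \<open>V\<close> itself, as in the inductive limit, and
  for topologies on larger spaces, as in the projective limit. Nonemptiness of \<open>F\<close>
  makes \<open>V\<close> the carrier of the generated topology.\<close>

lemma locally_convex_space_generated:
  assumes V: "subspace V" and F: "F \<noteq> {}" "\<And>T. T \<in> F \<Longrightarrow> locally_convex_space (topspace T) T"
    "\<And>T. T \<in> F \<Longrightarrow> V \<subseteq> topspace T"
  shows "locally_convex_space V (topology_generated_by {V \<inter> U |U. \<exists>T\<in>F. openin T U})"
proof -
  let ?G = "{V \<inter> U |U. \<exists>T\<in>F. openin T U}"
  define \<tau> where "\<tau> = topology_generated_by ?G"
  have G: "\<Union>?G = V"
  proof -
    obtain T where T: "T \<in> F" using F(1) by blast
    then have "V \<in> ?G"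
      using F(3)[OF T] openin_topspace[of T] by blast
    then show ?thesis by blast
  qed
  have top: "topspace \<tau> = V"
    unfolding \<tau>_def topology_generated_by_topspace by (rule G)
  have incl: "continuous_map \<tau> T (\<lambda>x. x)" if "T \<in> F" for T
    unfolding continuous_map
  proof (intro conjI allI impI)
    show "(\<lambda>x. x) ` topspace \<tau> \<subseteq> topspace T"
      using F(3)[OF that] top by simp
    fix U assume "openin T U"
    then have "V \<inter> U \<in> ?G" using that by blast
    moreover have "{x \<in> topspace \<tau>. x \<in> U} = V \<inter> U" using top by auto
    ultimately show "openin \<tau> {x \<in> topspace \<tau>. x \<in> U}"
      unfolding \<tau>_def by (simp add: topology_generated_by_Basis)
  qed
  have into: "continuous_map X \<tau> f"
    if "f ` topspace X \<subseteq> V" "\<And>T. T \<in> F \<Longrightarrow> continuous_map X T f" for X :: "'x topology" and f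
    unfolding \<tau>_def
  proof (rule continuous_on_generated_topo)
    show "f ` topspace X \<subseteq> \<Union>?G" unfolding G by (rule that)
    fix U assume "U \<in> ?G"
    then obtain W T where W: "U = V \<inter> W" "T \<in> F" "openin T W" by blast
    have "openin X {x \<in> topspace X. f x \<in> W}"
      using that(2)[OF W(2)] W(3) by (simp add: continuous_map)
    moreover have "{x \<in> topspace X. f x \<in> W} = f -` U \<inter> topspace X"
      using that(1) W(1) by blast
    ultimately show "openin X (f -` U \<inter> topspace X)" by simp
  qed
  have "continuous_map (prod_topology \<tau> \<tau>) \<tau> (\<lambda>(x, y). x + y)"
  proof (rule into)
    show "(\<lambda>(x, y). x + y) ` topspace (prod_topology \<tau> \<tau>) \<subseteq> V"
      using top V by (auto simp: subspace_add)
    fix T assume T: "T \<in> F"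
    have "continuous_map (prod_topology \<tau> \<tau>) (prod_topology T T) (\<lambda>(x, y). (x, y))"
      using incl[OF T] continuous_map_prod_top[of \<tau> \<tau> T T "\<lambda>x. x" "\<lambda>x. x"] by blast
    from continuous_map_compose[OF this locally_convex_spaceD(3)[OF F(2)[OF T]]]
    show "continuous_map (prod_topology \<tau> \<tau>) T (\<lambda>(x, y). x + y)"
      by (simp add: o_def case_prod_unfold)
  qed
  moreover have "continuous_map (prod_topology euclidean \<tau>) \<tau> (\<lambda>(c, x). scale c x)"
  proof (rule into)
    show "(\<lambda>(c, x). scale c x) ` topspace (prod_topology euclidean \<tau>) \<subseteq> V"
      using top V by (auto simp: subspace_scale)
    fix T assume T: "T \<in> F"
    have "continuous_map (prod_topology euclidean \<tau>) (prod_topology euclidean T) (\<lambda>(x :: complex, y). (x, y))"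
      using incl[OF T] continuous_map_prod_top[of euclidean \<tau> euclidean T "\<lambda>x. x" "\<lambda>x. x"] continuous_map_id
      by (auto simp: id_def)
    from continuous_map_compose[OF this locally_convex_spaceD(4)[OF F(2)[OF T]]]
    show "continuous_map (prod_topology euclidean \<tau>) T (\<lambda>(c, x). scale c x)"
      by (simp add: o_def case_prod_unfold)
  qed
  moreover have "\<exists>W. absolutely_convex W \<and> nbhd_zero \<tau> W \<and> W \<subseteq> U" if "nbhd_zero \<tau> U" for U
  proof -
    from that obtain S where S: "openin \<tau> S" "0 \<in> S" "S \<subseteq> U"
      by (auto simp: nbhd_zero_def)
    have "generate_topology_on ?G S"
      using S(1) unfolding \<tau>_def by (rule openin_topology_generated_by)
    \<comment> \<open>A convex neighbourhood is needed inside an arbitrary generated open set, so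
      the induction follows its generation.\<close>
    then have "0 \<in> S \<longrightarrow> (\<exists>W. absolutely_convex W \<and> nbhd_zero \<tau> W \<and> W \<subseteq> S)"
    proof induction
      case Empty
      then show ?case by simp
    next
      case (Int A B)
      show ?case
      proof
        assume "0 \<in> A \<inter> B"
        then obtain WA WB where W: "absolutely_convex WA" "nbhd_zero \<tau> WA" "WA \<subseteq> A"
          "absolutely_convex WB" "nbhd_zero \<tau> WB" "WB \<subseteq> B"
          using Int.IH by blast
        obtain OA OB where O: "openin \<tau> OA" "0 \<in> OA" "OA \<subseteq> WA" "openin \<tau> OB" "0 \<in> OB" "OB \<subseteq> WB"
          using W unfolding nbhd_zero_def by blast
        have "nbhd_zero \<tau> (WA \<inter> WB)"
          unfolding nbhd_zero_def
          using W(2) O openin_Int[OF O(1,4)] by (auto simp: nbhd_zero_def intro!: exI[of _ "OA \<inter> OB"])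
        then show "\<exists>W. absolutely_convex W \<and> nbhd_zero \<tau> W \<and> W \<subseteq> A \<inter> B"
          using W by (intro exI[of _ "WA \<inter> WB"]) (auto intro: absolutely_convex_Int)
      qed
    next
      case (UN K)
      then show ?case by blast
    next
      case (Basis s)
      then obtain W T where W: "s = V \<inter> W" "T \<in> F" "openin T W" by blast
      show ?case
      proof
        assume "0 \<in> s"
        then have "nbhd_zero T W"
          using W openin_subset[OF W(3)] by (auto simp: nbhd_zero_def)
        then obtain Z where Z: "absolutely_convex Z" "nbhd_zero T Z" "Z \<subseteq> W"
          using locally_convex_spaceD(5)[OF F(2)[OF W(2)]] by blast
        then obtain Q where Q: "openin T Q" "0 \<in> Q" "Q \<subseteq> Z"
          by (auto simp: nbhd_zero_def)
        have "openin \<tau> (V \<inter> Q)"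
          unfolding \<tau>_def by (rule topology_generated_by_Basis) (use W(2) Q(1) in blast)
        then have "nbhd_zero \<tau> (V \<inter> Z)"
          unfolding nbhd_zero_def top using Q subspace_0[OF V] by blast
        then show "\<exists>W. absolutely_convex W \<and> nbhd_zero \<tau> W \<and> W \<subseteq> s"
          using Z W(1) absolutely_convex_Int[OF absolutely_convex_subspace[OF V] Z(1)] by blast
      qed
    qed
    then show ?thesis using S by blast
  qed
  ultimately show ?thesis
    unfolding locally_convex_space_def \<tau>_def[symmetric] using V top by blast
qed

section \<open>Seminorms and the topologies they define\<close>

definition seminorm_on :: "'v set \<Rightarrow> ('v \<Rightarrow> real) \<Rightarrow> bool" where
  "seminorm_on V p \<longleftrightarrow> (\<forall>x\<in>V. \<forall>y\<in>V. p (x + y) \<le> p x + p y) \<and> (\<forall>c. \<forall>x\<in>V. p (scale c x) = norm c * p x)"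

lemma seminorm_onD:
  assumes "seminorm_on V p"
  shows "x \<in> V \<Longrightarrow> y \<in> V \<Longrightarrow> p (x + y) \<le> p x + p y" "x \<in> V \<Longrightarrow> p (scale c x) = norm c * p x"
  using assms by (auto simp: seminorm_on_def)

text \<open>One inequality suffices for homogeneity: applied to \<open>inverse c\<close> it gives
  the other one, and nonnegativity settles \<open>c = 0\<close>.\<close>

lemma seminorm_onI:
  assumes V: "subspace V" and add: "\<And>x y. x \<in> V \<Longrightarrow> y \<in> V \<Longrightarrow> p (x + y) \<le> p x + p y"
    and le: "\<And>c x. x \<in> V \<Longrightarrow> p (scale c x) \<le> norm c * p x" and nonneg: "\<And>x. x \<in> V \<Longrightarrow> 0 \<le> p x"
  shows "seminorm_on V p"
  unfolding seminorm_on_def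
proof (intro conjI ballI allI add)
  fix c x assume x: "x \<in> V"
  then have cx: "scale c x \<in> V" using V by (simp add: subspace_scale)
  show "p (scale c x) = norm c * p x"
  proof (cases "c = 0")
    case True
    then show ?thesis using le[OF x, of c] nonneg[OF cx] by simp
  next
    case False
    then have "p x \<le> norm (inverse c) * p (scale c x)"
      using le[OF cx, of "inverse c"] by simp
    then have "norm c * p x \<le> p (scale c x)"
      using False by (simp add: norm_inverse inverse_eq_divide pos_le_divide_eq mult.commute norm_divide)
    then show ?thesis using le[OF x, of c] by simp
  qed
qed

lemma seminorm_zero: "seminorm_on V p \<Longrightarrow> subspace V \<Longrightarrow> p 0 = 0"
  using seminorm_onD(2)[of V p 0 0] subspace_0[of V] by simp

lemma seminorm_nonneg:
  assumes "seminorm_on V p" "subspace V" "x \<in> V"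
  shows "0 \<le> p x"
proof -
  have "- x \<in> V" using assms by (simp add: subspace_neg)
  then have "p (x + - x) \<le> p x + p (- x)" using assms by (intro seminorm_onD)
  moreover have "p (- x) = p x" using seminorm_onD(2)[OF assms(1,3), of "-1"] by simp
  ultimately show ?thesis using seminorm_zero[OF assms(1,2)] by simp
qed

text \<open>Described by seminorm balls and not by a metric, because a seminorm need not separate
  points.\<close>

definition seminorm_topology :: "'v set \<Rightarrow> ('v \<Rightarrow> real) \<Rightarrow> 'v topology" where
  "seminorm_topology V p = topology (\<lambda>W. W \<subseteq> V \<and> (\<forall>x\<in>W. \<exists>e>0. \<forall>y\<in>V. p (y - x) < e \<longrightarrow> y \<in> W))"

lemma openin_seminorm_topology:
  "openin (seminorm_topology V p) W \<longleftrightarrow> W \<subseteq> V \<and> (\<forall>x\<in>W. \<exists>e>0. \<forall>y\<in>V. p (y - x) < e \<longrightarrow> y \<in> W)"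
proof -
  have "istopology (\<lambda>W. W \<subseteq> V \<and> (\<forall>x\<in>W. \<exists>e>0. \<forall>y\<in>V. p (y - x) < e \<longrightarrow> y \<in> W))"
    unfolding istopology_def
  proof (intro conjI allI impI)
    fix S T
    assume S: "S \<subseteq> V \<and> (\<forall>x\<in>S. \<exists>e>0. \<forall>y\<in>V. p (y - x) < e \<longrightarrow> y \<in> S)"
      and T: "T \<subseteq> V \<and> (\<forall>x\<in>T. \<exists>e>0. \<forall>y\<in>V. p (y - x) < e \<longrightarrow> y \<in> T)"
    show "S \<inter> T \<subseteq> V" using S by blast
    show "\<forall>x\<in>S \<inter> T. \<exists>e>0. \<forall>y\<in>V. p (y - x) < e \<longrightarrow> y \<in> S \<inter> T"
    proof
      fix x assume "x \<in> S \<inter> T"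
      then obtain d e where "d > 0" "\<forall>y\<in>V. p (y - x) < d \<longrightarrow> y \<in> S" "e > 0" "\<forall>y\<in>V. p (y - x) < e \<longrightarrow> y \<in> T"
        using S T by blast
      then show "\<exists>e>0. \<forall>y\<in>V. p (y - x) < e \<longrightarrow> y \<in> S \<inter> T"
        by (intro exI[of _ "min d e"]) simp
    qed
  next
    fix K
    assume K: "\<forall>S\<in>K. S \<subseteq> V \<and> (\<forall>x\<in>S. \<exists>e>0. \<forall>y\<in>V. p (y - x) < e \<longrightarrow> y \<in> S)"
    show "\<Union>K \<subseteq> V" using K by blast
    show "\<forall>x\<in>\<Union>K. \<exists>e>0. \<forall>y\<in>V. p (y - x) < e \<longrightarrow> y \<in> \<Union>K"
    proof
      fix x assume "x \<in> \<Union>K"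
      then obtain S where "S \<in> K" "x \<in> S" by blast
      then show "\<exists>e>0. \<forall>y\<in>V. p (y - x) < e \<longrightarrow> y \<in> \<Union>K" using K by (meson UnionI)
    qed
  qed
  then show ?thesis by (simp add: seminorm_topology_def topology_inverse')
qed

lemma topspace_seminorm_topology: "topspace (seminorm_topology V p) = V"
  by (rule antisym) (auto simp: topspace_def openin_seminorm_topology intro: zero_less_one)

lemma openin_seminorm_ball:
  assumes p: "seminorm_on V p" and V: "subspace V" and x: "x \<in> V"
  shows "openin (seminorm_topology V p) {y \<in> V. p (y - x) < e}"
  unfolding openin_seminorm_topology
proof (intro conjI ballI)
  fix y assume y: "y \<in> {y \<in> V. p (y - x) < e}"
  show "\<exists>d>0. \<forall>z\<in>V. p (z - y) < d \<longrightarrow> z \<in> {y \<in> V. p (y - x) < e}"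
  proof (intro exI conjI ballI impI)
    show "0 < e - p (y - x)" using y by simp
    fix z assume z: "z \<in> V" "p (z - y) < e - p (y - x)"
    have "p ((z - y) + (y - x)) \<le> p (z - y) + p (y - x)"
      using V x y z by (intro seminorm_onD(1)[OF p]) (auto intro: subspace_diff)
    then show "z \<in> {y \<in> V. p (y - x) < e}" using z by simp
  qed
qed blast

lemma locally_convex_space_seminorm:
  assumes p: "seminorm_on V p" and V: "subspace V"
  shows "locally_convex_space V (seminorm_topology V p)"
proof -
  let ?T = "seminorm_topology V p"
  note top = topspace_seminorm_topology[of V p]
  note ball = openin_seminorm_ball[OF p V]
  note [simp] = subspace_add[OF V] subspace_scale[OF V] subspace_diff[OF V]
  have "continuous_map (prod_topology ?T ?T) ?T (\<lambda>(x, y). x + y)"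
    unfolding continuous_map
  proof (intro conjI allI impI)
    show "(\<lambda>(x, y). x + y) ` topspace (prod_topology ?T ?T) \<subseteq> topspace ?T"
      by (auto simp: top)
    fix U assume U: "openin ?T U"
    show "openin (prod_topology ?T ?T) {z \<in> topspace (prod_topology ?T ?T). (case z of (x, y) \<Rightarrow> x + y) \<in> U}"
      unfolding openin_prod_topology_alt
    proof (intro allI impI)
      fix x y assume "(x, y) \<in> {z \<in> topspace (prod_topology ?T ?T). (case z of (x, y) \<Rightarrow> x + y) \<in> U}"
      then have xy: "x \<in> V" "y \<in> V" "x + y \<in> U" by (auto simp: top)
      obtain e where e: "e > 0" "\<forall>z\<in>V. p (z - (x + y)) < e \<longrightarrow> z \<in> U"
        using U xy(3) unfolding openin_seminorm_topology by blast
      show "\<exists>A B. openin ?T A \<and> openin ?T B \<and> x \<in> A \<and> y \<in> B \<and>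
         A \<times> B \<subseteq> {z \<in> topspace (prod_topology ?T ?T). (case z of (x, y) \<Rightarrow> x + y) \<in> U}"
      proof (intro exI conjI)
        show "openin ?T {z \<in> V. p (z - x) < e / 2}" "openin ?T {z \<in> V. p (z - y) < e / 2}"
          using xy by (blast intro: ball)+
        show "x \<in> {z \<in> V. p (z - x) < e / 2}" "y \<in> {z \<in> V. p (z - y) < e / 2}"
          using xy e seminorm_zero[OF p V] by auto
        have "a + b \<in> U" if "a \<in> V" "b \<in> V" "p (a - x) < e / 2" "p (b - y) < e / 2" for a b
        proof -
          have "p ((a - x) + (b - y)) \<le> p (a - x) + p (b - y)"
            using that xy by (intro seminorm_onD(1)[OF p]) auto
          then have "p (a + b - (x + y)) < e" using that by (simp add: algebra_simps)
          then show ?thesis using e that by simp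
        qed
        then show "{z \<in> V. p (z - x) < e / 2} \<times> {z \<in> V. p (z - y) < e / 2} \<subseteq>
            {z \<in> topspace (prod_topology ?T ?T). (case z of (x, y) \<Rightarrow> x + y) \<in> U}"
          by (auto simp: top)
      qed
    qed
  qed
  moreover have "continuous_map (prod_topology euclidean ?T) ?T (\<lambda>(c, x). scale c x)"
    unfolding continuous_map
  proof (intro conjI allI impI)
    show "(\<lambda>(c, x). scale c x) ` topspace (prod_topology euclidean ?T) \<subseteq> topspace ?T"
      by (auto simp: top)
    fix U assume U: "openin ?T U"
    show "openin (prod_topology euclidean ?T) {z \<in> topspace (prod_topology euclidean ?T). (case z of (c, x) \<Rightarrow> scale c x) \<in> U}"
      unfolding openin_prod_topology_alt
    proof (intro allI impI)
      fix c x assume "(c, x) \<in> {z \<in> topspace (prod_topology euclidean ?T). (case z of (c, x) \<Rightarrow> scale c x) \<in> U}"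
      then have x: "x \<in> V" "scale c x \<in> U" by (auto simp: top)
      obtain e where e: "e > 0" "\<forall>z\<in>V. p (z - scale c x) < e \<longrightarrow> z \<in> U"
        using U x(2) unfolding openin_seminorm_topology by blast
      \<comment> \<open>Splitting a y - c x as a (y - x) + (a - c) x, \<open>d\<close> and
        \<open>b\<close> make each part contribute at most e/2; the minimum with 1 gives
        \<open>norm a \<le> norm c + 1\<close>, and the added 1 keeps the denominators
        positive.\<close>
      define d where "d = (e / 2) / (norm c + 1)"
      define b where "b = min 1 (e / (2 * (p x + 1)))"
      have px: "0 \<le> p x" using p V x by (intro seminorm_nonneg)
      have d: "0 < d" using e by (simp add: d_def add_nonneg_pos)
      have b: "0 < b" using e px by (simp add: b_def)
      show "\<exists>A B. openin euclidean A \<and> openin ?T B \<and> c \<in> A \<and> x \<in> B \<and>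
         A \<times> B \<subseteq> {z \<in> topspace (prod_topology euclidean ?T). (case z of (c, x) \<Rightarrow> scale c x) \<in> U}"
      proof (intro exI conjI)
        show "openin euclidean (ball c b)" "openin ?T {z \<in> V. p (z - x) < d}"
          using x by (blast intro: ball open_openin[THEN iffD1] open_ball)+
        show "c \<in> ball c b" "x \<in> {z \<in> V. p (z - x) < d}"
          using x b d seminorm_zero[OF p V] by auto
        have "scale a y \<in> U" if "dist c a < b" "y \<in> V" "p (y - x) < d" for a y
        proof -
          have ac: "norm (a - c) < b" using that(1) by (simp add: dist_norm norm_minus_commute)
          have "norm a \<le> norm c + norm (a - c)"
            using norm_triangle_ineq[of c "a - c"] by simp
          then have na: "norm a \<le> norm c + 1" using ac by (simp add: b_def)
          have "p (scale a (y - x) + scale (a - c) x) \<le> p (scale a (y - x)) + p (scale (a - c) x)"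
            using that x by (intro seminorm_onD(1)[OF p]) auto
          also have "\<dots> = norm a * p (y - x) + norm (a - c) * p x"
            using that x by (simp add: seminorm_onD(2)[OF p])
          also have "norm a * p (y - x) \<le> (norm c + 1) * d"
            using na that x seminorm_nonneg[OF p V, of "y - x"] by (intro mult_mono) auto
          also have "(norm c + 1) * d = e / 2"
          proof -
            have "norm c + 1 \<noteq> 0" using norm_ge_zero[of c] by linarith
            then show ?thesis
              unfolding d_def by (metis nonzero_mult_div_cancel_left times_divide_eq_right)
          qed
          also have "norm (a - c) * p x \<le> e / (2 * (p x + 1)) * p x"
            using ac px by (intro mult_right_mono) (auto simp: b_def)
          also have "\<dots> < e / 2"
            using e px by (simp add: field_simps)
          also have "scale a (y - x) + scale (a - c) x = scale a y - scale c x"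
            by (simp add: scale_right_diff_distrib scale_left_diff_distrib)
          finally show ?thesis using e that by simp
        qed
        then show "ball c b \<times> {z \<in> V. p (z - x) < d} \<subseteq>
            {z \<in> topspace (prod_topology euclidean ?T). (case z of (c, x) \<Rightarrow> scale c x) \<in> U}"
          by (auto simp: top)
      qed
    qed
  qed
  moreover have "\<exists>W. absolutely_convex W \<and> nbhd_zero ?T W \<and> W \<subseteq> U" if "nbhd_zero ?T U" for U
  proof -
    from that obtain S where "openin ?T S" "0 \<in> S" "S \<subseteq> U"
      by (auto simp: nbhd_zero_def)
    then obtain e where e: "e > 0" "\<forall>z\<in>V. p (z - 0) < e \<longrightarrow> z \<in> U"
      unfolding openin_seminorm_topology by blast
    let ?W = "{z \<in> V. p (z - 0) < e}"
    have "absolutely_convex ?W"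
      unfolding absolutely_convex_def
    proof (intro ballI allI impI)
      fix x y and a b :: complex
      assume xy: "x \<in> ?W" "y \<in> ?W" and ab: "norm a + norm b \<le> 1"
      have "p (scale a x + scale b y) \<le> norm a * p x + norm b * p y"
        using seminorm_onD(1)[OF p, of "scale a x" "scale b y"] xy by (simp add: seminorm_onD(2)[OF p])
      also have "\<dots> \<le> norm a * max (p x) (p y) + norm b * max (p x) (p y)"
        by (intro add_mono mult_left_mono) auto
      also have "\<dots> = (norm a + norm b) * max (p x) (p y)" by (simp add: distrib_right)
      also have "\<dots> \<le> 1 * max (p x) (p y)"
        using ab seminorm_nonneg[OF p V, of x] xy by (intro mult_right_mono) (auto simp: le_max_iff_disj)
      also have "\<dots> < e" using xy by simp
      finally show "scale a x + scale b y \<in> ?W" using xy by simp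
    qed
    moreover have "nbhd_zero ?T ?W"
      unfolding nbhd_zero_def top
      using ball[of 0 e] e seminorm_zero[OF p V] subspace_0[OF V] by (intro conjI exI[of _ ?W]) auto
    ultimately show ?thesis using e by (intro exI[of _ ?W]) auto
  qed
  ultimately show ?thesis
    unfolding locally_convex_space_def using V top by blast
qed

section \<open>The Minkowski functional of an absolutely convex set\<close>

definition gauge_of :: "'v set \<Rightarrow> 'v \<Rightarrow> real" where
  "gauge_of A x = Inf {t. 0 < t \<and> x \<in> scale (of_real t) ` A}"

lemma absolutely_convex_scale_mono:
  assumes "absolutely_convex A" "0 < s" "s \<le> t" "x \<in> scale (of_real s) ` A"
  shows "x \<in> scale (of_real t) ` A"
proof -
  obtain a where a: "a \<in> A" "x = scale (of_real s) a" using assms by blast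
  have "norm (complex_of_real (s / t)) + norm (0 :: complex) \<le> 1"
    using assms unfolding norm_of_real by simp
  then have "scale (of_real (s / t)) a + scale 0 a \<in> A"
    using assms(1) a(1) unfolding absolutely_convex_def by blast
  moreover have "x = scale (of_real t) (scale (of_real (s / t)) a + scale 0 a)"
    using assms a by simp
  ultimately show ?thesis by blast
qed

lemma gauge_of_le: "0 < t \<Longrightarrow> x \<in> scale (of_real t) ` A \<Longrightarrow> gauge_of A x \<le> t"
  unfolding gauge_of_def by (rule cInf_lower) (auto intro: bdd_belowI[of _ 0])

lemma gauge_of_less:
  assumes "absolutely_convex A" "\<exists>t>0. x \<in> scale (of_real t) ` A" "gauge_of A x < s"
  shows "x \<in> scale (of_real s) ` A"
proof -
  have "{t. 0 < t \<and> x \<in> scale (of_real t) ` A} \<noteq> {}" using assms(2) by blast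
  from cInf_lessD[OF this assms(3)[unfolded gauge_of_def]]
  obtain t where "0 < t" "x \<in> scale (of_real t) ` A" "t < s" by blast
  then show ?thesis using assms(1) absolutely_convex_scale_mono[of A t s x] by simp
qed

lemma gauge_of_nonneg: "\<exists>t>0. x \<in> scale (of_real t) ` A \<Longrightarrow> 0 \<le> gauge_of A x"
  unfolding gauge_of_def by (rule cInf_greatest) auto

lemma seminorm_gauge_of:
  assumes A: "absolutely_convex A" and V: "subspace V" and absb: "\<And>x. x \<in> V \<Longrightarrow> \<exists>t>0. x \<in> scale (of_real t) ` A"
  shows "seminorm_on V (gauge_of A)"
proof (rule seminorm_onI[OF V])
  show "0 \<le> gauge_of A x" if "x \<in> V" for x
    by (rule gauge_of_nonneg[OF absb[OF that]])
next
  fix x y assume x: "x \<in> V" and y: "y \<in> V"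
  show "gauge_of A (x + y) \<le> gauge_of A x + gauge_of A y"
  proof (rule field_le_epsilon)
    fix e :: real assume e: "0 < e"
    define s where "s = gauge_of A x + e / 2"
    define t where "t = gauge_of A y + e / 2"
    have st: "0 < s" "0 < t"
      using e gauge_of_nonneg[OF absb[OF x]] gauge_of_nonneg[OF absb[OF y]] by (auto simp: s_def t_def)
    have "x \<in> scale (of_real s) ` A" "y \<in> scale (of_real t) ` A"
      using e gauge_of_less[OF A absb[OF x], of s] gauge_of_less[OF A absb[OF y], of t] by (simp_all add: s_def t_def)
    then obtain a b where ab: "a \<in> A" "x = scale (of_real s) a" "b \<in> A" "y = scale (of_real t) b" by blast
    have "norm (complex_of_real (s / (s + t))) + norm (complex_of_real (t / (s + t))) \<le> 1"
      using st unfolding norm_of_real by (simp add: add_divide_distrib[symmetric])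
    then have "scale (of_real (s / (s + t))) a + scale (of_real (t / (s + t))) b \<in> A"
      using A ab unfolding absolutely_convex_def by blast
    moreover have "x + y = scale (of_real (s + t)) (scale (of_real (s / (s + t))) a + scale (of_real (t / (s + t))) b)"
    proof -
      have "complex_of_real (s + t) * of_real (s / (s + t)) = of_real s" 
        "complex_of_real (s + t) * of_real (t / (s + t)) = of_real t"
        unfolding of_real_mult[symmetric] using st by simp_all
      then show ?thesis
        unfolding ab by (simp only: scale_right_distrib scale_scale)
    qed
    ultimately have "gauge_of A (x + y) \<le> s + t"
      by (intro gauge_of_le[OF add_pos_pos[OF st]]) (rule image_eqI)
    then show "gauge_of A (x + y) \<le> gauge_of A x + gauge_of A y + e" by (simp add: s_def t_def)
  qed
next
  show "gauge_of A (scale c x) \<le> norm c * gauge_of A x" if x: "x \<in> V" for c x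
  proof (rule field_le_epsilon)
    fix e :: real assume e: "0 < e"
    define s where "s = gauge_of A x + e / (norm c + 1)"
    have e': "0 < e / (norm c + 1)" using e by (simp add: add_nonneg_pos)
    then have s: "0 < s" using gauge_of_nonneg[OF absb[OF x]] by (simp add: s_def)
    have "x \<in> scale (of_real s) ` A"
      using e' gauge_of_less[OF A absb[OF x], of s] by (simp add: s_def)
    then obtain a where a: "a \<in> A" "x = scale (of_real s) a" by blast
    \<comment> \<open>The extra summand keeps \<open>t\<close> positive when \<open>c = 0\<close>;
      together with the one inside \<open>s\<close> the errors add up to exactly
      \<open>e\<close>.\<close>
    define t where "t = norm c * s + e / (norm c + 1)"
    have t: "0 < t" using s e' by (auto simp: t_def intro: add_nonneg_pos)
    have "norm (c * of_real s / of_real t) + norm (0 :: complex) \<le> 1"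
    proof -
      have "norm c * s \<le> t" using e' by (simp add: t_def)
      then show ?thesis using s t by (simp add: norm_divide norm_mult)
    qed
    then have "scale (c * of_real s / of_real t) a + scale 0 a \<in> A"
      using A a(1) unfolding absolutely_convex_def by blast
    moreover have "scale c x = scale (of_real t) (scale (c * of_real s / of_real t) a + scale 0 a)"
      using t a by simp
    ultimately have "gauge_of A (scale c x) \<le> t"
      by (intro gauge_of_le[OF t]) (rule image_eqI)
    also have "t = norm c * gauge_of A x + (norm c + 1) * (e / (norm c + 1))"
      unfolding t_def s_def distrib_left distrib_right by simp
    also have "(norm c + 1) * (e / (norm c + 1)) = e"
      using e' by (auto simp: zero_less_divide_iff)
    finally show "gauge_of A (scale c x) \<le> norm c * gauge_of A x + e" .
  qed
qed

section \<open>Absorption of sets\<close>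

lemma absorbs_mono: "absorbs A B \<Longrightarrow> A \<subseteq> A' \<Longrightarrow> absorbs A' B"
  unfolding absorbs_def by (meson image_mono subset_trans)

text \<open>Allows boundedness in a generated topology to be tested on the generating sets that
  contain 0.\<close>

lemma absorbs_generated:
  assumes "generate_topology_on G S" "0 \<in> S" "\<And>U. U \<in> G \<Longrightarrow> 0 \<in> U \<Longrightarrow> absorbs U B"
  shows "absorbs S B"
  using assms(1,2)
proof induction
  case Empty
  then show ?case by simp
next
  case (Int S1 S2)
  then obtain r1 r2 where r: "r1 > 0" "\<And>c. norm c \<ge> r1 \<Longrightarrow> B \<subseteq> scale c ` S1"
     "r2 > 0" "\<And>c. norm c \<ge> r2 \<Longrightarrow> B \<subseteq> scale c ` S2"
    unfolding absorbs_def by blast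
  have "B \<subseteq> scale c ` (S1 \<inter> S2)" if "norm c \<ge> max r1 r2" for c
  proof
    fix x assume "x \<in> B"
    then obtain s1 s2 where s: "s1 \<in> S1" "x = scale c s1" "s2 \<in> S2" "x = scale c s2"
      using r(2)[of c] r(4)[of c] \<open>norm c \<ge> max r1 r2\<close> by (auto 4 4)
    have "c \<noteq> 0" using that r by auto
    then have "s1 = s2" using s by (metis scale_left_imp_eq)
    then show "x \<in> scale c ` (S1 \<inter> S2)" using s by blast
  qed
  then show ?case unfolding absorbs_def using r by (intro exI[of _ "max r1 r2"]) auto
next
  case (UN K)
  then obtain k where "k \<in> K" "0 \<in> k" by blast
  then show ?case using UN.IH absorbs_mono by blast
next
  case (Basis s)
  then show ?case using assms(3) by blast
qed

end

section \<open>The topologies of \<open>X_n\<close> and \<open>O_M\<close>\<close>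

text \<open>Bridge from the supremum norm to \<open>bounded_C_k\<close>: on \<open>X_nN n N\<close>
  the norm is the least admissible \<open>M\<close>, so norm estimates reduce to exhibiting some
  \<open>M\<close>.\<close>

lemma bounded_C_k_weighted_values:
  assumes "C_k n f"
  shows "bounded_C_k n (\<lambda>x. M * bracket x ^ N) f \<longleftrightarrow> (\<forall>v\<in>weighted_values n N f. v \<le> M)"
proof -
  have "norm (mpartial \<alpha> f x) / bracket x ^ N \<le> M \<longleftrightarrow> norm (mpartial \<alpha> f x) \<le> M * bracket x ^ N" for \<alpha> x
    by (simp add: pos_divide_le_eq bracket_pos)
  then show ?thesis
    unfolding bounded_C_k_mpartial[OF assms] weighted_values_def by blast
qed

lemma weighted_values_nonempty:
  fixes f :: "real^'a::finite \<Rightarrow> complex"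
  shows "weighted_values n N f \<noteq> {}"
proof -
  have "norm (mpartial (\<lambda>_. 0) f 0) / bracket (0 :: real^'a) ^ N \<in> weighted_values n N f"
    unfolding weighted_values_def order_of_def by (intro CollectI exI[of _ 0] exI[of _ "\<lambda>_. 0"]) simp
  then show ?thesis by blast
qed

lemma X_nN_iff: "f \<in> X_nN n N \<longleftrightarrow> (\<exists>M. bounded_C_k n (\<lambda>x. M * bracket x ^ N) f)"
  using bounded_C_k_weighted_values[of n f _ N] bounded_C_k_C_k
  unfolding X_nN_def bdd_above_def by blast

lemma norm_nN_bounded:
  assumes "f \<in> X_nN n N"
  shows "bounded_C_k n (\<lambda>x. norm_nN n N f * bracket x ^ N) f"
  using assms unfolding X_nN_def norm_nN_def
  by (auto simp: bounded_C_k_weighted_values intro: cSup_upper)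

lemma norm_nN_le: "bounded_C_k n (\<lambda>x. M * bracket x ^ N) f \<Longrightarrow> norm_nN n N f \<le> M"
  unfolding norm_nN_def
  by (rule cSup_least[OF weighted_values_nonempty])
     (use bounded_C_k_weighted_values[OF bounded_C_k_C_k] in blast)

lemma norm_nN_nonneg: "f \<in> X_nN n N \<Longrightarrow> 0 \<le> norm_nN n N f"
  using weight_nonneg norm_nN_bounded by blast

lemma bounded_C_k_weight_mono:
  assumes "bounded_C_k n (\<lambda>x. M * bracket x ^ N) f" "N \<le> N'" "m \<le> n"
  shows "bounded_C_k m (\<lambda>x. M * bracket x ^ N') f"
  using assms weight_nonneg[OF assms(1)]
  by (intro bounded_C_k_mono[OF assms(1)] mult_left_mono power_increasing bracket_ge_1)

lemma bounded_C_k_zero: "bounded_C_k n (\<lambda>x. 0) (\<lambda>x. 0)"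
  by (induction n) (auto simp: partial_const)

lemma bounded_C_k_add_weight:
  assumes "bounded_C_k n (\<lambda>x. M * bracket x ^ N) f" "bounded_C_k n (\<lambda>x. M' * bracket x ^ N) g"
  shows "bounded_C_k n (\<lambda>x. (M + M') * bracket x ^ N) (f + g)"
  using bounded_C_k_add[OF assms] by (simp add: distrib_right)

lemma bounded_C_k_fscale_weight:
  assumes "bounded_C_k n (\<lambda>x. M * bracket x ^ N) f"
  shows "bounded_C_k n (\<lambda>x. (norm c * M) * bracket x ^ N) (fscale c f)"
  using bounded_C_k_fscale[OF assms] by (simp add: mult.assoc)

lemma X_nN_I: "bounded_C_k n (\<lambda>x. M * bracket x ^ N) f \<Longrightarrow> f \<in> X_nN n N"
  unfolding X_nN_iff by blast

lemma X_nN_add: "f \<in> X_nN n N \<Longrightarrow> g \<in> X_nN n N \<Longrightarrow> f + g \<in> X_nN n N"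
  by (rule X_nN_I[OF bounded_C_k_add_weight[OF norm_nN_bounded norm_nN_bounded]])

lemma X_nN_fscale: "f \<in> X_nN n N \<Longrightarrow> fscale c f \<in> X_nN n N"
  by (rule X_nN_I[OF bounded_C_k_fscale_weight[OF norm_nN_bounded]])

lemma subspace_X_nN: "cfun.subspace (X_nN n N)"
  unfolding cfun.subspace_def
proof (intro conjI ballI allI)
  show "0 \<in> X_nN n N"
    using bounded_C_k_zero by (intro X_nN_I[of n 0]) (simp add: zero_fun_def)
qed (simp_all only: X_nN_add X_nN_fscale)

lemma X_nN_diff: "f \<in> X_nN n N \<Longrightarrow> g \<in> X_nN n N \<Longrightarrow> f - g \<in> X_nN n N"
  by (rule cfun.subspace_diff[OF subspace_X_nN])

lemma norm_nN_add: "f \<in> X_nN n N \<Longrightarrow> g \<in> X_nN n N \<Longrightarrow> norm_nN n N (f + g) \<le> norm_nN n N f + norm_nN n N g"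
  by (intro norm_nN_le bounded_C_k_add_weight norm_nN_bounded)

lemma norm_nN_fscale: "f \<in> X_nN n N \<Longrightarrow> norm_nN n N (fscale c f) \<le> norm c * norm_nN n N f"
  by (intro norm_nN_le bounded_C_k_fscale_weight norm_nN_bounded)

lemma fscale_minus_one: "fscale (-1) f = - f"
  by (simp add: fscale_def fun_eq_iff)

lemma norm_nN_minus_commute:
  assumes "f \<in> X_nN n N" "g \<in> X_nN n N"
  shows "norm_nN n N (f - g) = norm_nN n N (g - f)"
proof -
  have "norm_nN n N (f - g) \<le> norm_nN n N (g - f)" if "f \<in> X_nN n N" "g \<in> X_nN n N" for f g :: "real^'a \<Rightarrow> complex"
  proof -
    have "g - f \<in> X_nN n N" using that by (intro X_nN_diff)
    then have "norm_nN n N (fscale (-1) (g - f)) \<le> norm (-1 :: complex) * norm_nN n N (g - f)"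
      by (rule norm_nN_fscale)
    then show ?thesis unfolding fscale_minus_one minus_diff_eq by simp
  qed
  then show ?thesis using assms by (intro antisym)
qed

lemma Metric_space_nN: "Metric_space (X_nN n N) (dist_nN n N)"
proof
  fix f g h :: "real^'a \<Rightarrow> complex"
  show "0 \<le> dist_nN n N f g"
    unfolding dist_nN_def by (simp add: norm_nN_nonneg X_nN_diff del: minus_apply)
  show "dist_nN n N f g = dist_nN n N g f"
    unfolding dist_nN_def by (simp add: norm_nN_minus_commute del: minus_apply)
  assume f: "f \<in> X_nN n N" and g: "g \<in> X_nN n N"
  have fg: "f - g \<in> X_nN n N" using f g by (intro X_nN_diff)
  show "dist_nN n N f g = 0 \<longleftrightarrow> f = g"
  proof
    assume "dist_nN n N f g = 0"
    then have "norm_nN n N (f - g) = 0" using f g by (simp add: dist_nN_def del: minus_apply)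
    then have "norm ((f - g) x) \<le> 0" for x
      using bounded_C_k_norm[OF norm_nN_bounded[OF fg], of x] by simp
    then show "f = g" by (simp add: fun_eq_iff)
  next
    assume "f = g"
    have "norm_nN n N (f - g) \<le> 0"
      using bounded_C_k_zero[of n] \<open>f = g\<close> by (intro norm_nN_le) (simp add: zero_fun_def)
    then show "dist_nN n N f g = 0"
      using norm_nN_nonneg[OF fg] f g by (simp add: dist_nN_def)
  qed
  assume h: "h \<in> X_nN n N"
  have gh: "g - h \<in> X_nN n N" using g h by (intro X_nN_diff)
  have "norm_nN n N ((f - g) + (g - h)) \<le> norm_nN n N (f - g) + norm_nN n N (g - h)"
    by (rule norm_nN_add[OF fg gh])
  also have "(f - g) + (g - h) = f - h" by (simp add: fun_eq_iff)
  finally show "dist_nN n N f h \<le> dist_nN n N f g + dist_nN n N g h"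
    using f g h by (simp only: dist_nN_def simp_thms if_True)
qed

lemma openin_top_nN:
  "openin (top_nN n N) W \<longleftrightarrow> W \<subseteq> X_nN n N \<and> (\<forall>f\<in>W. \<exists>e>0. \<forall>g\<in>X_nN n N. norm_nN n N (g - f) < e \<longrightarrow> g \<in> W)"
proof -
  interpret Metric_space "X_nN n N :: (real^'a \<Rightarrow> complex) set" "dist_nN n N" by (rule Metric_space_nN)
  have "mball f e \<subseteq> W \<longleftrightarrow> (\<forall>g\<in>X_nN n N. norm_nN n N (g - f) < e \<longrightarrow> g \<in> W)" if "f \<in> X_nN n N" for f e
    using that norm_nN_minus_commute[OF that] by (auto simp: mball_def dist_nN_def subset_iff)
  then show ?thesis
    unfolding top_nN_def openin_mtopology by (meson subsetD)
qed

lemma topspace_top_nN: "topspace (top_nN n N) = X_nN n N"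
  unfolding top_nN_def using Metric_space.topspace_mtopology[OF Metric_space_nN] .

lemma X_nN_mono: "N \<le> N' \<Longrightarrow> X_nN n N \<subseteq> X_nN n N'"
  by (auto intro: X_nN_I bounded_C_k_weight_mono[OF norm_nN_bounded])

section \<open>The inductive limit topology of \<open>X_n\<close>\<close>

lemma X_n_iff: "f \<in> X_n n \<longleftrightarrow> (\<exists>N M. bounded_C_k n (\<lambda>x. M * bracket x ^ N) f)"
proof
  assume "\<exists>N M. bounded_C_k n (\<lambda>x. M * bracket x ^ N) f"
  then obtain N M where "bounded_C_k n (\<lambda>x. M * bracket x ^ N) f" by blast
  \<comment> \<open>The union in \<open>X_n\<close> starts at exponent 1, so the exponent is raised
    once to exclude 0.\<close>
  then have "bounded_C_k n (\<lambda>x. M * bracket x ^ Suc N) f"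
    by (rule bounded_C_k_weight_mono) auto
  then show "f \<in> X_n n" unfolding X_n_def by (intro UN_I[of "Suc N"] X_nN_I) auto
next
  assume "f \<in> X_n n"
  then show "\<exists>N M. bounded_C_k n (\<lambda>x. M * bracket x ^ N) f"
    unfolding X_n_def using norm_nN_bounded by blast
qed

lemma subspace_X_n: "cfun.subspace (X_n n :: (real^'a::finite \<Rightarrow> complex) set)"
  unfolding cfun.subspace_def
proof (intro conjI ballI allI)
  show "0 \<in> X_n n" unfolding X_n_def using cfun.subspace_0[OF subspace_X_nN] by blast
  fix f g :: "real^'a \<Rightarrow> complex" and c
  assume f: "f \<in> X_n n"
  then obtain N where N: "N \<ge> 1" "f \<in> X_nN n N" unfolding X_n_def by auto
  then show "fscale c f \<in> X_n n" unfolding X_n_def using cfun.subspace_scale[OF subspace_X_nN] by blast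
  assume "g \<in> X_n n"
  then obtain N' where N': "N' \<ge> 1" "g \<in> X_nN n N'" unfolding X_n_def by auto
  have "f \<in> X_nN n (N + N')" "g \<in> X_nN n (N + N')"
    using N N' X_nN_mono[of N "N + N'" n] X_nN_mono[of N' "N + N'" n] by auto
  then have "f + g \<in> X_nN n (N + N')" by (rule cfun.subspace_add[OF subspace_X_nN])
  then show "f + g \<in> X_n n" unfolding X_n_def using N by (auto intro!: bexI[of _ "N + N'"])
qed

lemma X_nN_subset_X_n: "X_nN n N \<subseteq> X_n n"
  unfolding X_n_iff subset_iff using norm_nN_bounded by blast

text \<open>The competing topologies whose supremum is the inductive limit topology, see
  \<open>top_n_eq\<close>.\<close>

definition admissible :: "nat \<Rightarrow> (real^'d::finite \<Rightarrow> complex) topology set" where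
  "admissible n = {T. cfun.locally_convex_space (X_n n) T \<and> (\<forall>N\<in>{1..}. continuous_map (top_nN n N) T (\<lambda>x. x))}"

text \<open>The source of neighbourhoods in \<open>top_n\<close>: a seminorm bounded on each
  \<open>X_nN n N\<close>, with a constant that may depend on \<open>N\<close>, defines one of the
  competing topologies.\<close>

lemma seminorm_topology_admissible:
  assumes p: "cfun.seminorm_on (X_n n) p" and C: "\<And>N. \<exists>C. \<forall>f\<in>X_nN n N. p f \<le> C * norm_nN n N f"
  shows "cfun.seminorm_topology (X_n n) p \<in> admissible n"
  unfolding admissible_def
proof (intro CollectI conjI ballI)
  show "cfun.locally_convex_space (X_n n) (cfun.seminorm_topology (X_n n) p)"
    by (rule cfun.locally_convex_space_seminorm[OF p subspace_X_n])
  fix N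
  obtain C where C: "\<And>f. f \<in> X_nN n N \<Longrightarrow> p f \<le> C * norm_nN n N f" using C by blast
  show "continuous_map (top_nN n N) (cfun.seminorm_topology (X_n n) p) (\<lambda>x. x)"
    unfolding continuous_map topspace_top_nN cfun.topspace_seminorm_topology
  proof (intro conjI allI impI)
    show "(\<lambda>x. x) ` X_nN n N \<subseteq> X_n n" using X_nN_subset_X_n by auto
    fix U assume U: "openin (cfun.seminorm_topology (X_n n) p) U"
    show "openin (top_nN n N) {x \<in> X_nN n N. x \<in> U}"
      unfolding openin_top_nN
    proof (intro conjI ballI)
      fix f assume "f \<in> {x \<in> X_nN n N. x \<in> U}"
      then have f: "f \<in> X_nN n N" "f \<in> U" by auto
      obtain e where e: "e > 0" "\<forall>g\<in>X_n n. p (g - f) < e \<longrightarrow> g \<in> U"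
        using U f(2) unfolding cfun.openin_seminorm_topology by blast
      show "\<exists>e>0. \<forall>g\<in>X_nN n N. norm_nN n N (g - f) < e \<longrightarrow> g \<in> {x \<in> X_nN n N. x \<in> U}"
      proof (intro exI conjI ballI impI)
        show "0 < e / (\<bar>C\<bar> + 1)" using e by (simp add: add_nonneg_pos)
        fix g assume g: "g \<in> X_nN n N" "norm_nN n N (g - f) < e / (\<bar>C\<bar> + 1)"
        have gf: "g - f \<in> X_nN n N" using f g by (intro X_nN_diff)
        have "p (g - f) \<le> C * norm_nN n N (g - f)" by (rule C[OF gf])
        also have "\<dots> \<le> (\<bar>C\<bar> + 1) * norm_nN n N (g - f)"
          using norm_nN_nonneg[OF gf] by (intro mult_right_mono) auto
        also have "\<dots> < e" using g(2) by (simp add: pos_less_divide_eq add_nonneg_pos mult.commute)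
        finally show "g \<in> {x \<in> X_nN n N. x \<in> U}"
          using e(2) g(1) X_nN_subset_X_n by auto
      qed
    qed blast
  qed
qed

text \<open>The zero seminorm, that is, the indiscrete topology, always competes.\<close>

lemma admissible_nonempty: "admissible n \<noteq> {}"
proof -
  have "cfun.seminorm_topology (X_n n) (\<lambda>_. 0) \<in> admissible n"
    by (rule seminorm_topology_admissible) (auto simp: cfun.seminorm_on_def intro: exI[of _ 0])
  then show ?thesis by blast
qed

lemma top_n_eq: "top_n n = topology_generated_by {X_n n \<inter> U |U. \<exists>T\<in>admissible n. openin T U}"
proof -
  have "U \<subseteq> X_n n" if "T \<in> admissible n" "openin T U" for T :: "(real^'a \<Rightarrow> complex) topology" and U
    using that openin_subset[of T U] cfun.locally_convex_spaceD(2)[of "X_n n" T] by (auto simp: admissible_def)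
  then have "X_n n \<inter> U = U" if "T \<in> admissible n" "openin T U" for T :: "(real^'a \<Rightarrow> complex) topology" and U
    using that by blast
  then have "{X_n n \<inter> U |U. \<exists>T\<in>admissible n. openin T U} = {U. \<exists>T\<in>admissible n. openin (T :: (real^'a \<Rightarrow> complex) topology) U}"
    by (auto; metis)
  then show ?thesis
    unfolding top_n_def cfun.lc_inductive_limit_def admissible_def by (simp add: conj_assoc)
qed

lemma locally_convex_space_top_n: "cfun.locally_convex_space (X_n n) (top_n n)"
  unfolding top_n_eq
proof (rule cfun.locally_convex_space_generated[OF subspace_X_n admissible_nonempty])
  fix T :: "(real^'a \<Rightarrow> complex) topology" assume "T \<in> admissible n"
  then have "cfun.locally_convex_space (X_n n) T" by (simp add: admissible_def)
  with cfun.locally_convex_spaceD(2)[OF this]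
  show "cfun.locally_convex_space (topspace T) T" "X_n n \<subseteq> topspace T" by simp_all
qed

lemma topspace_top_n: "topspace (top_n n) = X_n n"
  by (rule cfun.locally_convex_spaceD(2)[OF locally_convex_space_top_n])

lemma continuous_map_top_nN_top_n:
  assumes "1 \<le> N"
  shows "continuous_map (top_nN n N) (top_n n :: (real^'a::finite \<Rightarrow> complex) topology) (\<lambda>x. x)"
proof -
  have "openin (top_nN n N) ((\<lambda>x. x) -` U \<inter> topspace (top_nN n N))"
    if U: "U \<in> {X_n n \<inter> U |U. \<exists>T\<in>admissible n. openin T U}" for U :: "(real^'a \<Rightarrow> complex) set"
  proof -
    obtain W and T :: "(real^'a \<Rightarrow> complex) topology" where W: "U = X_n n \<inter> W" "T \<in> admissible n" "openin T W"
      using U by blast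
    have "continuous_map (top_nN n N) T (\<lambda>x. x)"
      using W(2) assms by (auto simp: admissible_def)
    then have "openin (top_nN n N) {x \<in> topspace (top_nN n N). x \<in> W}"
      using W(3) by (simp add: continuous_map)
    moreover have "{x \<in> topspace (top_nN n N). x \<in> W} = (\<lambda>x. x) -` U \<inter> topspace (top_nN n N)"
      using W(1) X_nN_subset_X_n by (auto simp: topspace_top_nN)
    ultimately show ?thesis by simp
  qed
  moreover have "(\<lambda>x. x) ` topspace (top_nN n N) \<subseteq> \<Union>{X_n n \<inter> U |U. \<exists>T\<in>admissible n. openin (T :: (real^'a \<Rightarrow> complex) topology) U}"
    using topspace_top_n[of n, where 'a = 'a] X_nN_subset_X_n[of n N, where 'a = 'a]
    unfolding top_n_eq topology_generated_by_topspace by (simp add: topspace_top_nN)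
  ultimately show ?thesis
    unfolding top_n_eq by (rule continuous_on_generated_topo)
qed

section \<open>Pointwise description of \<open>O_M\<close>\<close>

lemma C_k_iter_partial_continuous: "C_k n f \<Longrightarrow> length is \<le> n \<Longrightarrow> continuous_on UNIV (iter_partial is f)"
proof (induction "is" arbitrary: f n)
  case Nil
  then show ?case by (simp add: C_k_continuous)
next
  case (Cons i "is")
  then show ?case by (cases n) auto
qed

text \<open>The set where the bound fails is open and negligible, hence empty.\<close>

lemma AE_bounded_continuous:
  fixes g :: "real^'d::finite \<Rightarrow> complex"
  assumes "continuous_on UNIV g" "AE x in lebesgue. norm (g x) \<le> C"
  shows "norm (g x) \<le> C"
proof (rule ccontr)
  assume "\<not> norm (g x) \<le> C"
  then have "x \<in> {x. C < norm (g x)}" by simp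
  moreover have "open {x. C < norm (g x)}"
    using assms(1) by (intro open_Collect_less continuous_intros)
  moreover have "negligible {x. C < norm (g x)}"
  proof -
    from assms(2) obtain N where N: "{x \<in> space lebesgue. \<not> norm (g x) \<le> C} \<subseteq> N" "N \<in> null_sets lebesgue"
      by (auto simp: eventually_ae_filter)
    have "negligible N" using N(2) by (simp add: negligible_iff_null_sets)
    then show ?thesis by (rule negligible_subset) (use N(1) in \<open>auto simp: not_le\<close>)
  qed
  ultimately show False using open_not_negligible by blast
qed

text \<open>In the definition the exponent depends on the multi-index and bounds hold almost
  everywhere. Continuity removes the exceptional sets, and finiteness of the number of derivatives
  up to order \<open>k\<close> gives them a common exponent.\<close>

lemma O_M_iff: "f \<in> O_M \<longleftrightarrow> (\<forall>k. \<exists>N M. bounded_C_k k (\<lambda>x. M * bracket x ^ N) f)"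
proof
  assume f: "f \<in> O_M"
  then have Ck: "C_k k f" for k by (auto simp: O_M_def C_infinity_def)
  have ex: "\<exists>N C. \<forall>x. norm (iter_partial is f x) \<le> C * bracket x ^ N" for "is"
  proof -
    let ?\<alpha> = "count (mset is)"
    have eq: "mpartial ?\<alpha> f = iter_partial is f"
      using mpartial_C_k(1)[OF Ck[of "length is"]] by simp
    obtain N C where N: "AE x in lebesgue. norm (mpartial ?\<alpha> f x / complex_of_real (bracket x ^ N)) \<le> C"
      using f unfolding O_M_def L_infinity_def by blast
    have "continuous_on UNIV (iter_partial is f)"
      by (rule C_k_iter_partial_continuous[OF Ck[of "length is"]]) simp
    then have "continuous_on UNIV (\<lambda>x. mpartial ?\<alpha> f x / complex_of_real (bracket x ^ N))"
      unfolding eq bracket_def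
      by (intro continuous_intros) (auto simp: add_nonneg_eq_0_iff simp flip: of_real_power of_real_add)
    from AE_bounded_continuous[OF this N]
    have *: "norm (iter_partial is f x) / \<bar>bracket x ^ N\<bar> \<le> C" for x
      unfolding eq norm_divide norm_of_real .
    have "norm (iter_partial is f x) \<le> C * bracket x ^ N" for x
      using *[of x] bracket_pos[of x] by (simp add: pos_divide_le_eq)
    then show ?thesis by blast
  qed
  then have "\<forall>is. \<exists>q. \<forall>x. norm (iter_partial is f x) \<le> snd q * bracket x ^ fst q"
    by (metis fst_conv snd_conv)
  from choice[OF this] obtain q where q: "\<And>is x. norm (iter_partial is f x) \<le> snd (q is) * bracket x ^ fst (q is)"
    by blast
  show "\<forall>k. \<exists>N M. bounded_C_k k (\<lambda>x. M * bracket x ^ N) f"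
  proof
    fix k
    let ?L = "{is :: 'a list. length is \<le> k}"
    have fin: "finite ?L"
      using finite_lists_length_le[of "UNIV :: 'a set" k] by simp
    \<comment> \<open>Sums over the finitely many lists take the place of maxima: they dominate
      every single exponent and constant.\<close>
    define N where "N = (\<Sum>is\<in>?L. fst (q is))"
    define M where "M = (\<Sum>is\<in>?L. \<bar>snd (q is)\<bar>)"
    have "norm (iter_partial is f x) \<le> M * bracket x ^ N" if "length is \<le> k" for "is" x
    proof -
      have "norm (iter_partial is f x) \<le> snd (q is) * bracket x ^ fst (q is)" by (rule q)
      also have "\<dots> \<le> M * bracket x ^ N"
      proof (intro mult_mono power_increasing)
        have "\<bar>snd (q is)\<bar> \<le> M"
          unfolding M_def using that by (intro member_le_sum fin) auto
        then show "snd (q is) \<le> M" by linarith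
        show "0 \<le> M" by (simp add: M_def sum_nonneg)
        show "fst (q is) \<le> N"
          unfolding N_def using that by (intro member_le_sum fin) auto
      qed (use bracket_pos[of x] bracket_ge_1[of x] in auto)
      finally show ?thesis .
    qed
    then show "\<exists>N M. bounded_C_k k (\<lambda>x. M * bracket x ^ N) f"
      using Ck by (auto simp: bounded_C_k_iff)
  qed
next
  assume f: "\<forall>k. \<exists>N M. bounded_C_k k (\<lambda>x. M * bracket x ^ N) f"
  then have Ck: "C_k k f" for k using bounded_C_k_C_k by blast
  have "\<exists>N\<ge>1. (\<lambda>x. mpartial \<alpha> f x / complex_of_real (bracket x ^ N)) \<in> L_infinity" for \<alpha>
  proof -
    obtain N M where NM: "bounded_C_k (order_of \<alpha>) (\<lambda>x. M * bracket x ^ N) f" using f by blast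
    have "bounded_C_k (order_of \<alpha>) (\<lambda>x. M * bracket x ^ Suc N) f"
      by (rule bounded_C_k_weight_mono[OF NM]) auto
    then have b: "norm (mpartial \<alpha> f x) \<le> M * bracket x ^ Suc N" for x
      using bounded_C_k_mpartial[OF Ck[of "order_of \<alpha>"], of "\<lambda>x. M * bracket x ^ Suc N"] by blast
    have "norm (mpartial \<alpha> f x / complex_of_real (bracket x ^ Suc N)) \<le> M" for x
    proof -
      have "norm (mpartial \<alpha> f x / complex_of_real (bracket x ^ Suc N)) = norm (mpartial \<alpha> f x) / bracket x ^ Suc N"
        using bracket_pos[of x] by (simp only: norm_divide norm_of_real) (simp add: abs_mult)
      then show ?thesis
        using b[of x] bracket_pos[of x] by (simp add: pos_divide_le_eq)
    qed
    moreover have "(\<lambda>x. mpartial \<alpha> f x / complex_of_real (bracket x ^ Suc N)) \<in> borel_measurable lebesgue"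
    proof -
      have "continuous_on UNIV (mpartial \<alpha> f)"
        unfolding mpartial_eq_iter_partial
        by (rule C_k_iter_partial_continuous[OF Ck[of "order_of \<alpha>"]]) (simp add: length_replicate_coords)
      then have "continuous_on UNIV (\<lambda>x. mpartial \<alpha> f x / complex_of_real (bracket x ^ Suc N))"
        unfolding bracket_def
        by (intro continuous_intros) (auto simp: add_nonneg_eq_0_iff simp flip: of_real_power of_real_add)
      then have "(\<lambda>x. mpartial \<alpha> f x / complex_of_real (bracket x ^ Suc N)) \<in> borel_measurable borel"
        by (rule borel_measurable_continuous_onI)
      then show ?thesis by (simp add: measurable_completion)
    qed
    ultimately have "(\<lambda>x. mpartial \<alpha> f x / complex_of_real (bracket x ^ Suc N)) \<in> L_infinity"
      unfolding L_infinity_def by blast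
    then show ?thesis by (intro exI[of _ "Suc N"]) simp
  qed
  then show "f \<in> O_M" unfolding O_M_def C_infinity_def using Ck by blast
qed

section \<open>The projective limit topology and its bounded sets\<close>

lemma O_M_eq_X_n: "f \<in> O_M \<longleftrightarrow> (\<forall>n. f \<in> X_n n)"
  by (simp add: O_M_iff X_n_iff)

lemma subspace_O_M: "cfun.subspace O_M"
  unfolding cfun.subspace_def Ball_def O_M_eq_X_n
  by (intro conjI allI impI; rule cfun.subspace_0[OF subspace_X_n] cfun.subspace_add[OF subspace_X_n]
      cfun.subspace_scale[OF subspace_X_n]; erule spec)

lemma O_M_topology_eq: "O_M_topology = topology_generated_by {O_M \<inter> U |U. \<exists>T\<in>top_n ` {1..}. openin T U}"
  unfolding O_M_topology_def projective_limit_def by simp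

lemma locally_convex_space_O_M: "cfun.locally_convex_space O_M O_M_topology"
  unfolding O_M_topology_eq
proof (rule cfun.locally_convex_space_generated[OF subspace_O_M])
  fix T :: "(real^'a \<Rightarrow> complex) topology" assume "T \<in> top_n ` {1..}"
  then obtain n where T: "T = top_n n" by blast
  show "cfun.locally_convex_space (topspace T) T" "O_M \<subseteq> topspace T"
    using locally_convex_space_top_n by (auto simp: T topspace_top_n O_M_eq_X_n)
qed auto

lemma topspace_O_M: "topspace O_M_topology = O_M"
  by (rule cfun.locally_convex_spaceD(2)[OF locally_convex_space_O_M])

text \<open>By continuity of the inclusion of a single \<open>X_nN n N\<close> into
  \<open>top_n\<close>, a neighbourhood contains a norm ball of that space, and division by a large
  scalar moves \<open>B\<close> into the ball.\<close>

lemma bounded_in_O_M: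
  fixes B :: "(real^'a::finite \<Rightarrow> complex) set"
  assumes B: "\<And>k. \<exists>N M. \<forall>f\<in>B. bounded_C_k k (\<lambda>x. M * bracket x ^ N) f"
  shows "cfun.bounded_in O_M_topology B"
  unfolding cfun.bounded_in_def topspace_O_M
proof (intro conjI allI impI)
  show BO: "B \<subseteq> O_M"
    unfolding O_M_iff subset_iff using B by meson
  fix U :: "(real^'a \<Rightarrow> complex) set"
  assume "cfun.nbhd_zero O_M_topology U"
  then obtain S where S: "openin O_M_topology S" "0 \<in> S" "S \<subseteq> U"
    by (auto simp: cfun.nbhd_zero_def)
  have "cfun.absorbs S B"
  proof (rule cfun.absorbs_generated[OF openin_topology_generated_by[OF S(1)[unfolded O_M_topology_eq]] S(2)])
    fix W :: "(real^'a \<Rightarrow> complex) set"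
    assume "W \<in> {O_M \<inter> U |U. \<exists>T\<in>top_n ` {1..}. openin T U}" and 0: "0 \<in> W"
    then obtain Z n where Z: "W = O_M \<inter> Z" "openin (top_n n) Z" by blast
    obtain N' M where M': "\<forall>f\<in>B. bounded_C_k n (\<lambda>x. M * bracket x ^ N') f" using B by blast
    have M: "bounded_C_k n (\<lambda>x. M * bracket x ^ Suc N') f" if "f \<in> B" for f
      by (rule bounded_C_k_weight_mono[OF M'[rule_format, OF that]]) auto
    define N where "N = Suc N'"
    have "openin (top_nN n N) {x \<in> topspace (top_nN n N). x \<in> Z}"
      using continuous_map_top_nN_top_n[of N n, where 'a = 'a] Z(2) unfolding continuous_map N_def by simp
    moreover have "0 \<in> {x \<in> topspace (top_nN n N). x \<in> Z}"
      using 0 Z(1) cfun.subspace_0[OF subspace_X_nN] by (simp add: topspace_top_nN)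
    ultimately obtain e where e: "e > 0" "\<forall>g\<in>X_nN n N. norm_nN n N (g - 0) < e \<longrightarrow> g \<in> Z"
      unfolding openin_top_nN by blast
    \<comment> \<open>The added 1 makes \<open>r\<close> positive and the inequality
      \<open>inverse r * \<bar>M\<bar> < e\<close> strict.\<close>
    define r where "r = (\<bar>M\<bar> + 1) / e"
    have r: "r > 0" using e by (simp add: r_def add_nonneg_pos)
    have "B \<subseteq> fscale c ` W" if c: "norm c \<ge> r" for c
    proof
      fix f assume f: "f \<in> B"
      have c0: "c \<noteq> 0" using c r by auto
      have b: "bounded_C_k n (\<lambda>x. (norm (inverse c) * M) * bracket x ^ N) (fscale (inverse c) f)"
        unfolding N_def by (rule bounded_C_k_fscale_weight[OF M[OF f]])
      have "norm (inverse c) * M \<le> norm (inverse c) * \<bar>M\<bar>"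
        by (intro mult_left_mono) auto
      also have "\<dots> \<le> inverse r * \<bar>M\<bar>"
        unfolding norm_inverse by (intro mult_right_mono le_imp_inverse_le c r) simp
      also have "\<dots> < e"
        using e by (simp add: r_def field_simps)
      finally have "norm_nN n N (fscale (inverse c) f) < e"
        using norm_nN_le[OF b] by linarith
      moreover have "fscale (inverse c) f \<in> X_nN n N" using b by (auto simp: X_nN_iff)
      ultimately have "fscale (inverse c) f \<in> Z" using e(2) by simp
      moreover have "fscale (inverse c) f \<in> O_M"
        using f BO by (intro cfun.subspace_scale[OF subspace_O_M]) auto
      moreover have "f = fscale c (fscale (inverse c) f)"
        using c0 by (simp add: fscale_def fun_eq_iff)
      ultimately show "f \<in> fscale c ` W" unfolding Z(1) by blast
    qed
    then show "cfun.absorbs W B" unfolding cfun.absorbs_def using r by blast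
  qed
  then show "cfun.absorbs U B" using S(3) by (rule cfun.absorbs_mono)
qed

section \<open>Continuity estimates for bounded seminorms\<close>

text \<open>The radii of the cutoffs double, so \<open>bracket\<close> quadruples from one annulus
  to the next; this is the origin of the powers of 4. The sums telescope.\<close>

definition annulus :: "nat \<Rightarrow> real^'d::finite \<Rightarrow> complex" where
  "annulus j = (case j of 0 \<Rightarrow> cutoff 1 (\<lambda>_. 0) | Suc i \<Rightarrow> cutoff (1 / 2 ^ Suc i) (\<lambda>_. 0) - cutoff (1 / 2 ^ i) (\<lambda>_. 0))"

lemma sum_annulus: "(\<Sum>j\<le>J. annulus j) = (cutoff (1 / 2 ^ J) (\<lambda>_. 0) :: real^'d::finite \<Rightarrow> complex)"
proof (induction J)
  case (Suc J)
  have "(\<Sum>j\<le>Suc J. annulus j) = (cutoff (1 / 2 ^ J) (\<lambda>_. 0) + annulus (Suc J) :: real^'d \<Rightarrow> complex)"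
    unfolding Suc.IH[symmetric] by (rule sum.atMost_Suc)
  then show ?case by (simp add: annulus_def fun_eq_iff)
qed (simp add: annulus_def)

lemma bounded_C_k_min:
  assumes "bounded_C_k k w f" "bounded_C_k k v f"
  shows "bounded_C_k k (\<lambda>x. min (w x) (v x)) f"
  using assms by (simp add: bounded_C_k_iff)

lemma bounded_C_k_uminus: "bounded_C_k k w f \<Longrightarrow> bounded_C_k k w (- f)"
  using bounded_C_k_fscale[of k w f "-1"] by (simp only: fscale_minus_one) simp

lemma bounded_C_k_diff:
  assumes "bounded_C_k k w f" "bounded_C_k k v g"
  shows "bounded_C_k k (\<lambda>x. w x + v x) (f - g)"
proof -
  have "bounded_C_k k (\<lambda>x. w x + v x) (f + - g)"
    by (rule bounded_C_k_add[OF assms(1) bounded_C_k_uminus[OF assms(2)]])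
  then show ?thesis by (simp only: diff_conv_add_uminus)
qed

text \<open>The outer cutoff bounds the support from above; writing the piece as a difference of two
  functions \<open>1 - cutoff\<close> bounds it from below, and the minimum of the two weights
  combines both. The inner cutoff belongs to index \<open>j - 1\<close>, whence the factor 4 in the
  lower bound, which for \<open>j = 0\<close> holds everywhere.\<close>

lemma bounded_C_k_annulus:
  fixes k :: nat
  shows "\<exists>c\<ge>0. \<forall>j. bounded_C_k k
    (\<lambda>x. if 4 ^ j \<le> 4 * bracket x \<and> bracket x \<le> (1 + 16 * real CARD('d)) * 4 ^ j then c else 0) (annulus j :: real^'d::finite \<Rightarrow> complex)"
proof -
  let ?K = "1 + 16 * real CARD('d)"
  obtain c1 where c1: "0 \<le> c1" "\<And>r. 0 < r \<and> r \<le> 1 \<Longrightarrow> bounded_C_k k (\<lambda>x :: real^'d. if r\<^sup>2 * bracket x \<le> ?K then c1 else 0) (cutoff r (\<lambda>_. 0))"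
    using bounded_C_k_cutoff[of k "\<lambda>_ :: 'd. 0"] by auto
  obtain c2 where c2: "0 \<le> c2" "\<And>r. 0 < r \<and> r \<le> 1 \<Longrightarrow> bounded_C_k k (\<lambda>x :: real^'d. if 1 \<le> r\<^sup>2 * bracket x then c2 else 0) ((\<lambda>_. 1) - cutoff r (\<lambda>_. 0))"
    using bounded_C_k_one_minus_cutoff[of k, where 'd = 'd] by blast
  have pow: "(1 / 2 ^ j)\<^sup>2 * b = b / 4 ^ j" for j and b :: real
    by (simp add: power_divide flip: power_mult) (simp add: power_mult mult.commute[of j] )
  show ?thesis
  proof (intro exI[of _ "2 * c1 + 2 * c2"] conjI allI)
    show "0 \<le> 2 * c1 + 2 * c2" using c1 c2 by simp
    fix j
    show "bounded_C_k k (\<lambda>x. if 4 ^ j \<le> 4 * bracket x \<and> bracket x \<le> ?K * 4 ^ j then 2 * c1 + 2 * c2 else 0) (annulus j :: real^'d \<Rightarrow> complex)"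
    proof (cases j)
      case 0
      have 4: "4 ^ 0 \<le> 4 * bracket x" for x :: "real^'d"
        using bracket_ge_1[of x] by simp
      have "bounded_C_k k (\<lambda>x :: real^'d. if 1\<^sup>2 * bracket x \<le> ?K then c1 else 0) (cutoff 1 (\<lambda>_. 0))"
        by (rule c1) simp
      then show ?thesis
        unfolding 0 annulus_def nat.case
        by (rule bounded_C_k_mono) (use c1 c2 4 in auto)
    next
      case (Suc i)
      define r :: "nat \<Rightarrow> real" where "r j = 1 / 2 ^ j" for j
      have r: "0 < r j \<and> r j \<le> 1" for j by (simp add: r_def)
      have far: "1 \<le> (r j)\<^sup>2 * bracket x \<longleftrightarrow> 4 ^ j \<le> bracket x" for j and x :: "real^'d"
        by (simp add: r_def pow pos_le_divide_eq)
      have near: "(r j)\<^sup>2 * bracket x \<le> ?K \<longleftrightarrow> bracket x \<le> ?K * 4 ^ j" for j and x :: "real^'d"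
        unfolding r_def pow by (simp add: pos_divide_le_eq)
      have 1: "bounded_C_k k (\<lambda>x. (if bracket x \<le> ?K * 4 ^ Suc i then c1 else 0) + (if bracket x \<le> ?K * 4 ^ i then c1 else 0))
         (annulus j :: real^'d \<Rightarrow> complex)"
        unfolding Suc annulus_def nat.case r_def[symmetric]
        by (rule bounded_C_k_diff[OF c1(2)[OF r, unfolded near] c1(2)[OF r, unfolded near]])
      have "(annulus j :: real^'d \<Rightarrow> complex) = ((\<lambda>_. 1) - cutoff (r i) (\<lambda>_. 0)) - ((\<lambda>_. 1) - cutoff (r (Suc i)) (\<lambda>_. 0))"
        unfolding Suc annulus_def nat.case r_def[symmetric] by (simp add: fun_eq_iff)
      then have 2: "bounded_C_k k (\<lambda>x. (if 4 ^ i \<le> bracket x then c2 else 0) + (if 4 ^ Suc i \<le> bracket x then c2 else 0))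
         (annulus j :: real^'d \<Rightarrow> complex)"
        using bounded_C_k_diff[OF c2(2)[OF r[of i], unfolded far] c2(2)[OF r[of "Suc i"], unfolded far]] by simp
      have near': "bracket x \<le> ?K * 4 ^ Suc i" if "bracket x \<le> ?K * 4 ^ i" for x :: "real^'d"
        by (rule order_trans[OF that]) simp
      have far': "4 ^ i \<le> bracket x" if "4 ^ Suc i \<le> bracket x" for x :: "real^'d"
        by (rule order_trans[OF _ that]) simp
      have far'': "4 ^ Suc i \<le> 4 * bracket x \<longleftrightarrow> 4 ^ i \<le> bracket x" for x :: "real^'d"
        by simp
      show ?thesis
        using c1(1) c2(1) near' far' unfolding Suc far''
        by (intro bounded_C_k_mono[OF bounded_C_k_min[OF 1 2, unfolded Suc]]) (auto simp: min_def simp del: power_Suc)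
    qed
  qed
qed

section \<open>Seminorms that are bounded on bounded sets\<close>

text \<open>Isolates what the estimates use of the gauge of \<open>A\<close>; the boundedness
  hypothesis covers exactly the sets treated in \<open>bounded_in_O_M\<close>.\<close>

locale bounded_seminorm =
  fixes p :: "(real^'d::finite \<Rightarrow> complex) \<Rightarrow> real"
  assumes seminorm: "cfun.seminorm_on O_M p"
    and bounded: "(\<And>k. \<exists>N M. \<forall>f\<in>B. bounded_C_k k (\<lambda>x. M * bracket x ^ N) f) \<Longrightarrow> \<exists>r. \<forall>f\<in>B. p f \<le> r"
begin

lemmas p_add = cfun.seminorm_onD(1)[OF seminorm]
lemmas p_fscale = cfun.seminorm_onD(2)[OF seminorm]
lemmas p_nonneg = cfun.seminorm_nonneg[OF seminorm subspace_O_M]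
lemmas p_zero = cfun.seminorm_zero[OF seminorm subspace_O_M]

lemma p_sum: "(\<And>i. i \<in> I \<Longrightarrow> f i \<in> O_M) \<Longrightarrow> finite I \<Longrightarrow> p (\<Sum>i\<in>I. f i) \<le> (\<Sum>i\<in>I. p (f i))"
proof (induction I rule: infinite_finite_induct)
  case (insert i I)
  have "(\<Sum>i\<in>I. f i) \<in> O_M" using insert.prems by (intro cfun.subspace_sum[OF subspace_O_M]) auto
  then have "p (f i + (\<Sum>i\<in>I. f i)) \<le> p (f i) + p (\<Sum>i\<in>I. f i)" using insert.prems by (intro p_add) auto
  moreover have "p (\<Sum>i\<in>I. f i) \<le> (\<Sum>i\<in>I. p (f i))"
    using insert.prems insert.hyps by (intro insert.IH) auto
  ultimately show ?case unfolding sum.insert[OF insert.hyps(1,2)] by linarith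
qed (use p_zero in simp_all)

text \<open>On the Frechet space of all \<open>f\<close> with \<open>\<partial>\<^sup>\<alpha> f = O(\<langle>x\<rangle>\<^bsup>N k\<^esup>)\<close> for \<open>|\<alpha>| \<le> k\<close> the seminorm is
  continuous, since it is bounded on bounded sets. The order \<open>n\<close> depends on the sequence \<open>N\<close>.\<close>

lemma frechet_estimate:
  fixes N :: "nat \<Rightarrow> nat"
  shows "\<exists>n C. 0 \<le> C \<and> (\<forall>f M. (\<forall>k. \<exists>c. bounded_C_k k (\<lambda>x. c * bracket x ^ N k) f) \<and>
     (\<forall>k\<le>n. bounded_C_k k (\<lambda>x. M * bracket x ^ N k) f) \<longrightarrow> p f \<le> C * M)"
proof (rule ccontr)
  assume neg: "\<not> ?thesis"
  have "\<forall>n. \<exists>q. (\<forall>k. \<exists>c. bounded_C_k k (\<lambda>x. c * bracket x ^ N k) (fst q)) \<and>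
     (\<forall>k\<le>n. bounded_C_k k (\<lambda>x. snd q * bracket x ^ N k) (fst q)) \<and> real n * snd q < p (fst q)"
  proof
    fix n
    \<comment> \<open>The negated statement is used with the same number \<open>n\<close> as order
      and as constant.\<close>
    obtain f M where "\<forall>k. \<exists>c. bounded_C_k k (\<lambda>x. c * bracket x ^ N k) f"
      "\<forall>k\<le>n. bounded_C_k k (\<lambda>x. M * bracket x ^ N k) f" "real n * M < p f"
      using neg by (metis not_le of_nat_0_le_iff)
    then show "\<exists>q. (\<forall>k. \<exists>c. bounded_C_k k (\<lambda>x. c * bracket x ^ N k) (fst q)) \<and>
       (\<forall>k\<le>n. bounded_C_k k (\<lambda>x. snd q * bracket x ^ N k) (fst q)) \<and> real n * snd q < p (fst q)"
      by (intro exI[of _ "(f, M)"]) simp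
  qed
  from choice[OF this] obtain q where
    q: "\<And>n k. \<exists>c. bounded_C_k k (\<lambda>x. c * bracket x ^ N k) (fst (q n))"
      "\<And>n k. k \<le> n \<Longrightarrow> bounded_C_k k (\<lambda>x. snd (q n) * bracket x ^ N k) (fst (q n))"
      "\<And>n. real n * snd (q n) < p (fst (q n))"
    by blast
  define F M where "F n = fst (q n)" and "M n = snd (q n)" for n
  have FO: "F n \<in> O_M" for n unfolding O_M_iff F_def using q(1) by blast
  have M: "0 < M n" for n
  proof -
    have b: "bounded_C_k 0 (\<lambda>x. M n * bracket x ^ N 0) (F n)" unfolding F_def M_def by (rule q) simp
    have "M n \<noteq> 0"
    proof
      assume "M n = 0"
      then have "F n = 0" using bounded_C_k_norm[OF b] by (auto simp: fun_eq_iff)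
      then show False using q(3)[of n] \<open>M n = 0\<close> p_zero by (simp add: F_def M_def)
    qed
    with weight_nonneg[OF b] show ?thesis by simp
  qed
  \<comment> \<open>After normalisation \<open>g n\<close> has bound 1 up to order \<open>n\<close>
    while \<open>p (g n)\<close> exceeds \<open>n\<close>: the sequence is bounded, but
    \<open>p\<close> is not bounded on it.\<close>
  define g where "g n = fscale (inverse (of_real (M n))) (F n)" for n
  have pg: "real n < p (g n)" for n
  proof -
    have "p (g n) = p (F n) / M n"
      unfolding g_def p_fscale[OF FO] using M[of n] by (simp add: norm_inverse divide_inverse mult.commute)
    then show ?thesis using q(3)[of n] M[of n] by (simp add: F_def M_def pos_less_divide_eq)
  qed
  have "\<exists>N' C. \<forall>f\<in>range g. bounded_C_k k (\<lambda>x. C * bracket x ^ N') f" for k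
  proof -
    have "\<forall>n. \<exists>c. bounded_C_k k (\<lambda>x. c * bracket x ^ N k) (g n)"
      unfolding g_def F_def using q(1) bounded_C_k_fscale_weight by blast
    from choice[OF this] obtain c where c: "\<And>n. bounded_C_k k (\<lambda>x. c n * bracket x ^ N k) (g n)" by blast
    \<comment> \<open>The constant 1 serves all \<open>n \<ge> k\<close>; the finitely many earlier
      functions contribute their own constants.\<close>
    define C where "C = 1 + (\<Sum>n<k. \<bar>c n\<bar>)"
    have "bounded_C_k k (\<lambda>x. C * bracket x ^ N k) (g n)" for n
    proof -
      have "\<exists>c\<le>C. bounded_C_k k (\<lambda>x. c * bracket x ^ N k) (g n)"
      proof (cases "n < k")
        case True
        then have "\<bar>c n\<bar> \<le> (\<Sum>n<k. \<bar>c n\<bar>)" by (intro member_le_sum) auto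
        then show ?thesis using c[of n] by (intro exI[of _ "c n"]) (auto simp: C_def)
      next
        case False
        then have "bounded_C_k k (\<lambda>x. M n * bracket x ^ N k) (F n)"
          unfolding F_def M_def by (intro q) simp
        from bounded_C_k_fscale_weight[OF this, of "inverse (of_real (M n))"]
        have "bounded_C_k k (\<lambda>x. 1 * bracket x ^ N k) (g n)"
          using M[of n] by (simp add: g_def norm_inverse)
        then show ?thesis by (intro exI[of _ 1]) (auto simp: C_def sum_nonneg)
      qed
      then obtain c where c: "c \<le> C" "bounded_C_k k (\<lambda>x. c * bracket x ^ N k) (g n)" by blast
      show ?thesis
        by (rule bounded_C_k_mono[OF c(2)]) (auto intro!: mult_right_mono c(1) zero_le_power less_imp_le[OF bracket_pos])
    qed
    then show ?thesis by blast
  qed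
  then obtain r where "\<forall>f\<in>range g. p f \<le> r" using bounded[of "range g"] by blast
  moreover obtain n where "r < real n" using reals_Archimedean2 by blast
  ultimately show False using pg[of n] by (metis less_trans not_le rangeI)
qed

text \<open>On the support of the tail 4^J is at most \<open>bracket x\<close>, so multiplying the
  tail by 4^J costs just one more power of the weight. The rescaled tails thus form a bounded set.
  That \<open>r\<close> depends on \<open>f\<close> is harmless, as only convergence to 0 is drawn
  from it.\<close>

lemma tail_estimate:
  assumes f: "f \<in> O_M"
  shows "\<exists>r. \<forall>J. ((\<lambda>_. 1) - cutoff (1 / 2 ^ J) (\<lambda>_. 0)) * f \<in> O_M \<and>
      p (((\<lambda>_. 1) - cutoff (1 / 2 ^ J) (\<lambda>_. 0)) * f) \<le> r / 4 ^ J"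
proof -
  define g where "g J = ((\<lambda>_. 1) - cutoff (1 / 2 ^ J) (\<lambda>_. 0)) * f" for J :: nat
  have ex: "\<exists>N M. \<forall>J. bounded_C_k k (\<lambda>x. M * bracket x ^ N) (fscale (4 ^ J) (g J))" for k
  proof -
    obtain N M where NM: "bounded_C_k k (\<lambda>x. M * bracket x ^ N) f" using f O_M_iff by blast
    obtain c where c: "0 \<le> c" "\<And>r. 0 < r \<and> r \<le> 1 \<Longrightarrow> bounded_C_k k (\<lambda>x :: real^'d. if 1 \<le> r\<^sup>2 * bracket x then c else 0) ((\<lambda>_. 1) - cutoff r (\<lambda>_. 0))"
      using bounded_C_k_one_minus_cutoff[of k, where 'd = 'd] by blast
    have M: "0 \<le> M" by (rule weight_nonneg[OF NM])
    have "bounded_C_k k (\<lambda>x. (2 ^ k * c * M) * bracket x ^ Suc N) (fscale (4 ^ J) (g J))" for J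
    proof -
      let ?v = "\<lambda>x :: real^'d. if 1 \<le> (1 / 2 ^ J)\<^sup>2 * bracket x then c else 0"
      have "bounded_C_k k ?v ((\<lambda>_. 1) - cutoff (1 / 2 ^ J) (\<lambda>_. 0))" by (rule c) simp
      from bounded_C_k_fscale[OF bounded_C_k_mult[OF this NM], of "4 ^ J"]
      have "bounded_C_k k (\<lambda>x. norm ((4 :: complex) ^ J) * (2 ^ k * (?v x * (M * bracket x ^ N)))) (fscale (4 ^ J) (g J))"
        unfolding g_def .
      then show ?thesis
      proof (rule bounded_C_k_mono)
        fix x :: "real^'d"
        have "4 ^ J * ?v x \<le> c * bracket x"
        proof (cases "1 \<le> (1 / 2 ^ J)\<^sup>2 * bracket x")
          case True
          have "(1 / 2 ^ J)\<^sup>2 * bracket x = bracket x / 4 ^ J"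
            by (simp add: power_divide power2_eq_square flip: power_mult_distrib)
          then have "4 ^ J \<le> bracket x" using True by (simp add: pos_le_divide_eq)
          then show ?thesis using True c by (simp add: mult.commute mult_left_mono)
        qed (use c bracket_pos[of x] in auto)
        then have "(4 ^ J * ?v x) * (2 ^ k * (M * bracket x ^ N)) \<le> (c * bracket x) * (2 ^ k * (M * bracket x ^ N))"
          using M bracket_pos[of x] by (intro mult_right_mono) auto
        then show "norm ((4 :: complex) ^ J) * (2 ^ k * (?v x * (M * bracket x ^ N))) \<le> 2 ^ k * c * M * bracket x ^ Suc N"
          by (simp add: norm_power mult_ac)
      qed simp
    qed
    then show ?thesis by blast
  qed
  have bd: "\<exists>N M. \<forall>h\<in>range (\<lambda>J. fscale (4 ^ J) (g J)). bounded_C_k k (\<lambda>x. M * bracket x ^ N) h" for k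
  proof -
    obtain N M where "\<And>J. bounded_C_k k (\<lambda>x. M * bracket x ^ N) (fscale (4 ^ J) (g J))"
      using ex[of k] by blast
    then show ?thesis by blast
  qed
  have O: "fscale (4 ^ J) (g J) \<in> O_M" for J
    unfolding O_M_iff
  proof
    fix k
    obtain N M where "\<And>J. bounded_C_k k (\<lambda>x. M * bracket x ^ N) (fscale (4 ^ J) (g J))"
      using ex[of k] by blast
    then show "\<exists>N M. bounded_C_k k (\<lambda>x. M * bracket x ^ N) (fscale (4 ^ J) (g J))" by blast
  qed
  have gO: "g J \<in> O_M" for J
  proof -
    have "g J = fscale (inverse (4 ^ J)) (fscale (4 ^ J) (g J))" by (simp add: fscale_def fun_eq_iff)
    also have "\<dots> \<in> O_M" by (rule cfun.subspace_scale[OF subspace_O_M O])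
    finally show ?thesis .
  qed
  obtain r where r: "\<And>J. p (fscale (4 ^ J) (g J)) \<le> r" using bounded[OF bd] by blast
  have "p (g J) \<le> r / 4 ^ J" for J
    using r[of J] unfolding p_fscale[OF gO] by (simp add: norm_power pos_le_divide_eq mult.commute)
  then show ?thesis using gO unfolding g_def by blast
qed

end

section \<open>Estimates on one annulus and their summation\<close>

text \<open>On the annulus \<open>bracket\<close> is comparable to 4^j, so growth and powers of 4^j
  can be exchanged in both directions: the first bound removes the weight and pays (4^j)^N, the
  second introduces the weight \<open>bracket x ^ m\<close> and gains (4/4^j)^m.\<close>

lemma bounded_C_k_annulus_mult:
  "\<exists>c\<ge>0. \<forall>j N M f. bounded_C_k k (\<lambda>x :: real^'d::finite. M * bracket x ^ N) f \<longrightarrow>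
     bounded_C_k k (\<lambda>x. (c * ((1 + 16 * real CARD('d)) * 4 ^ j) ^ N * M) * bracket x ^ 0) (annulus j * f) \<and>
     (\<forall>m x. norm ((annulus j * f) x) \<le>
        (c * ((1 + 16 * real CARD('d)) * 4 ^ j) ^ N * M * (4 / 4 ^ j) ^ m) * bracket x ^ m)"
proof -
  let ?K = "\<lambda>j. (1 + 16 * real CARD('d)) * 4 ^ j"
  let ?R = "\<lambda>j x. 4 ^ j \<le> 4 * bracket x \<and> bracket x \<le> ?K j"
  obtain c where c: "0 \<le> c" "\<And>j. bounded_C_k k (\<lambda>x :: real^'d. if ?R j x then c else 0) (annulus j)"
    using bounded_C_k_annulus[of k, where 'd = 'd] by blast
  show ?thesis
  proof (intro exI[of _ "2 ^ k * c"] conjI allI impI)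
    show "0 \<le> 2 ^ k * c" using c by simp
    fix j N M and f :: "real^'d \<Rightarrow> complex"
    assume f: "bounded_C_k k (\<lambda>x. M * bracket x ^ N) f"
    have M: "0 \<le> M" by (rule weight_nonneg[OF f])
    have *: "2 ^ k * ((if ?R j x then c else 0) * (M * bracket x ^ N)) \<le> (if ?R j x then 2 ^ k * c * ?K j ^ N * M else 0)"
      for x :: "real^'d"
    proof (cases "?R j x")
      case True
      then have "bracket x ^ N \<le> ?K j ^ N"
        by (intro power_mono less_imp_le[OF bracket_pos]) auto
      then have "2 ^ k * c * M * bracket x ^ N \<le> 2 ^ k * c * M * ?K j ^ N"
        using c M by (intro mult_left_mono) auto
      then show ?thesis unfolding if_P[OF True] by (simp only: mult_ac)
    next
      case False
      show ?thesis unfolding if_not_P[OF False] by simp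
    qed
    have b: "bounded_C_k k (\<lambda>x. if ?R j x then 2 ^ k * c * ?K j ^ N * M else 0) (annulus j * f)"
      by (rule bounded_C_k_mono[OF bounded_C_k_mult[OF c(2)[of j] f] * order.refl])
    show "bounded_C_k k (\<lambda>x. (2 ^ k * c * ?K j ^ N * M) * bracket x ^ 0) (annulus j * f)"
      using c M by (intro bounded_C_k_mono[OF b _ order.refl]) auto
    fix m and x :: "real^'d"
    have "norm ((annulus j * f) x) \<le> (if ?R j x then 2 ^ k * c * ?K j ^ N * M else 0)"
      by (rule bounded_C_k_norm[OF b])
    also have "\<dots> \<le> 2 ^ k * c * ?K j ^ N * M * (4 / 4 ^ j * bracket x) ^ m"
    proof (cases "?R j x")
      case True
      then have "1 \<le> 4 / 4 ^ j * bracket x" by (simp add: pos_le_divide_eq)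
      then have "1 \<le> (4 / 4 ^ j * bracket x) ^ m" by (rule one_le_power)
      then have "2 ^ k * c * ?K j ^ N * M * 1 \<le> 2 ^ k * c * ?K j ^ N * M * (4 / 4 ^ j * bracket x) ^ m"
        using c M by (intro mult_left_mono) auto
      then show ?thesis unfolding if_P[OF True] by (simp only: mult_1_right)
    next
      case False
      show ?thesis
        unfolding if_not_P[OF False] using c M bracket_pos[of x] by simp
    qed
    also have "\<dots> = 2 ^ k * c * ?K j ^ N * M * (4 / 4 ^ j) ^ m * bracket x ^ m"
      by (simp only: power_mult_distrib mult.assoc)
    finally show "norm ((annulus j * f) x) \<le> 2 ^ k * c * ?K j ^ N * M * (4 / 4 ^ j) ^ m * bracket x ^ m" .
  qed
qed

text \<open>Puts mollifications of C^1 functions of slow growth into \<open>O_M\<close>, with one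
  exponent for all orders.\<close>

lemma C_k_mollify_smooth:
  assumes "bounded_C_k (Suc 0) (\<lambda>x. M * bracket x ^ N) f" "0 < \<delta>" "\<delta> \<le> 1"
  shows "\<exists>c. bounded_C_k k (\<lambda>x. c * bracket x ^ N) (mollify coords \<delta> \<alpha> f)"
proof -
  obtain c where c: "\<And>\<delta> M f. 0 < \<delta> \<and> \<delta> \<le> 1 \<and> C_k (Suc 0) f \<and> (\<forall>x. norm (f x) \<le> M * bracket x ^ N) \<Longrightarrow>
       bounded_C_k k (\<lambda>x. c * M / \<delta> ^ k * bracket x ^ N) (mollify coords \<delta> \<alpha> f)"
    using bounded_C_k_mollify_smooth[of N k \<alpha>] by blast
  have "bounded_C_k k (\<lambda>x. c * M / \<delta> ^ k * bracket x ^ N) (mollify coords \<delta> \<alpha> f)"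
    using assms bounded_C_k_C_k[OF assms(1)] bounded_C_k_norm[OF assms(1)] by (intro c) blast
  then show ?thesis by (rule exI)
qed

context bounded_seminorm
begin

text \<open>For \<open>g = annulus j * f\<close>, supported where \<open>\<langle>x\<rangle>\<close> is of size \<open>R = 4\<^sup>j\<close>, mollify at scale
  \<open>\<delta> = R\<^bsup>-L\<^esup>\<close> with \<open>L = N + 1\<close>. The part \<open>g - g * \<phi>\<^sub>\<delta>\<close> gains a factor \<open>\<delta>\<close> at the cost of one derivative and is
  estimated by the Frechet estimate for the constant sequence \<open>0\<close>, which determines the order \<open>n\<^sub>0\<close> independently of
  \<open>N\<close>. The smooth part \<open>g * \<phi>\<^sub>\<delta>\<close> loses \<open>\<delta>\<^bsup>-k\<^esup>\<close> in the \<open>k\<close>-th derivatives only, and this is absorbed by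
  the Frechet estimate for the sequence \<open>L (k + 1)\<close>.\<close>

lemma annulus_estimate:
  "\<exists>n. \<forall>N. \<exists>C\<ge>0. \<forall>f\<in>O_M. \<forall>M j. bounded_C_k (Suc n) (\<lambda>x. M * bracket x ^ N) f \<longrightarrow>
     annulus j * f \<in> O_M \<and> p (annulus j * f) \<le> C * M / 4 ^ j"
proof -
  obtain n C0 where C0: "0 \<le> C0" "\<And>f M. (\<forall>k. \<exists>c. bounded_C_k k (\<lambda>x. c * bracket x ^ 0) f) \<Longrightarrow>
     (\<forall>k\<le>n. bounded_C_k k (\<lambda>x. M * bracket x ^ 0) f) \<Longrightarrow> p f \<le> C0 * M"
    using frechet_estimate[of "\<lambda>_. 0"] by blast
  show ?thesis
  proof (intro exI[of _ n] allI)
    fix N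
    define L where "L = Suc N"
    define K where "K = 1 + 16 * real CARD('d)"
    have K: "0 \<le> K" by (simp add: K_def)
    obtain n1 C1 where C1: "0 \<le> C1" "\<And>f M. (\<forall>k. \<exists>c. bounded_C_k k (\<lambda>x. c * bracket x ^ (L * Suc k)) f) \<Longrightarrow>
       (\<forall>k\<le>n1. bounded_C_k k (\<lambda>x. M * bracket x ^ (L * Suc k)) f) \<Longrightarrow> p f \<le> C1 * M"
      using frechet_estimate[of "\<lambda>k. L * Suc k"] by blast
    obtain c1 where c1: "0 \<le> c1" "\<And>j N M f. bounded_C_k (Suc n) (\<lambda>x :: real^'d. M * bracket x ^ N) f \<Longrightarrow>
        bounded_C_k (Suc n) (\<lambda>x. (c1 * (K * 4 ^ j) ^ N * M) * bracket x ^ 0) (annulus j * f)"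
      "\<And>j N M f m x. bounded_C_k (Suc n) (\<lambda>x :: real^'d. M * bracket x ^ N) f \<Longrightarrow>
        norm ((annulus j * f) x) \<le> (c1 * (K * 4 ^ j) ^ N * M * (4 / 4 ^ j) ^ m) * bracket x ^ m"
      using bounded_C_k_annulus_mult[of "Suc n", where 'd = 'd] unfolding K_def[symmetric] by blast
    obtain c2 where c2: "0 \<le> c2"
      "\<And>n \<delta> M f. 0 < \<delta> \<Longrightarrow> \<delta> \<le> 1 \<Longrightarrow> bounded_C_k (Suc n) (\<lambda>x :: real^'d. M * bracket x ^ 0) f \<Longrightarrow>
       bounded_C_k n (\<lambda>x. c2 * (\<delta> * M) * bracket x ^ 0) (f - mollify coords \<delta> (\<lambda>_. 0) f)"
      using bounded_C_k_mollify_diff[of 0 "coords :: 'd list"] by blast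
    have "\<forall>k. \<exists>c. 0 \<le> c \<and> (\<forall>\<delta> M f. 0 < \<delta> \<and> \<delta> \<le> 1 \<and> C_k (Suc 0) f \<and> (\<forall>x. norm (f x) \<le> M * bracket x ^ (L * Suc k)) \<longrightarrow>
       bounded_C_k k (\<lambda>x. c * M / \<delta> ^ k * bracket x ^ (L * Suc k)) (mollify coords \<delta> (\<lambda>_ :: 'd. 0) f))"
      using bounded_C_k_mollify_smooth by blast
    from choice[OF this] obtain c3 where c3: "\<And>k. 0 \<le> c3 k"
      "\<And>k \<delta> M f. 0 < \<delta> \<and> \<delta> \<le> 1 \<and> C_k (Suc 0) f \<and> (\<forall>x. norm (f x) \<le> M * bracket x ^ (L * Suc k)) \<Longrightarrow>
       bounded_C_k k (\<lambda>x. c3 k * M / \<delta> ^ k * bracket x ^ (L * Suc k)) (mollify coords \<delta> (\<lambda>_ :: 'd. 0) f)"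
      by blast
    \<comment> \<open>The order \<open>n1\<close> depends on \<open>N\<close> through
      \<open>L\<close>, but it enters only this constant and not the order \<open>n\<close>.\<close>
    define D where "D = (\<Sum>k\<le>n1. c3 k * 4 ^ (L * Suc k))"
    define C where "C = C0 * (c2 * (c1 * K ^ N)) + C1 * (D * (c1 * K ^ N))"
    have D: "0 \<le> D" using c3 by (auto simp: D_def intro!: sum_nonneg)
    have "annulus j * f \<in> O_M \<and> p (annulus j * f) \<le> C * M / 4 ^ j"
      if f: "f \<in> O_M" and fb: "bounded_C_k (Suc n) (\<lambda>x. M * bracket x ^ N) f" for f M j
    proof -
      have M: "0 \<le> M" by (rule weight_nonneg[OF fb])
      define g where "g = annulus j * f"
      define \<delta> where "\<delta> = 1 / (4 :: real) ^ (j * L)"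
      have d: "0 < \<delta>" "\<delta> \<le> 1" by (simp_all add: \<delta>_def)
      define h where "h = g - mollify coords \<delta> (\<lambda>_. 0) g"
      have gb: "\<exists>c. bounded_C_k k (\<lambda>x. c * bracket x ^ 0) g" for k
      proof -
        obtain N M where "bounded_C_k k (\<lambda>x. M * bracket x ^ N) f" using f O_M_iff by blast
        then show ?thesis
          unfolding g_def using bounded_C_k_annulus_mult[of k, where 'd = 'd] by blast
      qed
      have gO: "g \<in> O_M" unfolding O_M_iff using gb by blast
      have "p h \<le> C0 * (c2 * (c1 * K ^ N * M / 4 ^ j))"
      proof (rule C0(2); intro allI impI)
        fix k
        obtain c where "bounded_C_k (Suc k) (\<lambda>x. c * bracket x ^ 0) g" using gb by blast
        from c2(2)[OF d this] show "\<exists>c. bounded_C_k k (\<lambda>x. c * bracket x ^ 0) h" unfolding h_def by blast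
        assume k: "k \<le> n"
        have "bounded_C_k n (\<lambda>x. c2 * (\<delta> * (c1 * (K * 4 ^ j) ^ N * M)) * bracket x ^ 0) h"
          unfolding h_def g_def by (rule c2(2)[OF d c1(2)[OF fb]])
        \<comment> \<open>Of the \<open>L = N + 1\<close> factors 1/4^j in \<open>\<delta>\<close>,
          \<open>N\<close> cancel the removed growth; the last one makes the sum over the annuli
          converge.\<close>
        also have "\<delta> * (c1 * (K * 4 ^ j) ^ N * M) = c1 * K ^ N * M / 4 ^ j"
          by (simp add: \<delta>_def L_def power_mult_distrib power_add flip: power_mult)
        finally show "bounded_C_k k (\<lambda>x. c2 * (c1 * K ^ N * M / 4 ^ j) * bracket x ^ 0) h"
          by (rule bounded_C_k_mono) (use k in auto)
      qed
      moreover have "p (mollify coords \<delta> (\<lambda>_. 0) g) \<le> C1 * (D * (c1 * K ^ N * M / 4 ^ j))"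
      proof -
        have b: "bounded_C_k k (\<lambda>x. c3 k * 4 ^ (L * Suc k) * (c1 * K ^ N * M / 4 ^ j) * bracket x ^ (L * Suc k))
            (mollify coords \<delta> (\<lambda>_. 0) g)" for k
        proof -
          let ?m = "L * Suc k"
          obtain c where "bounded_C_k (Suc 0) (\<lambda>x. c * bracket x ^ 0) g" using gb by blast
          then have "C_k (Suc 0) g" by (rule bounded_C_k_C_k)
          then have "bounded_C_k k (\<lambda>x. c3 k * (c1 * (K * 4 ^ j) ^ N * M * (4 / 4 ^ j) ^ ?m) / \<delta> ^ k * bracket x ^ ?m)
            (mollify coords \<delta> (\<lambda>_. 0) g)"
            using d c1(3)[OF fb, of j _ ?m] unfolding g_def by (intro c3(2)) blast
          \<comment> \<open>With \<open>a = 4 ^ j\<close> the gain a^(L(k+1)) pays for the a^(Lk)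
            lost in \<delta>^(-k) and for the a^N from the weight, and again one factor 1/a is
            left.\<close>
          also have "c3 k * (c1 * (K * 4 ^ j) ^ N * M * (4 / 4 ^ j) ^ ?m) / \<delta> ^ k = c3 k * 4 ^ ?m * (c1 * K ^ N * M / 4 ^ j)"
          proof -
            define a b where "a = (4 :: real) ^ j" and "b = a ^ (L * k)"
            have "?m = L * k + (N + 1)" by (simp add: L_def)
            then have 1: "a ^ ?m = b * (a ^ N * a)"
              unfolding b_def by (simp only: power_add power_one_right)
            have "((4 :: real) ^ (j * L)) ^ k = b"
              unfolding a_def b_def by (simp only: power_mult[symmetric] mult.assoc)
            then have 2: "\<delta> ^ k = 1 / b" by (simp add: \<delta>_def power_divide)
            have "a \<noteq> 0" "b \<noteq> 0" by (simp_all add: a_def b_def)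
            then show ?thesis
              unfolding 2 a_def[symmetric] power_divide 1 power_mult_distrib by (simp add: field_simps)
          qed
          finally show ?thesis .
        qed
        show ?thesis
        proof (rule C1(2); intro allI impI)
          fix k
          show "\<exists>c. bounded_C_k k (\<lambda>x. c * bracket x ^ (L * Suc k)) (mollify coords \<delta> (\<lambda>_. 0) g)"
            using b by blast
          assume "k \<le> n1"
          then have "c3 k * 4 ^ (L * Suc k) \<le> D"
            unfolding D_def using c3(1) by (intro member_le_sum) auto
          then have "c3 k * 4 ^ (L * Suc k) * (c1 * K ^ N * M / 4 ^ j) * bracket x ^ (L * Suc k) \<le>
            D * (c1 * K ^ N * M / 4 ^ j) * bracket x ^ (L * Suc k)" for x :: "real^'d"
            using c1(1) K M bracket_pos[of x] by (intro mult_right_mono) auto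
          then show "bounded_C_k k (\<lambda>x. D * (c1 * K ^ N * M / 4 ^ j) * bracket x ^ (L * Suc k)) (mollify coords \<delta> (\<lambda>_. 0) g)"
            by (rule bounded_C_k_mono[OF b]) simp
        qed
      qed
      moreover have "p (h + mollify coords \<delta> (\<lambda>_. 0) g) \<le> p h + p (mollify coords \<delta> (\<lambda>_. 0) g)"
      proof (rule p_add)
        obtain c where c: "bounded_C_k (Suc 0) (\<lambda>x. c * bracket x ^ 0) g" using gb by blast
        show "mollify coords \<delta> (\<lambda>_. 0) g \<in> O_M"
          unfolding O_M_iff using C_k_mollify_smooth[OF c d] by blast
        then show "h \<in> O_M" unfolding h_def by (rule cfun.subspace_diff[OF subspace_O_M gO])
      qed
      moreover have "h + mollify coords \<delta> (\<lambda>_. 0) g = g"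
        unfolding h_def by (simp only: diff_add_cancel)
      ultimately have "p g \<le> C0 * (c2 * (c1 * K ^ N * M / 4 ^ j)) + C1 * (D * (c1 * K ^ N * M / 4 ^ j))"
        by simp
      also have "\<dots> = C * M / 4 ^ j"
        by (simp add: C_def field_simps)
      finally show ?thesis using gO unfolding g_def by blast
    qed
    moreover have "0 \<le> C" using C0 C1 c1 c2 D K by (simp add: C_def)
    ultimately show "\<exists>C\<ge>0. \<forall>f\<in>O_M. \<forall>M j. bounded_C_k (Suc n) (\<lambda>x. M * bracket x ^ N) f \<longrightarrow>
       annulus j * f \<in> O_M \<and> p (annulus j * f) \<le> C * M / 4 ^ j"
      by blast
  qed
qed

text \<open>The factor 1/4^j makes the annulus bounds summable, with sum at most 2, and the tail
  disappears as J grows. The order is \<open>Suc n\<close> because the mollification error consumes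
  one derivative.\<close>

lemma main_estimate:
  "\<exists>n. \<forall>N. \<exists>C\<ge>0. \<forall>f\<in>O_M. \<forall>M. bounded_C_k (Suc n) (\<lambda>x. M * bracket x ^ N) f \<longrightarrow> p f \<le> C * M"
proof -
  obtain n where n: "\<And>N. \<exists>C\<ge>0. \<forall>f\<in>O_M. \<forall>M j. bounded_C_k (Suc n) (\<lambda>x. M * bracket x ^ N) f \<longrightarrow>
     annulus j * f \<in> O_M \<and> p (annulus j * f) \<le> C * M / 4 ^ j"
    using annulus_estimate by blast
  show ?thesis
  proof (intro exI[of _ n] allI)
    fix N
    obtain C where C: "0 \<le> C" "\<And>f M j. f \<in> O_M \<Longrightarrow> bounded_C_k (Suc n) (\<lambda>x. M * bracket x ^ N) f \<Longrightarrow>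
       annulus j * f \<in> O_M \<and> p (annulus j * f) \<le> C * M / 4 ^ j"
      using n[of N] by blast
    have "p f \<le> 2 * C * M" if f: "f \<in> O_M" and fb: "bounded_C_k (Suc n) (\<lambda>x. M * bracket x ^ N) f" for f M
    proof -
      have M: "0 \<le> M" by (rule weight_nonneg[OF fb])
      obtain r where r: "\<And>J. ((\<lambda>_. 1) - cutoff (1 / 2 ^ J) (\<lambda>_. 0)) * f \<in> O_M"
        "\<And>J. p (((\<lambda>_. 1) - cutoff (1 / 2 ^ J) (\<lambda>_. 0)) * f) \<le> r / 4 ^ J"
        using tail_estimate[OF f] by blast
      have "p f \<le> 2 * C * M + r * (1 / 4) ^ J" for J
      proof -
        let ?t = "((\<lambda>_. 1) - cutoff (1 / 2 ^ J) (\<lambda>_. 0)) * f"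
        let ?s = "\<Sum>j\<le>J. annulus j * f"
        have s: "?s \<in> O_M" using C(2)[OF f fb] by (intro cfun.subspace_sum[OF subspace_O_M]) blast
        have "f = ?s + ?t"
          unfolding sum_distrib_right[symmetric] sum_annulus by (simp add: fun_eq_iff algebra_simps)
        then have "p f \<le> p ?s + p ?t" using p_add[OF s r(1)[of J]] by simp
        moreover have "p ?s \<le> (\<Sum>j\<le>J. p (annulus j * f))"
          using C(2)[OF f fb] by (intro p_sum) auto
        moreover have "(\<Sum>j\<le>J. p (annulus j * f)) \<le> (\<Sum>j\<le>J. C * M * (1 / 4) ^ j)"
          using C(2)[OF f fb] by (intro sum_mono) (simp add: power_divide)
        moreover have "(\<Sum>j\<le>J. C * M * (1 / 4) ^ j) \<le> C * M * 2"
        proof -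
          have "(\<Sum>j\<le>J. (1 / 4 :: real) ^ j) \<le> 2"
          proof -
            have "- ((1 / 4 :: real) ^ J) \<le> 2" by (rule order_trans[of _ 0]) auto
            then show ?thesis by (simp add: sum_gp0)
          qed
          then show ?thesis
            unfolding sum_distrib_left[symmetric] using C M by (intro mult_left_mono) auto
        qed
        moreover have "r / 4 ^ J = r * (1 / 4) ^ J" by (simp add: power_divide)
        ultimately show ?thesis using r(2)[of J] by linarith
      qed
      moreover have "(\<lambda>J. 2 * C * M + r * (1 / 4) ^ J) \<longlonglongrightarrow> 2 * C * M + r * 0"
        by (intro tendsto_intros) auto
      ultimately show ?thesis
        using LIMSEQ_le_const[of "\<lambda>J. 2 * C * M + r * (1 / 4) ^ J" "2 * C * M + r * 0" "p f"] by simp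
    qed
    then show "\<exists>C\<ge>0. \<forall>f\<in>O_M. \<forall>M. bounded_C_k (Suc n) (\<lambda>x. M * bracket x ^ N) f \<longrightarrow> p f \<le> C * M"
      using C(1) by (intro exI[of _ "2 * C"]) auto
  qed
qed

text \<open>The dominating seminorm is the supremum of \<open>p\<close> over mollifications, which is defined for
  functions that are not smooth.\<close>

lemma dominating_seminorm:
  "\<exists>n q. 1 \<le> n \<and> cfun.seminorm_on (X_n n) q \<and> (\<forall>N. \<exists>C. \<forall>f\<in>X_nN n N. q f \<le> C * norm_nN n N f) \<and>
     (\<forall>f\<in>O_M. p f \<le> q f)"
proof -
  obtain n0 where n0: "\<And>N. \<exists>C\<ge>0. \<forall>f\<in>O_M. \<forall>M. bounded_C_k (Suc n0) (\<lambda>x. M * bracket x ^ N) f \<longrightarrow> p f \<le> C * M"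
    using main_estimate by blast
  \<comment> \<open>Being at least 1, this order supplies the C^1 functions that mollification makes
    smooth, and makes \<open>X_n\<close> one of the factors of the projective limit.\<close>
  define n where "n = Suc n0"
  define T where "T k = mollify (coords :: 'd list) (1 / real (Suc k)) (\<lambda>_. 0)" for k
  have d: "0 < 1 / real (Suc k)" "1 / real (Suc k) \<le> 1" for k by simp_all
  define q where "q f = (SUP k. p (T k f))" for f
  have TO: "T k f \<in> O_M" if "f \<in> X_n n" for k f
  proof -
    from that obtain N M where "bounded_C_k n (\<lambda>x. M * bracket x ^ N) f" using X_n_iff by blast
    then have "bounded_C_k (Suc 0) (\<lambda>x. M * bracket x ^ N) f"
      by (rule bounded_C_k_mono) (auto simp: n_def)
    from C_k_mollify_smooth[OF this d] show ?thesis unfolding T_def O_M_iff by blast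
  qed
  have bound: "\<exists>C\<ge>0. \<forall>f\<in>X_nN n N. \<forall>k. p (T k f) \<le> C * norm_nN n N f" for N
  proof -
    obtain C where C: "0 \<le> C" "\<And>f M. f \<in> O_M \<Longrightarrow> bounded_C_k n (\<lambda>x. M * bracket x ^ N) f \<Longrightarrow> p f \<le> C * M"
      using n0[of N] unfolding n_def by blast
    obtain c where c: "0 \<le> c" "\<And>n \<delta> M f. 0 < \<delta> \<Longrightarrow> \<delta> \<le> 1 \<Longrightarrow> bounded_C_k n (\<lambda>x. M * bracket x ^ N) f \<Longrightarrow>
       bounded_C_k n (\<lambda>x. c * M * bracket x ^ N) (mollify (coords :: 'd list) \<delta> (\<lambda>_. 0) f)"
      using bounded_C_k_mollify by blast
    have "p (T k f) \<le> C * c * norm_nN n N f" if f: "f \<in> X_nN n N" for f k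
    proof -
      have "f \<in> X_n n" using f X_nN_subset_X_n by blast
      from C(2)[OF TO[OF this, of k, unfolded T_def] c(2)[OF d norm_nN_bounded[OF f]]]
      show ?thesis by (simp add: T_def)
    qed
    then show ?thesis using C(1) c(1) by (intro exI[of _ "C * c"]) auto
  qed
  have bdd: "bdd_above (range (\<lambda>k. p (T k f)))" if "f \<in> X_n n" for f
  proof -
    obtain N where f: "f \<in> X_nN n N" using \<open>f \<in> X_n n\<close> unfolding X_n_def by blast
    obtain C where "\<forall>k. p (T k f) \<le> C * norm_nN n N f" using bound[of N] f by blast
    then show ?thesis by (intro bdd_aboveI2[of _ _ "C * norm_nN n N f"]) simp
  qed
  have le_q: "p (T k f) \<le> q f" if "f \<in> X_n n" for k f
    unfolding q_def by (rule cSUP_upper[OF UNIV_I bdd[OF that]])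
  have cont: "continuous_on UNIV f" if "f \<in> X_n n" for f
    using that X_n_iff bounded_C_k_continuous by blast
  have semi: "cfun.seminorm_on (X_n n) q"
  proof (rule cfun.seminorm_onI[OF subspace_X_n])
    fix f :: "real^'d \<Rightarrow> complex"
    assume f: "f \<in> X_n n"
    show "0 \<le> q f" using p_nonneg[OF TO[OF f, of 0]] le_q[OF f, of 0] by simp
    show "q (fscale c f) \<le> norm c * q f" for c
      unfolding q_def[of "fscale c f"]
    proof (rule cSUP_least)
      fix k
      have "p (T k (fscale c f)) = norm c * p (T k f)"
        unfolding T_def mollify_fscale using p_fscale[OF TO[OF f, of k]] by (simp add: T_def)
      then show "p (T k (fscale c f)) \<le> norm c * q f" using le_q[OF f] by (simp add: mult_left_mono)
    qed simp
    fix g :: "real^'d \<Rightarrow> complex"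
    assume g: "g \<in> X_n n"
    show "q (f + g) \<le> q f + q g"
      unfolding q_def[of "f + g"]
    proof (rule cSUP_least)
      fix k
      have "p (T k (f + g)) \<le> p (T k f) + p (T k g)"
        using p_add[OF TO[OF f, of k] TO[OF g, of k]] unfolding T_def mollify_add[OF cont[OF f] cont[OF g]] .
      then show "p (T k (f + g)) \<le> q f + q g" using le_q[OF f, of k] le_q[OF g, of k] by linarith
    qed simp
  qed
  have "p f \<le> q f" if f: "f \<in> O_M" for f
  proof -
    have fX: "f \<in> X_n n" using f O_M_eq_X_n by blast
    \<comment> \<open>One order beyond \<open>n\<close> is spent on the convergence of the
      mollifications; an element of \<open>O_M\<close> has it, and the resulting constant may depend
      on \<open>f\<close> because only the limit counts.\<close>
    obtain N M where M: "bounded_C_k (Suc n) (\<lambda>x. M * bracket x ^ N) f" using f O_M_iff by blast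
    obtain C where C: "0 \<le> C" "\<And>f M. f \<in> O_M \<Longrightarrow> bounded_C_k n (\<lambda>x. M * bracket x ^ N) f \<Longrightarrow> p f \<le> C * M"
      using n0[of N] unfolding n_def by blast
    obtain c where c: "0 \<le> c" "\<And>n \<delta> M f. 0 < \<delta> \<Longrightarrow> \<delta> \<le> 1 \<Longrightarrow> bounded_C_k (Suc n) (\<lambda>x. M * bracket x ^ N) f \<Longrightarrow>
       bounded_C_k n (\<lambda>x. c * (\<delta> * M) * bracket x ^ N) (f - mollify (coords :: 'd list) \<delta> (\<lambda>_. 0) f)"
      using bounded_C_k_mollify_diff by blast
    have "p f \<le> C * c * M * (1 / real (Suc k)) + q f" for k
    proof -
      have O: "f - T k f \<in> O_M" by (rule cfun.subspace_diff[OF subspace_O_M f TO[OF fX]])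
      have "p (f - T k f) \<le> C * (c * (1 / real (Suc k) * M))"
        using O unfolding T_def by (intro C c d M)
      moreover have "p ((f - T k f) + T k f) \<le> p (f - T k f) + p (T k f)"
        by (rule p_add[OF O TO[OF fX]])
      ultimately show ?thesis
        using le_q[OF fX, of k] by (simp only: diff_add_cancel mult_ac)
    qed
    moreover have "(\<lambda>k. C * c * M * (1 / real (Suc k)) + q f) \<longlonglongrightarrow> C * c * M * 0 + q f"
      by (intro tendsto_intros LIMSEQ_Suc[OF lim_1_over_n])
    ultimately show ?thesis
      using LIMSEQ_le_const[of "\<lambda>k. C * c * M * (1 / real (Suc k)) + q f" "C * c * M * 0 + q f" "p f"] by simp
  qed
  moreover have "\<exists>C. \<forall>f\<in>X_nN n N. q f \<le> C * norm_nN n N f" for N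
  proof -
    obtain C where "\<forall>f\<in>X_nN n N. \<forall>k. p (T k f) \<le> C * norm_nN n N f" using bound[of N] by blast
    then show ?thesis unfolding q_def by (intro exI[of _ C] ballI cSUP_least) auto
  qed
  moreover have "1 \<le> n" by (simp add: n_def)
  ultimately show ?thesis using semi by blast
qed

end

section \<open>Continuity of the gauge of a set that absorbs all bounded sets\<close>

theorem proposition2:
  shows "cfun.locally_convex_space (O_M :: (real^'d::finite \<Rightarrow> complex) set) O_M_topology \<and>
         cfun.bornological (O_M_topology :: (real^'d \<Rightarrow> complex) topology)"
proof (intro conjI locally_convex_space_O_M)
  show "cfun.bornological (O_M_topology :: (real^'d \<Rightarrow> complex) topology)"
    unfolding cfun.bornological_def topspace_O_M
  proof (intro allI impI; elim conjE)
    fix A :: "(real^'d \<Rightarrow> complex) set"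
    assume AO: "A \<subseteq> O_M" and A: "cfun.absolutely_convex A"
      and abs: "\<forall>B. cfun.bounded_in O_M_topology B \<longrightarrow> cfun.absorbs A B"
    have absb: "\<exists>r>0. B \<subseteq> fscale (of_real r) ` A"
      if B: "\<And>k. \<exists>N M. \<forall>f\<in>B. bounded_C_k k (\<lambda>x. M * bracket x ^ N) f" for B
    proof -
      obtain r where "r > 0" "\<forall>c. norm c \<ge> r \<longrightarrow> B \<subseteq> fscale c ` A"
        using abs bounded_in_O_M[OF B] unfolding cfun.absorbs_def by blast
      then show ?thesis by (intro exI[of _ r]) (simp add: norm_of_real)
    qed
    have absorbing: "\<exists>t>0. f \<in> fscale (of_real t) ` A" if "f \<in> O_M" for f
      using absb[of "{f}"] that by (auto simp: O_M_iff)
    define p where "p = cfun.gauge_of A"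
    interpret bounded_seminorm p
    proof
      show "cfun.seminorm_on O_M p"
        unfolding p_def by (rule cfun.seminorm_gauge_of[OF A subspace_O_M absorbing])
      fix B :: "(real^'d \<Rightarrow> complex) set"
      assume "\<And>k. \<exists>N M. \<forall>f\<in>B. bounded_C_k k (\<lambda>x. M * bracket x ^ N) f"
      from absb[OF this] show "\<exists>r. \<forall>f\<in>B. p f \<le> r"
        unfolding p_def by (meson cfun.gauge_of_le subsetD)
    qed
    obtain n q where n: "1 \<le> n" and q: "cfun.seminorm_on (X_n n) q"
      "\<And>N. \<exists>C. \<forall>f\<in>X_nN n N. q f \<le> C * norm_nN n N f" and pq: "\<And>f. f \<in> O_M \<Longrightarrow> p f \<le> q f"
      using dominating_seminorm by blast
    let ?T = "cfun.seminorm_topology (X_n n) q"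
    \<comment> \<open>The unit ball of \<open>q\<close> is open in an admissible topology, hence in
      \<open>top_n n\<close>, and \<open>1 \<le> n\<close> makes its trace on \<open>O_M\<close> a
      generating open set of the projective limit.\<close>
    define W where "W = {f \<in> X_n n. q (f - 0) < 1}"
    have "openin ?T W"
      unfolding W_def by (rule cfun.openin_seminorm_ball[OF q(1) subspace_X_n cfun.subspace_0[OF subspace_X_n]])
    moreover have "?T \<in> admissible n" by (rule seminorm_topology_admissible[OF q])
    ultimately have "openin (top_n n) (X_n n \<inter> W)"
      unfolding top_n_eq by (intro topology_generated_by_Basis) blast
    then have "openin O_M_topology (O_M \<inter> (X_n n \<inter> W))"
      unfolding O_M_topology_eq using n by (intro topology_generated_by_Basis) blast
    moreover have "0 \<in> O_M \<inter> (X_n n \<inter> W)"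
      using cfun.seminorm_zero[OF q(1) subspace_X_n]
      by (simp add: W_def cfun.subspace_0[OF subspace_O_M] cfun.subspace_0[OF subspace_X_n])
    moreover have "O_M \<inter> (X_n n \<inter> W) \<subseteq> A"
    proof
      fix f assume f: "f \<in> O_M \<inter> (X_n n \<inter> W)"
      then have "cfun.gauge_of A f < 1" using pq[of f] by (auto simp: W_def p_def)
      \<comment> \<open>A gauge below 1 puts \<open>f\<close> into some \<open>t A\<close> with t <
        1, and absolute convexity carries it into \<open>A\<close> itself.\<close>
      then have "f \<in> fscale (of_real 1) ` A"
        using f by (intro cfun.gauge_of_less[OF A absorbing]) auto
      then show "f \<in> A" by simp
    qed
    ultimately show "cfun.nbhd_zero O_M_topology A"
      unfolding cfun.nbhd_zero_def topspace_O_M using AO by blast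
  qed
qed

end
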